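(* Let $h_0>0$, $a,b\in\mathbb{R}$ with $a<b$, and $V\in\mathcal{C}^\infty([a,b];\mathbb{R})$ with $V'(x)\neq0$ for every $x\in[a,b]$. For $h\in(0,h_0)$ let $$\mathcal{A}_h=-h^2\frac{d^2}{dx^2}+iV(x),\qquad \mathcal{D}(\mathcal{A}_h)=H_0^1(a,b)\cap H^2(a,b),$$ acting on $L^2((a,b);\mathbb{C})$. Then $$\lim_{h\to0}\frac{1}{h^{2/3}}\inf\operatorname{Re}\sigma(\mathcal{A}_h)=\frac{|\mu_1|}{2}J^{2/3},$$ where $J=\min(|V'(a)|,|V'(b)|)$ and $\mu_1<0$ is the rightmost zero of the Airy function $\mathrm{Ai}$.
   Context: $\sigma(\cdot)$ denotes the spectrum; $\inf\operatorname{Re}\sigma(\mathcal{A}_h)=\inf\{\operatorname{Re}\lambda:\lambda\in\sigma(\mathcal{A}_h)\}$. Functions are complex-valued. *)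

theory Defs
  imports "HOL-Analysis.Analysis"
begin

(* On a closed interval the derivatives at the end points are one-sided, so that
   smooth_on {a..b} is the space C^\<infinity>([a,b]). *)
definition smooth_on :: "real set \<Rightarrow> (real \<Rightarrow> 'a::real_normed_vector) \<Rightarrow> bool" where
  "smooth_on S f \<longleftrightarrow>
     (\<exists>D :: nat \<Rightarrow> real \<Rightarrow> 'a. (\<forall>x\<in>S. D 0 x = f x) \<and>
        (\<forall>k. \<forall>x\<in>S. (D k has_vector_derivative D (Suc k) x) (at x within S)))"

(* The elements of L^2((a,b);C) are represented by functions on the line, of which only the
   values on (a,b), up to almost everywhere equality, are relevant.  All notions below
   respect this identification. *)
definition L2 :: "real \<Rightarrow> real \<Rightarrow> (real \<Rightarrow> complex) set" where
  "L2 a b = {f. f \<in> borel_measurable (lebesgue_on {a<..<b}) \<and>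
                integrable (lebesgue_on {a<..<b}) (\<lambda>x. (cmod (f x))\<^sup>2)}"

definition norm_L2 :: "real \<Rightarrow> real \<Rightarrow> (real \<Rightarrow> complex) \<Rightarrow> real" where
  "norm_L2 a b f = sqrt (LINT x|lebesgue_on {a<..<b}. (cmod (f x))\<^sup>2)"

definition test_functions :: "real \<Rightarrow> real \<Rightarrow> (real \<Rightarrow> complex) set" where
  "test_functions a b = {\<phi>. smooth_on UNIV \<phi> \<and>
     (\<exists>K. compact K \<and> K \<subseteq> {a<..<b} \<and> (\<forall>x. x \<notin> K \<longrightarrow> \<phi> x = 0))}"

definition derivative_of :: "(real \<Rightarrow> complex) \<Rightarrow> real \<Rightarrow> complex" where
  "derivative_of \<phi> = (\<lambda>x. vector_derivative \<phi> (at x))"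

(* v is the distributional derivative of u on (a,b); both are in L^2(a,b). *)
definition weak_deriv :: "real \<Rightarrow> real \<Rightarrow> (real \<Rightarrow> complex) \<Rightarrow> (real \<Rightarrow> complex) \<Rightarrow> bool" where
  "weak_deriv a b u v \<longleftrightarrow> u \<in> L2 a b \<and> v \<in> L2 a b \<and>
     (\<forall>\<phi>\<in>test_functions a b.
        (LINT x|lebesgue_on {a<..<b}. u x * derivative_of \<phi> x) =
        - (LINT x|lebesgue_on {a<..<b}. v x * \<phi> x))"

definition H1 :: "real \<Rightarrow> real \<Rightarrow> (real \<Rightarrow> complex) set" where
  "H1 a b = {u. \<exists>v. weak_deriv a b u v}"

definition H2 :: "real \<Rightarrow> real \<Rightarrow> (real \<Rightarrow> complex) set" where
  "H2 a b = {u. \<exists>v\<in>H1 a b. weak_deriv a b u v}"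

(* The closure of the test functions in the H^1 norm. *)
definition H10 :: "real \<Rightarrow> real \<Rightarrow> (real \<Rightarrow> complex) set" where
  "H10 a b = {u. \<exists>v. weak_deriv a b u v \<and>
     (\<forall>\<epsilon>>0. \<exists>\<phi>\<in>test_functions a b.
        sqrt ((norm_L2 a b (\<lambda>x. u x - \<phi> x))\<^sup>2 +
              (norm_L2 a b (\<lambda>x. v x - derivative_of \<phi> x))\<^sup>2) < \<epsilon>)}"

(* Unbounded operators on L^2(a,b) are given by their graphs, since the weak derivative
   is only determined almost everywhere. *)
definition schrodinger_op ::
    "real \<Rightarrow> real \<Rightarrow> (real \<Rightarrow> real) \<Rightarrow> real \<Rightarrow> ((real \<Rightarrow> complex) \<times> (real \<Rightarrow> complex)) set" where
  "schrodinger_op a b V h = {(u, g). u \<in> H10 a b \<inter> H2 a b \<and> g \<in> L2 a b \<and>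
     (\<exists>v w. weak_deriv a b u v \<and> weak_deriv a b v w \<and>
        (AE x in lebesgue_on {a<..<b}.
           g x = - (complex_of_real h)\<^sup>2 * w x + \<i> * complex_of_real (V x) * u x))}"

(* T - z maps the domain of T bijectively onto L^2(a,b), and its inverse is bounded. *)
definition resolvent_set ::
    "real \<Rightarrow> real \<Rightarrow> ((real \<Rightarrow> complex) \<times> (real \<Rightarrow> complex)) set \<Rightarrow> complex set" where
  "resolvent_set a b T = {z.
     (\<forall>f\<in>L2 a b. \<exists>(u, g)\<in>T. AE x in lebesgue_on {a<..<b}. g x - z * u x = f x) \<and>
     (\<forall>(u, g)\<in>T. (AE x in lebesgue_on {a<..<b}. g x - z * u x = 0) \<longrightarrow>
        (AE x in lebesgue_on {a<..<b}. u x = 0)) \<and>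
     (\<exists>C. \<forall>(u, g)\<in>T. norm_L2 a b u \<le> C * norm_L2 a b (\<lambda>x. g x - z * u x))}"

definition spectrum_of ::
    "real \<Rightarrow> real \<Rightarrow> ((real \<Rightarrow> complex) \<times> (real \<Rightarrow> complex)) set \<Rightarrow> complex set" where
  "spectrum_of a b T = - resolvent_set a b T"

(* The integral over [0,\<infinity>) is only conditionally convergent. *)
definition airy_Ai :: "real \<Rightarrow> real" where
  "airy_Ai x = (1 / pi) * Lim at_top (\<lambda>R. integral {0..R} (\<lambda>t. cos (t ^ 3 / 3 + x * t)))"

end

theory Submission
  imports Defs "HOL-Complex_Analysis.Complex_Analysis" "HOL-Real_Asymp.Real_Asymp"
begin

text \<open>Put \<open>\<delta> = h powr (2/3)\<close>.  In the variable \<open>t = (x - x0) / \<delta>\<close> the eigenvalue equation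
  becomes \<open>u'' = (\<i> W - \<nu>) u\<close> with \<open>W t\<close> close to \<open>V' x0 * t\<close>.  If \<open>u\<close> vanishes at a far
  endpoint on the right of \<open>0\<close>, energy identities bound its \<open>L\<^sup>2\<close> norm by its data at \<open>0\<close>, and the
  Wronskian with the decaying solution \<open>f\<close> of the limit equation, an Airy function on the ray of
  angle \<open>pi / 6\<close>, must then be almost zero.  The same holds on the left for the conjugate
  reflection.  If both endpoints are far, the two conditions contradict
  \<open>Re (f' 0 * cnj (f 0)) \<noteq> 0\<close>, a quantity which does not depend on the real number \<open>\<nu>\<close>; so eigenvalues
  with small real part live near \<open>\<i> V a\<close> or \<open>\<i> V b\<close>, and there the Dirichlet condition forces
  \<open>f 0\<close> to be almost zero, that is, \<open>\<nu>\<close> to be close to a multiple of a zero of the Airy function.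
  Conversely, near such a zero the logarithmic derivative at the endpoint of the solution shot from
  the other end would violate the maximum modulus principle if there were no eigenvalue.\<close>

subsection \<open>Linear second order equations\<close>

text \<open>The operator is not normal, so min-max principles and resolvent perturbation say nothing
  directly about its spectrum; every estimate is therefore made on exact solutions of the
  differential equation. What replaces self-adjointness is that an eigenvalue \<open>z\<close>
  satisfies \<open>Im z = V x0\<close> for some \<open>x0\<close> in the interval: with this base
  point the parameter \<open>\<nu>\<close> is real, and this is why conjugation and reflection lead
  back to the same profile. All constants must be uniform in \<open>x0\<close>,
  \<open>\<delta>\<close> and \<open>\<nu>\<close>, since \<open>x0\<close> moves with the
  eigenvalue. The factor 1/2 of the limit is \<open>- cos (2 * pi / 3)\<close>: at the base point
  the profile is \<open>Airy\<close> at \<open>\<nu>\<close> rotated by \<open>2 * pi / 3\<close>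
  and rescaled, and all zeros of \<open>Airy\<close> are real. That \<open>Airy 0\<close> is not
  zero comes from the assumption that the rightmost zero is negative; no numerical value of the Airy
  function enters. The functional analysis is confined to one statement, that the spectrum is the
  set of Dirichlet eigenvalues; there symmetry for the bilinear pairing, without conjugation, takes
  the place of an adjoint.\<close>

definition ode_sol ::
    "real \<Rightarrow> real \<Rightarrow> (real \<Rightarrow> complex) \<Rightarrow> (real \<Rightarrow> complex) \<Rightarrow> (real \<Rightarrow> complex) \<Rightarrow> bool" where
  "ode_sol a b q y y' \<longleftrightarrow> (\<forall>x\<in>{a..b}.
     (y has_vector_derivative y' x) (at x within {a..b}) \<and>
     (y' has_vector_derivative q x * y x) (at x within {a..b}))"

lemma nonincreasing_within:
  fixes f :: "real \<Rightarrow> real"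
  assumes "a \<le> b" and "\<And>x. x \<in> {a..b} \<Longrightarrow> (f has_real_derivative f' x) (at x within {a..b})"
    and "\<And>x. x \<in> {a..b} \<Longrightarrow> f' x \<le> 0"
  shows "f b \<le> f a"
proof -
  have "\<exists>x\<in>{a..b}. f b - f a = f' x * (b - a)"
    by (rule mvt_very_simple[OF assms(1)])
      (use assms(2) in \<open>auto simp: has_field_derivative_def\<close>)
  then show ?thesis
    using assms(1,3) by (metis diff_ge_0_iff_ge diff_le_0_iff_le mult_nonpos_nonneg)
qed

lemma has_real_derivative_norm_sq:
  fixes f :: "real \<Rightarrow> 'a::real_inner"
  assumes "(f has_vector_derivative f') (at x within A)"
  shows "((\<lambda>x. (norm (f x))\<^sup>2) has_real_derivative 2 * (f x \<bullet> f')) (at x within A)"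
proof -
  have "((\<lambda>x. f x \<bullet> f x) has_derivative (\<lambda>h. f x \<bullet> (h *\<^sub>R f') + (h *\<^sub>R f') \<bullet> f x)) (at x within A)"
    using assms unfolding has_vector_derivative_def by (intro has_derivative_inner)
  moreover have "(\<lambda>h. f x \<bullet> (h *\<^sub>R f') + (h *\<^sub>R f') \<bullet> f x) = (*) (2 * (f x \<bullet> f'))"
    by (auto simp: inner_commute algebra_simps)
  ultimately show ?thesis
    by (simp add: has_field_derivative_def power2_norm_eq_inner)
qed

text \<open>Cauchy-Schwarz and Young give \<open>E' \<le> (k + 2) * E + \<gamma>\<^sup>2\<close> for
  the energy \<open>E\<close>: the potential costs \<open>k\<close>, the term
  \<open>2 * (d \<bullet> d')\<close> and the forcing cost one each. The forcing serves to compare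
  solutions at two spectral parameters; without it this is uniqueness.\<close>

lemma gronwall_second_order:
  fixes d d' q g :: "real \<Rightarrow> complex"
  assumes "a \<le> b"
    and d: "\<And>x. x \<in> {a..b} \<Longrightarrow> (d has_vector_derivative d' x) (at x within {a..b})"
    and d': "\<And>x. x \<in> {a..b} \<Longrightarrow> (d' has_vector_derivative q x * d x + g x) (at x within {a..b})"
    and q: "\<And>x. x \<in> {a..b} \<Longrightarrow> norm (q x) \<le> k"
    and g: "\<And>x. x \<in> {a..b} \<Longrightarrow> norm (g x) \<le> \<gamma>"
    and x: "x \<in> {a..b}"
  shows "(norm (d x))\<^sup>2 + (norm (d' x))\<^sup>2
           \<le> exp ((k + 2) * (x - a)) * ((norm (d a))\<^sup>2 + (norm (d' a))\<^sup>2 + \<gamma>\<^sup>2 * (x - a))"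
proof -
  define E where "E = (\<lambda>x. (norm (d x))\<^sup>2 + (norm (d' x))\<^sup>2)"
  define E' where "E' = (\<lambda>x. 2 * (d x \<bullet> d' x) + 2 * (d' x \<bullet> (q x * d x + g x)))"
  \<comment> \<open>The forcing is subtracted as the linear term
    \<open>\<gamma>\<^sup>2 * (t - a)\<close>, which suffices because the exponential weight is at
    most 1.\<close>
  define \<Phi> where "\<Phi> = (\<lambda>t. exp (- (k + 2) * (t - a)) * E t - \<gamma>\<^sup>2 * (t - a))"
  define \<Phi>' where
    "\<Phi>' = (\<lambda>t. exp (- (k + 2) * (t - a)) * (E' t - (k + 2) * E t) - \<gamma>\<^sup>2)"
  have k: "0 \<le> k"
    using q[OF x] norm_ge_zero order_trans by blast
  have E'_bound: "E' t \<le> (k + 2) * E t + \<gamma>\<^sup>2" if t: "t \<in> {a..b}" for t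
  proof -
    have 1: "2 * (d t \<bullet> d' t) \<le> E t"
      unfolding E_def
      using norm_cauchy_schwarz[of "d t" "d' t"] sum_squares_bound[of "norm (d t)" "norm (d' t)"]
      by linarith
    have "2 * (d' t \<bullet> (q t * d t)) \<le> 2 * (norm (d' t) * (k * norm (d t)))"
      using norm_cauchy_schwarz[of "d' t" "q t * d t"]
        mult_left_mono[OF mult_right_mono[OF q[OF t] norm_ge_zero[of "d t"]] norm_ge_zero[of "d' t"]]
      by (simp add: norm_mult)
    also have "\<dots> = k * (2 * norm (d t) * norm (d' t))"
      by simp
    also have "\<dots> \<le> k * E t"
      unfolding E_def using sum_squares_bound[of "norm (d t)" "norm (d' t)"] k
      by (intro mult_left_mono) auto
    finally have 2: "2 * (d' t \<bullet> (q t * d t)) \<le> k * E t" .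
    have "2 * (d' t \<bullet> g t) \<le> (norm (d' t))\<^sup>2 + (norm (g t))\<^sup>2"
      using norm_cauchy_schwarz[of "d' t" "g t"] sum_squares_bound[of "norm (d' t)" "norm (g t)"]
      by linarith
    also have "\<dots> \<le> E t + \<gamma>\<^sup>2"
      unfolding E_def using power_mono[OF g[OF t], of 2]
      by (smt (verit) norm_ge_zero zero_le_power2)
    finally show ?thesis
      using 1 2 unfolding E'_def inner_add_right by (simp add: algebra_simps)
  qed
  have der_E: "(E has_real_derivative E' t) (at t within {a..b})" if "t \<in> {a..b}" for t
    unfolding E_def E'_def
    by (intro DERIV_add has_real_derivative_norm_sq d d' that)
  have der: "(\<Phi> has_real_derivative \<Phi>' t) (at t within {a..b})" if "t \<in> {a..b}" for t
    unfolding \<Phi>_def \<Phi>'_def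
    by (rule derivative_eq_intros der_E that refl | simp add: algebra_simps)+
  have "\<Phi> x \<le> \<Phi> a"
  proof (rule nonincreasing_within[where f = \<Phi> and f' = \<Phi>'])
    show "a \<le> x" using x by simp
    show "(\<Phi> has_real_derivative \<Phi>' t) (at t within {a..x})" if "t \<in> {a..x}" for t
      by (rule DERIV_subset[OF der]) (use that x in auto)
    show "\<Phi>' t \<le> 0" if "t \<in> {a..x}" for t
    proof -
      have "exp (- (k + 2) * (t - a)) * (E' t - (k + 2) * E t) \<le> exp (- (k + 2) * (t - a)) * \<gamma>\<^sup>2"
        using E'_bound[of t] that x by (intro mult_left_mono) auto
      also have "\<dots> \<le> 1 * \<gamma>\<^sup>2"
        using k that by (intro mult_right_mono) (auto intro!: mult_nonpos_nonneg)
      finally show ?thesis by (simp add: \<Phi>'_def)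
    qed
  qed
  then have "exp (- (k + 2) * (x - a)) * E x \<le> E a + \<gamma>\<^sup>2 * (x - a)"
    by (simp add: \<Phi>_def)
  then have "exp ((k + 2) * (x - a)) * (exp (- (k + 2) * (x - a)) * E x)
      \<le> exp ((k + 2) * (x - a)) * (E a + \<gamma>\<^sup>2 * (x - a))"
    by (intro mult_left_mono) auto
  moreover have "exp ((k + 2) * (x - a)) * exp (- (k + 2) * (x - a)) = 1"
    by (simp add: algebra_simps flip: exp_add)
  ultimately show ?thesis
    by (simp only: mult.assoc[symmetric] mult_1_left E_def)
qed

text \<open>The gain \<open>1 / k\<close> makes the Picard operator a contraction on an interval of
  any length, without patching short intervals.\<close>

lemma exp_weight_integral_bound:
  fixes v :: "real \<Rightarrow> complex"
  assumes "a \<le> \<tau>" "k > 0" "continuous_on {a..\<tau>} v" "\<And>s. s \<in> {a..\<tau>} \<Longrightarrow> norm (v s) \<le> M"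
  shows "norm (exp (- k * \<tau>) *\<^sub>R integral {a..\<tau>} (\<lambda>s. exp (k * s) *\<^sub>R v s)) \<le> M / k"
proof -
  have M: "0 \<le> M"
    using assms(1,4) norm_ge_zero order_trans by (metis atLeastAtMost_iff order_refl)
  have "((\<lambda>s. exp (k * s) * M) has_integral (exp (k * \<tau>) * M / k - exp (k * a) * M / k)) {a..\<tau>}"
    by (rule fundamental_theorem_of_calculus[OF assms(1)])
      (use assms(2) in \<open>auto intro!: derivative_eq_intros
        simp flip: has_real_derivative_iff_has_vector_derivative\<close>)
  then have "integral {a..\<tau>} (\<lambda>s. exp (k * s) * M) = exp (k * \<tau>) * M / k - exp (k * a) * M / k"
    and "(\<lambda>s. exp (k * s) * M) integrable_on {a..\<tau>}"
    by (auto simp: has_integral_iff)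
  moreover have "(\<lambda>s. exp (k * s) *\<^sub>R v s) integrable_on {a..\<tau>}"
    by (intro integrable_continuous_real continuous_intros assms)
  ultimately have "norm (integral {a..\<tau>} (\<lambda>s. exp (k * s) *\<^sub>R v s)) \<le> exp (k * \<tau>) * M / k"
    using assms(2,4) M
    by (intro order_trans[OF integral_norm_bound_integral]) (auto intro: mult_left_mono)
  then have "exp (- k * \<tau>) * norm (integral {a..\<tau>} (\<lambda>s. exp (k * s) *\<^sub>R v s))
      \<le> exp (- k * \<tau>) * (exp (k * \<tau>) * M / k)"
    by (intro mult_left_mono) auto
  also have "\<dots> = M / k"
    by (simp add: exp_minus)
  finally show ?thesis by simp
qed

text \<open>Picard iteration, as a contraction for the weighted supremum norm of
  \<open>exp (- k t) (y, y')\<close> with \<open>k\<close> large.\<close>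

lemma ode_sol_exists:
  fixes q :: "real \<Rightarrow> complex"
  assumes "a \<le> b" and q: "continuous_on {a..b} q"
  shows "\<exists>y y'. ode_sol a b q y y' \<and> y a = c \<and> y' a = c'"
proof -
  obtain K where K: "K > 0" "\<And>x. x \<in> {a..b} \<Longrightarrow> norm (q x) \<le> K"
    using compact_imp_bounded[OF compact_continuous_image[OF q compact_Icc]]
    unfolding bounded_pos by blast
  \<comment> \<open>The two components of the Picard map are Lipschitz with constants
    \<open>1 / k\<close> and \<open>K / k\<close>; this \<open>k\<close> makes their sum
    1/2.\<close>
  define k where "k = 2 * (1 + K)"
  have k: "k > 0" using K(1) by (simp add: k_def)
  define I0 where "I0 = (\<lambda>(z :: real \<Rightarrow>\<^sub>C (complex \<times> complex)) t.
    exp (- k * t) *\<^sub>R (c + integral {a..t} (\<lambda>s. exp (k * s) *\<^sub>R snd (apply_bcontfun z s))))"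
  define I1 where "I1 = (\<lambda>(z :: real \<Rightarrow>\<^sub>C (complex \<times> complex)) t.
    exp (- k * t) *\<^sub>R (c' + integral {a..t} (\<lambda>s. exp (k * s) *\<^sub>R (q s * fst (apply_bcontfun z s)))))"
  have int0: "(\<lambda>s. exp (k * s) *\<^sub>R snd (apply_bcontfun z s)) integrable_on {a..t}"
    "continuous_on {a..t} (\<lambda>s. exp (k * s) *\<^sub>R snd (apply_bcontfun z s))"
    for z :: "real \<Rightarrow>\<^sub>C (complex \<times> complex)" and t
    by (intro integrable_continuous_real continuous_intros continuous_on_apply_bcontfun)+
  have int1: "(\<lambda>s. exp (k * s) *\<^sub>R (q s * fst (apply_bcontfun z s))) integrable_on {a..t}"
    "continuous_on {a..t} (\<lambda>s. exp (k * s) *\<^sub>R (q s * fst (apply_bcontfun z s)))" if "t \<le> b"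
    for z :: "real \<Rightarrow>\<^sub>C (complex \<times> complex)" and t
    using that continuous_on_subset[OF q, of "{a..t}"]
    by (intro integrable_continuous_real continuous_intros continuous_on_apply_bcontfun; force)+
  \<comment> \<open>Composing with \<open>clamp\<close> extends the iterate to the whole line, so
    that the fixed point can be sought in the complete space of bounded continuous
    functions.\<close>
  have "\<exists>w :: real \<Rightarrow>\<^sub>C (complex \<times> complex). \<forall>t. apply_bcontfun w t = (I0 z (clamp a b t), I1 z (clamp a b t))"
    for z
  proof -
    have "continuous_on (cbox a b) (\<lambda>t. (I0 z t, I1 z t))"
      unfolding I0_def I1_def cbox_interval using int0 int1[of b]
      by (intro continuous_intros indefinite_integral_continuous_1) auto
    then show ?thesis
      by (rule continuous_on_cbox_bcontfunE) blast
  qed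
  then obtain T :: "(real \<Rightarrow>\<^sub>C (complex \<times> complex)) \<Rightarrow> (real \<Rightarrow>\<^sub>C (complex \<times> complex))" where
    T: "\<And>z t. apply_bcontfun (T z) t = (I0 z (clamp a b t), I1 z (clamp a b t))"
    by metis
  have dist_T: "dist (T z) (T w) \<le> 1/2 * dist z w" for z w
  proof (rule dist_bound)
    fix t
    define \<tau> where "\<tau> = clamp a b t"
    have \<tau>: "\<tau> \<in> {a..b}"
      unfolding \<tau>_def cbox_interval[symmetric] using assms(1) by (intro clamp_in_interval) auto
    have d: "norm (apply_bcontfun z s - apply_bcontfun w s) \<le> dist z w" for s
      using dist_bounded[of z s w] by (simp add: dist_norm)
    have fst_snd: "norm (fst (apply_bcontfun z s) - fst (apply_bcontfun w s)) \<le> dist z w" "norm (snd (apply_bcontfun z s) - snd (apply_bcontfun w s)) \<le> dist z w" for s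
      using d[of s] dist_fst_le[of "apply_bcontfun z s" "apply_bcontfun w s"]
        dist_snd_le[of "apply_bcontfun z s" "apply_bcontfun w s"]
      by (auto simp: dist_norm intro: order_trans)
    have "I0 z \<tau> - I0 w \<tau> =
        exp (- k * \<tau>) *\<^sub>R integral {a..\<tau>} (\<lambda>s. exp (k * s) *\<^sub>R (snd (apply_bcontfun z s) - snd (apply_bcontfun w s)))"
      unfolding I0_def
      by (simp add: scaleR_right_diff_distrib integral_diff[OF int0(1)[of z \<tau>] int0(1)[of w \<tau>]]
        scaleR_add_right)
    also have "norm \<dots> \<le> dist z w / k"
      using \<tau> k fst_snd by (intro exp_weight_integral_bound) (auto intro!: continuous_intros)
    finally have 1: "norm (I0 z \<tau> - I0 w \<tau>) \<le> dist z w / k" .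
    have "I1 z \<tau> - I1 w \<tau> =
        exp (- k * \<tau>) *\<^sub>R integral {a..\<tau>} (\<lambda>s. exp (k * s) *\<^sub>R (q s * (fst (apply_bcontfun z s) - fst (apply_bcontfun w s))))"
      unfolding I1_def using \<tau>
      by (simp add: scaleR_right_diff_distrib right_diff_distrib
        integral_diff[OF int1(1)[of \<tau> z] int1(1)[of \<tau> w]] scaleR_add_right)
    also have "norm \<dots> \<le> (K * dist z w) / k"
    proof (rule exp_weight_integral_bound)
      show "continuous_on {a..\<tau>} (\<lambda>s. q s * (fst (apply_bcontfun z s) - fst (apply_bcontfun w s)))"
        using continuous_on_subset[OF q, of "{a..\<tau>}"] \<tau> by (auto intro!: continuous_intros)
      show "norm (q s * (fst (apply_bcontfun z s) - fst (apply_bcontfun w s))) \<le> K * dist z w" if "s \<in> {a..\<tau>}" for s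
        unfolding norm_mult using that \<tau> K fst_snd by (intro mult_mono) auto
    qed (use \<tau> k in auto)
    finally have 2: "norm (I1 z \<tau> - I1 w \<tau>) \<le> (K * dist z w) / k" .
    have "dist (apply_bcontfun (T z) t) (apply_bcontfun (T w) t) \<le> norm (I0 z \<tau> - I0 w \<tau>) + norm (I1 z \<tau> - I1 w \<tau>)"
      unfolding T \<tau>_def[symmetric] dist_norm using norm_Pair_le by (simp add: norm_Pair_le)
    also have "\<dots> \<le> (1 + K) * dist z w / k"
      using 1 2 by (simp add: add_divide_distrib distrib_right)
    also have "\<dots> = 1/2 * dist z w"
      using K(1) by (simp add: k_def field_simps)
    finally show "dist (apply_bcontfun (T z) t) (apply_bcontfun (T w) t) \<le> 1/2 * dist z w" .
  qed
  then obtain z where z: "T z = z"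
    using banach_fix_type[of "1/2" T] by auto
  have z_eq: "apply_bcontfun z t = (I0 z t, I1 z t)" if "t \<in> {a..b}" for t
    using T[of z t] that z by simp
  define y where "y = (\<lambda>t. c + integral {a..t} (\<lambda>s. exp (k * s) *\<^sub>R snd (apply_bcontfun z s)))"
  define y' where "y' = (\<lambda>t. c' + integral {a..t} (\<lambda>s. exp (k * s) *\<^sub>R (q s * fst (apply_bcontfun z s))))"
  have "y t = exp (k * t) *\<^sub>R fst (apply_bcontfun z t)" "y' t = exp (k * t) *\<^sub>R snd (apply_bcontfun z t)" if "t \<in> {a..b}" for t
    unfolding z_eq[OF that] I0_def I1_def y_def y'_def by (simp_all add: exp_minus)
  then have "ode_sol a b q y y'"
    unfolding ode_sol_def
  proof (intro ballI conjI)
    fix x assume x: "x \<in> {a..b}"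
      and eq: "\<And>t. t \<in> {a..b} \<Longrightarrow> y t = exp (k * t) *\<^sub>R fst (apply_bcontfun z t)"
        "\<And>t. t \<in> {a..b} \<Longrightarrow> y' t = exp (k * t) *\<^sub>R snd (apply_bcontfun z t)"
    have "(y has_vector_derivative 0 + exp (k * x) *\<^sub>R snd (apply_bcontfun z x)) (at x within {a..b})"
      unfolding y_def
      by (intro derivative_intros integral_has_vector_derivative[OF int0(2) x])
    then show "(y has_vector_derivative y' x) (at x within {a..b})"
      using eq(2)[OF x] by simp
    have "(y' has_vector_derivative 0 + exp (k * x) *\<^sub>R (q x * fst (apply_bcontfun z x))) (at x within {a..b})"
      unfolding y'_def
      by (intro derivative_intros integral_has_vector_derivative[OF int1(2) x]) simp
    then show "(y' has_vector_derivative q x * y x) (at x within {a..b})"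
      using eq(1)[OF x] by simp
  qed
  moreover have "y a = c" "y' a = c'"
    by (simp_all add: y_def y'_def)
  ultimately show ?thesis by blast
qed

lemma ode_sol_continuous:
  assumes "ode_sol a b q y y'"
  shows "continuous_on {a..b} y" "continuous_on {a..b} y'"
  using assms unfolding ode_sol_def
  by (auto intro!: has_vector_derivative_continuous simp: continuous_on_eq_continuous_within)

lemma ode_sol_subinterval:
  assumes "ode_sol a b q y y'" "a \<le> c" "d \<le> b"
  shows "ode_sol c d q y y'"
  using assms unfolding ode_sol_def
  by (meson atLeastatMost_subset_iff atLeastAtMost_iff has_vector_derivative_within_subset order_trans)

lemma ode_sol_scale:
  assumes "ode_sol a b q y y'"
  shows "ode_sol a b q (\<lambda>x. c * y x) (\<lambda>x. c * y' x)"
  using assms unfolding ode_sol_def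
  by (auto intro!: derivative_eq_intros simp: mult.left_commute)

lemma ode_sol_affine:
  assumes "ode_sol a b q y y'" "\<And>t. t \<in> {c..d} \<Longrightarrow> r * t + s \<in> {a..b}"
  shows "ode_sol c d (\<lambda>t. (of_real r)\<^sup>2 * q (r * t + s)) (\<lambda>t. y (r * t + s)) (\<lambda>t. r * y' (r * t + s))"
  unfolding ode_sol_def
proof (intro ballI conjI)
  fix t assume t: "t \<in> {c..d}"
  have *: "((\<lambda>t. r * t + s) has_vector_derivative r) (at t within {c..d})"
    by (auto intro!: derivative_eq_intros)
  have sub: "(\<lambda>t. r * t + s) ` {c..d} \<subseteq> {a..b}"
    using assms(2) by auto
  have comp: "((\<lambda>t. g (r * t + s)) has_vector_derivative r * g') (at t within {c..d})"
    if "(g has_vector_derivative g') (at (r * t + s) within {a..b})" for g :: "real \<Rightarrow> complex" and g' :: complex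
    using vector_diff_chain_within[OF * has_vector_derivative_within_subset[OF that sub]]
    by (simp add: o_def scaleR_conv_of_real)
  show "((\<lambda>t. y (r * t + s)) has_vector_derivative r * y' (r * t + s)) (at t within {c..d})"
    using comp[of y "y' (r * t + s)"] assms t by (auto simp: ode_sol_def)
  have "((\<lambda>t. y' (r * t + s)) has_vector_derivative r * (q (r * t + s) * y (r * t + s))) (at t within {c..d})"
    using comp[of y' "q (r * t + s) * y (r * t + s)"] assms t by (auto simp: ode_sol_def)
  then show "((\<lambda>t. r * y' (r * t + s)) has_vector_derivative (of_real r)\<^sup>2 * q (r * t + s) * y (r * t + s))
      (at t within {c..d})"
    by (auto intro!: derivative_eq_intros simp: power2_eq_square)
qed

lemma ode_sol_cnj:
  assumes "ode_sol a b q y y'"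
  shows "ode_sol a b (\<lambda>x. cnj (q x)) (\<lambda>x. cnj (y x)) (\<lambda>x. cnj (y' x))"
  using assms unfolding ode_sol_def
  by (auto intro!: derivative_eq_intros has_vector_derivative_cnj)

lemma ode_sol_zero:
  assumes "ode_sol a b q y y'" "continuous_on {a..b} q" "y a = 0" "y' a = 0" "x \<in> {a..b}"
  shows "y x = 0" "y' x = 0"
proof -
  obtain K where "\<And>x. x \<in> {a..b} \<Longrightarrow> norm (q x) \<le> K"
    using compact_imp_bounded[OF compact_continuous_image[OF assms(2) compact_Icc]]
    unfolding bounded_pos by blast
  then have "(norm (y x))\<^sup>2 + (norm (y' x))\<^sup>2 \<le> 0"
    using gronwall_second_order[of a b y y' q "\<lambda>_. 0" K 0 x] assms by (auto simp: ode_sol_def)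
  then show "y x = 0" "y' x = 0"
    by (auto simp: sum_power2_le_zero_iff)
qed

text \<open>The two equations may differ: this is the perturbation formula behind the comparison
  with the Airy profile, behind the derivative in the spectral parameter and, for equal potentials,
  behind the constancy of the Wronskian.\<close>

lemma ode_sol_wronskian_derivative:
  assumes "ode_sol a b p y y'" "ode_sol a b q w w'" "x \<in> {a..b}"
  shows "((\<lambda>x. y x * w' x - y' x * w x) has_vector_derivative (q x - p x) * y x * w x)
    (at x within {a..b})"
  using assms unfolding ode_sol_def
  by (auto intro!: derivative_eq_intros simp: algebra_simps)

lemma ode_sol_wronskian:
  assumes "ode_sol a b p y y'" "ode_sol a b q w w'" "a \<le> x" "x \<le> b"
  shows "((\<lambda>x. (q x - p x) * y x * w x) has_integral
     (y x * w' x - y' x * w x) - (y a * w' a - y' a * w a)) {a..x}"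
  using assms
  by (intro fundamental_theorem_of_calculus)
    (auto intro!: has_vector_derivative_within_subset[OF ode_sol_wronskian_derivative])

subsection \<open>Decaying solutions on a long interval\<close>

lemma has_integral_FTC_real:
  fixes f :: "real \<Rightarrow> real"
  assumes "a \<le> b" "\<And>x. x \<in> {a..b} \<Longrightarrow> (f has_real_derivative f' x) (at x within {a..b})"
  shows "(f' has_integral (f b - f a)) {a..b}"
  using assms
  by (intro fundamental_theorem_of_calculus) (auto simp: has_real_derivative_iff_has_vector_derivative)

text \<open>Multiply the equation by the conjugate of \<open>u\<close>. For
  \<open>q = \<i> * W - \<nu>\<close> the real part controls \<open>u'\<close> by the mass of
  \<open>u\<close>, and the imaginary part controls the mass weighted by \<open>W\<close>, which is
  where confinement comes from.\<close>

lemma ode_sol_energy: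
  assumes u: "ode_sol a b q u u'" and x: "x \<in> {a..b}"
  shows "((\<lambda>x. Re (cnj (u x) * u' x)) has_real_derivative
           (norm (u' x))\<^sup>2 + Re (q x) * (norm (u x))\<^sup>2) (at x within {a..b})"
    and "((\<lambda>x. Im (cnj (u x) * u' x)) has_real_derivative
           Im (q x) * (norm (u x))\<^sup>2) (at x within {a..b})"
proof -
  have "((\<lambda>x. cnj (u x) * u' x) has_vector_derivative
      cnj (u x) * (q x * u x) + cnj (u' x) * u' x) (at x within {a..b})"
    using u x unfolding ode_sol_def
    by (intro has_vector_derivative_mult has_vector_derivative_cnj) auto
  note d = bounded_linear.has_vector_derivative[OF bounded_linear_Re this]
    bounded_linear.has_vector_derivative[OF bounded_linear_Im this]
  show "((\<lambda>x. Re (cnj (u x) * u' x)) has_real_derivative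
           (norm (u' x))\<^sup>2 + Re (q x) * (norm (u x))\<^sup>2) (at x within {a..b})"
    unfolding has_real_derivative_iff_has_vector_derivative
    by (rule has_vector_derivative_eq_rhs[OF d(1)], unfold cmod_power2)
      (simp add: power2_eq_square algebra_simps)
  show "((\<lambda>x. Im (cnj (u x) * u' x)) has_real_derivative
           Im (q x) * (norm (u x))\<^sup>2) (at x within {a..b})"
    unfolding has_real_derivative_iff_has_vector_derivative
    by (rule has_vector_derivative_eq_rhs[OF d(2)], unfold cmod_power2)
      (simp add: power2_eq_square algebra_simps)
qed

lemma integral_exp_decay:
  fixes S :: real
  assumes "0 \<le> S"
  shows "integral {0..S} (\<lambda>t. exp (r - t)) \<le> exp r"
proof -
  have "((\<lambda>t. exp (r - t)) has_integral (- exp (r - S) - - exp (r - 0))) {0..S}"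
    by (rule has_integral_FTC_real[OF assms]) (auto intro!: derivative_eq_intros)
  then show ?thesis by (simp add: integral_unique)
qed

text \<open>The bound is spelled out because it must not depend on the length \<open>S\<close>.
  Beyond \<open>R\<close> the weighted mass absorbs the mass itself; the exponential comes from
  Gronwall on \<open>{0..R}\<close>.\<close>

definition halfline_const :: "real \<Rightarrow> real \<Rightarrow> real \<Rightarrow> real" where
  "halfline_const m J1 N = (let R = (2 * N + 1) / m in
     (2 * exp ((J1 * R + N + 3) * R) + 1) * (N + 1) + 1)"

text \<open>The imaginary energy identity and \<open>m * t \<le> W t\<close> bound the mass weighted
  by \<open>t\<close> in terms of the mass, so that beyond \<open>R\<close> at most half of the
  mass, up to a constant, can lie. Before \<open>R\<close>, Gronwall from the normalised data
  applies. The real identity then bounds \<open>u'\<close>. The boundary terms at \<open>S\<close>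
  vanish because \<open>u S = 0\<close>.\<close>

lemma halfline_energy:
  fixes W :: "real \<Rightarrow> real"
  assumes S: "0 < S"
    and u: "ode_sol 0 S (\<lambda>t. \<i> * W t - \<nu>) u u'" and uS: "u S = 0"
    and init: "(norm (u 0))\<^sup>2 + (norm (u' 0))\<^sup>2 = 1"
    and W: "continuous_on {0..S} W"
    and m: "0 < m" and W_lower: "\<And>t. t \<in> {0..S} \<Longrightarrow> m * t \<le> W t"
    and W_upper: "\<And>t. t \<in> {0..S} \<Longrightarrow> W t \<le> J1 * t"
    and \<nu>: "norm \<nu> \<le> N"
  shows "integral {0..S} (\<lambda>t. (norm (u t))\<^sup>2) \<le> halfline_const m J1 N"
    and "integral {0..S} (\<lambda>t. (norm (u' t))\<^sup>2) \<le> halfline_const m J1 N"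
proof -
  define R where "R = (2 * N + 1) / m"
  define K where "K = J1 * R + N + 2"
  define A where "A = integral {0..S} (\<lambda>t. (norm (u t))\<^sup>2)"
  define A1 where "A1 = integral {0..S} (\<lambda>t. (norm (u' t))\<^sup>2)"
  define At where "At = integral {0..S} (\<lambda>t. t * (norm (u t))\<^sup>2)"
  have N: "0 \<le> N" using \<nu> norm_ge_zero order_trans by blast
  have R: "0 < R" using N m by (simp add: R_def)
  have "m * S \<le> J1 * S"
    using W_lower[of S] W_upper[of S] S by (meson atLeastAtMost_iff less_imp_le order_refl order_trans)
  then have mJ: "m \<le> J1" using S by simp
  then have J1: "0 \<le> J1" using m by simp
  have K: "0 \<le> K" using J1 R N by (simp add: K_def)
  note cont = ode_sol_continuous[OF u]
  have int: "(\<lambda>t. (norm (u t))\<^sup>2) integrable_on {0..S}" "(\<lambda>t. (norm (u' t))\<^sup>2) integrable_on {0..S}"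
    "(\<lambda>t. t * (norm (u t))\<^sup>2) integrable_on {0..S}" "(\<lambda>t. W t * (norm (u t))\<^sup>2) integrable_on {0..S}"
    by (intro integrable_continuous_real continuous_intros cont W)+
  have A_nonneg: "0 \<le> A"
    unfolding A_def by (intro integral_nonneg int) auto
  have b0: "\<bar>Re (cnj (u 0) * u' 0)\<bar> \<le> 1/2" "\<bar>Im (cnj (u 0) * u' 0)\<bar> \<le> 1/2"
  proof -
    have "norm (cnj (u 0) * u' 0) \<le> 1/2"
      using sum_squares_bound[of "norm (u 0)" "norm (u' 0)"] init by (simp add: norm_mult)
    then show "\<bar>Re (cnj (u 0) * u' 0)\<bar> \<le> 1/2" "\<bar>Im (cnj (u 0) * u' 0)\<bar> \<le> 1/2"
      using abs_Re_le_cmod abs_Im_le_cmod order_trans by blast+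
  qed
  have "((\<lambda>t. (norm (u' t))\<^sup>2 - Re \<nu> * (norm (u t))\<^sup>2) has_integral - Re (cnj (u 0) * u' 0)) {0..S}"
    using has_integral_FTC_real[OF less_imp_le[OF S] ode_sol_energy(1)[OF u]] uS by simp
  moreover have "((\<lambda>t. (norm (u' t))\<^sup>2 - Re \<nu> * (norm (u t))\<^sup>2) has_integral A1 - Re \<nu> * A) {0..S}"
    unfolding A_def A1_def
    by (intro has_integral_diff has_integral_mult_right integrable_integral int)
  ultimately have "A1 - Re \<nu> * A = - Re (cnj (u 0) * u' 0)"
    using has_integral_unique by blast
  moreover have "Re \<nu> * A \<le> N * A"
    using \<nu> abs_Re_le_cmod[of \<nu>] A_nonneg by (intro mult_right_mono) auto
  ultimately have A1_le: "A1 \<le> N * A + 1/2"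
    using b0(1) by linarith
  have "((\<lambda>t. W t * (norm (u t))\<^sup>2 - Im \<nu> * (norm (u t))\<^sup>2) has_integral - Im (cnj (u 0) * u' 0)) {0..S}"
    using has_integral_FTC_real[OF less_imp_le[OF S] ode_sol_energy(2)[OF u]] uS
    by (simp add: left_diff_distrib)
  moreover have "((\<lambda>t. W t * (norm (u t))\<^sup>2 - Im \<nu> * (norm (u t))\<^sup>2) has_integral
      integral {0..S} (\<lambda>t. W t * (norm (u t))\<^sup>2) - Im \<nu> * A) {0..S}"
    unfolding A_def
    by (intro has_integral_diff has_integral_mult_right integrable_integral int)
  ultimately have "integral {0..S} (\<lambda>t. W t * (norm (u t))\<^sup>2) - Im \<nu> * A = - Im (cnj (u 0) * u' 0)"
    using has_integral_unique by blast
  moreover have "Im \<nu> * A \<le> N * A"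
    using \<nu> abs_Im_le_cmod[of \<nu>] A_nonneg by (intro mult_right_mono) auto
  moreover have "integral {0..S} (\<lambda>t. m * (t * (norm (u t))\<^sup>2)) \<le> integral {0..S} (\<lambda>t. W t * (norm (u t))\<^sup>2)"
    using W_lower int unfolding mult.assoc[symmetric]
    by (intro integral_le) (auto intro!: mult_right_mono integrable_continuous_real continuous_intros cont)
  ultimately have At_le: "m * At \<le> N * A + 1/2"
    using b0(2) by (simp add: At_def del: times_complex.simps complex_cnj_mult)
  \<comment> \<open>One bound for both regions: for \<open>t \<le> R\<close> the factor
    \<open>exp (R - t)\<close> is at least 1 and Gronwall applies, for \<open>t > R\<close> the
    second summand alone suffices. The integral of the exponential is bounded independently of
    \<open>S\<close>.\<close>
  have pointwise: "(norm (u t))\<^sup>2 \<le> exp (K * R) * exp (R - t) + t / R * (norm (u t))\<^sup>2"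
    if t: "t \<in> {0..S}" for t
  proof (cases "t \<le> R")
    case True
    have "(norm (u t))\<^sup>2 + (norm (u' t))\<^sup>2
        \<le> exp ((J1 * R + N + 2) * (t - 0)) * ((norm (u 0))\<^sup>2 + (norm (u' 0))\<^sup>2 + 0\<^sup>2 * (t - 0))"
    proof (rule gronwall_second_order[where q = "\<lambda>t. \<i> * W t - \<nu>" and g = "\<lambda>_. 0" and b = t])
      have u': "ode_sol 0 t (\<lambda>t. \<i> * W t - \<nu>) u u'"
        using t by (intro ode_sol_subinterval[OF u]) auto
      show "(u has_vector_derivative u' x) (at x within {0..t})"
        "(u' has_vector_derivative (\<i> * W x - \<nu>) * u x + 0) (at x within {0..t})" if "x \<in> {0..t}" for x
        using u' that by (auto simp: ode_sol_def)
      show "norm (\<i> * W x - \<nu>) \<le> J1 * R + N" if "x \<in> {0..t}" for x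
      proof -
        have x: "0 \<le> x" "x \<le> R" "x \<in> {0..S}" using that t True by auto
        have "0 \<le> m * x" using m x by simp
        then have "0 \<le> W x" using W_lower[OF x(3)] by linarith
        moreover have "J1 * x \<le> J1 * R" using x J1 by (intro mult_left_mono)
        then have "W x \<le> J1 * R" using W_upper[OF x(3)] by linarith
        ultimately show ?thesis
          using norm_triangle_ineq4[of "\<i> * W x" \<nu>] \<nu> by (simp add: norm_mult)
      qed
    qed (use t in auto)
    also have "\<dots> = exp (K * t)" using init by (simp add: K_def)
    also have "\<dots> \<le> exp (K * R) * exp (R - t)"
      using True K by (simp add: mult_left_mono add_increasing2 flip: exp_add)
    finally have "(norm (u t))\<^sup>2 + (norm (u' t))\<^sup>2 \<le> exp (K * R) * exp (R - t)" .
    moreover have "0 \<le> t / R * (norm (u t))\<^sup>2" using t R by simp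
    ultimately show ?thesis
      using zero_le_power2[of "norm (u' t)"] by linarith
  next
    case False
    then have "1 * (norm (u t))\<^sup>2 \<le> t / R * (norm (u t))\<^sup>2"
      using R by (intro mult_right_mono) auto
    then show ?thesis by (simp add: add_increasing)
  qed
  have "A \<le> integral {0..S} (\<lambda>t. exp (K * R) * exp (R - t) + t / R * (norm (u t))\<^sup>2)"
    unfolding A_def using pointwise R
    by (intro integral_le int) (auto intro!: integrable_continuous_real continuous_intros cont)
  also have "\<dots> = exp (K * R) * integral {0..S} (\<lambda>t. exp (R - t)) + At / R"
  proof -
    have "(\<lambda>t. exp (R - t)) integrable_on {0..S}"
      by (intro integrable_continuous_real continuous_intros)
    from has_integral_add[OF has_integral_mult_right[OF integrable_integral[OF this], of "exp (K * R)"]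
        has_integral_mult_right[OF integrable_integral[OF int(3)], of "1 / R"]]
    show ?thesis by (simp add: At_def integral_unique)
  qed
  also have "\<dots> \<le> exp (K * R) * exp R + (N * A + 1/2) / (m * R)"
    using integral_exp_decay[of S R] S At_le m R by (intro add_mono mult_left_mono) (auto simp: field_simps)
  \<comment> \<open>The choice \<open>m * R = 2 * N + 1\<close> leaves at most half of
    \<open>A\<close> on the right, to be absorbed by the left side.\<close>
  also have "(N * A + 1/2) / (m * R) \<le> (A + 1) / 2"
  proof -
    have "m * R = 2 * N + 1" using m by (simp add: R_def)
    then show ?thesis using N A_nonneg by (simp add: field_simps)
  qed
  also have "exp (K * R) * exp R = exp ((J1 * R + N + 3) * R)"
    by (simp add: K_def algebra_simps flip: exp_add)
  finally have A_le: "A \<le> 2 * exp ((J1 * R + N + 3) * R) + 1"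
    by (simp add: field_simps)
  define M where "M = 2 * exp ((J1 * R + N + 3) * R) + 1"
  have hc: "halfline_const m J1 N = M * (N + 1) + 1"
    by (simp add: halfline_const_def R_def M_def Let_def)
  have "0 \<le> M" by (simp add: M_def add_increasing)
  then have "0 \<le> M * N" using N by simp
  then show "integral {0..S} (\<lambda>t. (norm (u t))\<^sup>2) \<le> halfline_const m J1 N"
    using A_le unfolding A_def[symmetric] hc M_def[symmetric] by (simp add: algebra_simps)
  have "N * A \<le> N * M" using A_le N by (intro mult_left_mono) (auto simp: M_def)
  then show "integral {0..S} (\<lambda>t. (norm (u' t))\<^sup>2) \<le> halfline_const m J1 N"
    using A1_le \<open>0 \<le> M\<close> unfolding A1_def[symmetric] hc by (simp add: algebra_simps)
qed

text \<open>The Wronskian of \<open>u\<close> with the decaying solution \<open>f\<close> of the limit equation is averaged against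
  the weight \<open>1 - t / S\<close>; the \<open>L\<^sup>2\<close> bounds then make its value at \<open>0\<close> small.\<close>

lemma halfline_wronskian:
  fixes W :: "real \<Rightarrow> real" and J :: real
  assumes S: "0 < S"
    and u: "ode_sol 0 S (\<lambda>t. \<i> * W t - \<nu>) u u'" and uS: "u S = 0"
    and init: "(norm (u 0))\<^sup>2 + (norm (u' 0))\<^sup>2 = 1"
    and W: "continuous_on {0..S} W"
    and m: "0 < m" and W_lower: "\<And>t. t \<in> {0..S} \<Longrightarrow> m * t \<le> W t"
    and W_upper: "\<And>t. t \<in> {0..S} \<Longrightarrow> W t \<le> J1 * t"
    and W_lin: "\<And>t. t \<in> {0..S} \<Longrightarrow> \<bar>W t - J * t\<bar> \<le> K * t\<^sup>2" and K: "0 \<le> K"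
    and \<nu>: "norm \<nu> \<le> N"
    and f: "ode_sol 0 S (\<lambda>t. \<i> * (J * t) - \<nu>) f f'"
    and f_bound: "\<And>t. t \<in> {0..S} \<Longrightarrow> (1 + t ^ 4) * (norm (f t))\<^sup>2 + (norm (f' t))\<^sup>2 \<le> B * exp (- t)"
  shows "norm (u 0 * f' 0 - u' 0 * f 0) \<le> (halfline_const m J1 N + B) * (1 / S + K)"
proof -
  define M where "M = halfline_const m J1 N"
  define A where "A = integral {0..S} (\<lambda>t. (norm (u t))\<^sup>2)"
  define A1 where "A1 = integral {0..S} (\<lambda>t. (norm (u' t))\<^sup>2)"
  note cont = ode_sol_continuous[OF u] ode_sol_continuous[OF f]
  have int: "(\<lambda>t. (norm (u t))\<^sup>2) integrable_on {0..S}" "(\<lambda>t. (norm (u' t))\<^sup>2) integrable_on {0..S}"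
    by (intro integrable_continuous_real continuous_intros cont)+
  have A: "A \<le> M" "A1 \<le> M"
    unfolding M_def A_def A1_def using halfline_energy[OF S u uS init W m W_lower W_upper \<nu>] by auto
  have B: "0 \<le> B"
  proof -
    have "0 \<le> (1 + 0 ^ 4) * (norm (f 0))\<^sup>2 + (norm (f' 0))\<^sup>2" by simp
    also have "\<dots> \<le> B" using f_bound[of 0] S by simp
    finally show ?thesis .
  qed
  define w where "w = (\<lambda>t. u t * f' t - u' t * f t)"
  \<comment> \<open>The derivative of \<open>(1 - t / S) * w t\<close>. The weight vanishes at
    \<open>S\<close>, where \<open>u'\<close> is not controlled, and its own derivative costs only
    the average of \<open>w\<close>.\<close>
  define D where "D = (\<lambda>t. - of_real (1 / S) * w t
      + of_real (1 - t / S) * ((\<i> * (J * t) - \<nu> - (\<i> * W t - \<nu>)) * u t * f t))"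
  have "(D has_integral of_real (1 - S / S) * w S - of_real (1 - 0 / S) * w 0) {0..S}"
    unfolding D_def
  proof (rule fundamental_theorem_of_calculus)
    fix t assume t: "t \<in> {0..S}"
    have dw: "(w has_vector_derivative (\<i> * (J * t) - \<nu> - (\<i> * W t - \<nu>)) * u t * f t) (at t within {0..S})"
      unfolding w_def by (rule ode_sol_wronskian_derivative[OF u f t])
    have d\<theta>: "((\<lambda>t. complex_of_real (1 - t / S)) has_vector_derivative - of_real (1 / S)) (at t within {0..S})"
      using S by (auto intro!: derivative_eq_intros)
    show "((\<lambda>t. of_real (1 - t / S) * w t) has_vector_derivative - of_real (1 / S) * w t
      + of_real (1 - t / S) * ((\<i> * (J * t) - \<nu> - (\<i> * W t - \<nu>)) * u t * f t)) (at t within {0..S})"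
      by (rule has_vector_derivative_eq_rhs[OF has_vector_derivative_mult[OF d\<theta> dw]]) simp
  qed (use S in auto)
  then have D_int: "(D has_integral - w 0) {0..S}"
    using S by simp
  \<comment> \<open>Half of each of the errors \<open>1 / S\<close> and \<open>K\<close>; the halves
    come from \<open>x * y \<le> (x\<^sup>2 + y\<^sup>2) / 2\<close>.\<close>
  define c where "c = 1 / (2 * S) + K / 2"
  have c: "0 \<le> c" using S K by (simp add: c_def)
  define G where "G = (\<lambda>t. c * (norm (u t))\<^sup>2 + 1 / (2 * S) * (norm (u' t))\<^sup>2 + c * B * exp (0 - t))"
  have D_le: "norm (D t) \<le> G t" if t: "t \<in> {0..S}" for t
  proof -
    have ab: "x * y \<le> (x\<^sup>2 + y\<^sup>2) / 2" for x y :: real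
      using sum_squares_bound[of x y] by simp
    have "norm (w t) \<le> norm (u t) * norm (f' t) + norm (u' t) * norm (f t)"
      unfolding w_def by (metis norm_mult norm_triangle_ineq4)
    also have "\<dots> \<le> ((norm (u t))\<^sup>2 + (norm (f' t))\<^sup>2) / 2 + ((norm (u' t))\<^sup>2 + (norm (f t))\<^sup>2) / 2"
      by (intro add_mono ab)
    also have "\<dots> \<le> ((norm (u t))\<^sup>2 + (norm (u' t))\<^sup>2 + B * exp (- t)) / 2"
    proof -
      have "(norm (f' t))\<^sup>2 + (norm (f t))\<^sup>2 \<le> (1 + t ^ 4) * (norm (f t))\<^sup>2 + (norm (f' t))\<^sup>2"
        using t by (simp add: distrib_right)
      also have "\<dots> \<le> B * exp (- t)" by (rule f_bound[OF t])
      finally have "(norm (f' t))\<^sup>2 + (norm (f t))\<^sup>2 \<le> B * exp (- t)" .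
      moreover have "p + q \<le> r \<Longrightarrow> (a + p) / 2 + (b + q) / 2 \<le> (a + b + r) / 2" for a b p q r :: real
        by argo
      ultimately show ?thesis by blast
    qed
    finally have 0: "norm (w t) \<le> ((norm (u t))\<^sup>2 + (norm (u' t))\<^sup>2 + B * exp (- t)) / 2" .
    have 1: "norm (of_real (1 / S) * w t) \<le> 1 / S * (((norm (u t))\<^sup>2 + (norm (u' t))\<^sup>2 + B * exp (- t)) / 2)"
    proof -
      have "norm (of_real (1 / S) * w t) = 1 / S * norm (w t)"
        using S by (simp add: norm_mult norm_divide)
      then show ?thesis
        using S 0 by (simp only:) (intro mult_left_mono, auto)
    qed
    have "norm (of_real (1 - t / S) * ((\<i> * (J * t) - \<nu> - (\<i> * W t - \<nu>)) * u t * f t))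
        = \<bar>1 - t / S\<bar> * (\<bar>W t - J * t\<bar> * norm (u t) * norm (f t))"
    proof -
      have "\<i> * (J * t) - \<nu> - (\<i> * W t - \<nu>) = - \<i> * of_real (W t - J * t)"
        by (simp add: algebra_simps)
      then show ?thesis by (simp only: norm_mult norm_of_real norm_minus_cancel norm_ii mult_1)
    qed
    also have "\<dots> \<le> 1 * (K * t\<^sup>2 * norm (u t) * norm (f t))"
      using t S K W_lin[OF t] by (intro mult_mono) (auto simp: field_simps)
    \<comment> \<open>The quadratic factor of the Taylor error is moved onto the decaying solution,
      whose bound carries the weight \<open>1 + t ^ 4\<close> for this purpose.\<close>
    also have "\<dots> = K * (norm (u t) * (t\<^sup>2 * norm (f t)))"
      by simp
    also have "\<dots> \<le> K * (((norm (u t))\<^sup>2 + (t\<^sup>2 * norm (f t))\<^sup>2) / 2)"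
      using K by (intro mult_left_mono ab)
    also have "\<dots> \<le> K * (((norm (u t))\<^sup>2 + B * exp (- t)) / 2)"
    proof -
      have "(t\<^sup>2 * norm (f t))\<^sup>2 = t ^ 4 * (norm (f t))\<^sup>2" by (simp add: power_mult_distrib flip: power_mult)
      then have "(t\<^sup>2 * norm (f t))\<^sup>2 \<le> B * exp (- t)"
        using f_bound[OF t] zero_le_power2[of "norm (f t)"] zero_le_power2[of "norm (f' t)"]
        unfolding distrib_right by linarith
      then show ?thesis using K by (intro mult_left_mono) auto
    qed
    finally have 2: "norm (of_real (1 - t / S) * ((\<i> * (J * t) - \<nu> - (\<i> * W t - \<nu>)) * u t * f t))
        \<le> K * (((norm (u t))\<^sup>2 + B * exp (- t)) / 2)" .
    have "norm (D t) \<le> norm (of_real (1 / S) * w t)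
        + norm (of_real (1 - t / S) * ((\<i> * (J * t) - \<nu> - (\<i> * W t - \<nu>)) * u t * f t))"
      unfolding D_def by (metis mult_minus_left norm_minus_cancel norm_triangle_ineq)
    also have "\<dots> \<le> 1 / S * (((norm (u t))\<^sup>2 + (norm (u' t))\<^sup>2 + B * exp (- t)) / 2)
        + K * (((norm (u t))\<^sup>2 + B * exp (- t)) / 2)"
      by (intro add_mono 1 2)
    also have "\<dots> = G t"
      using S by (simp add: G_def c_def field_simps)
    finally show ?thesis .
  qed
  have G_int: "(G has_integral c * A + 1 / (2 * S) * A1 + c * B * integral {0..S} (\<lambda>t. exp (0 - t))) {0..S}"
    unfolding G_def A_def A1_def
    by (intro has_integral_add has_integral_mult_right integrable_integral int
        integrable_continuous_real continuous_intros)
  have "norm (w 0) \<le> c * A + 1 / (2 * S) * A1 + c * B * integral {0..S} (\<lambda>t. exp (0 - t))"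
    using integral_norm_bound_integral[of D "{0..S}" G] D_le D_int G_int
    by (auto simp: has_integral_iff)
  also have "\<dots> \<le> c * M + 1 / (2 * S) * M + c * B * exp 0"
    using A c B S integral_exp_decay[of S 0] by (intro add_mono mult_left_mono) auto
  also have "\<dots> \<le> (M + B) * (1 / S + K)"
  proof -
    have "0 \<le> M" using A by (intro order_trans[OF _ A(1)]) (auto simp: A_def intro!: integral_nonneg int)
    then have "0 \<le> M * K" "0 \<le> B * K" "0 \<le> B * (1 / S)" using K B S by auto
    then show ?thesis by (simp add: c_def algebra_simps add_divide_distrib)
  qed
  finally show ?thesis by (simp add: w_def M_def)
qed

subsection \<open>The Airy function\<close>

lemma integrable_exp_minus_abs: "integrable lborel (\<lambda>s::real. exp (- \<bar>s\<bar>))"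
proof -
  define g where "g = (\<lambda>s::real. indicator {0..} s *\<^sub>R exp (- s))"
  have "(\<lambda>s::real. exp (- s)) absolutely_integrable_on {0..}"
    using integrable_on_exp_minus_to_infinity[of 1 0]
    by (intro nonnegative_absolutely_integrable_1) auto
  then have "integrable lebesgue g"
    by (simp add: set_integrable_def g_def)
  moreover have "g \<in> borel_measurable lborel"
    unfolding g_def by measurable
  ultimately have g: "integrable lborel g"
    by (simp add: integrable_completion)
  have "integrable lborel (\<lambda>s. g s + g (0 + (- 1) * s))"
    by (intro Bochner_Integration.integrable_add g lborel_integrable_real_affine) auto
  then show ?thesis
    by (rule Bochner_Integration.integrable_bound) (auto simp: g_def indicator_def)
qed

lemma improper_integral_tendsto:
  fixes f :: "real \<Rightarrow> complex"
  assumes "integrable lborel f"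
  shows "((\<lambda>R. integral {-R..R} f) \<longlongrightarrow> integral\<^sup>L lborel f) at_top"
proof -
  have "((\<lambda>R. integral\<^sup>L lborel (\<lambda>s. indicator {-R..R} s *\<^sub>R f s)) \<longlongrightarrow> integral\<^sup>L lborel f) at_top"
  proof (rule integral_dominated_convergence_at_top[where w = "\<lambda>s. norm (f s)"])
    show "AE s in lborel. ((\<lambda>R. indicator {-R..R} s *\<^sub>R f s) \<longlongrightarrow> f s) at_top"
    proof (rule AE_I2)
      fix s
      have "\<forall>\<^sub>F R in at_top. indicator {-R..R} s *\<^sub>R f s = f s"
        using eventually_ge_at_top[of "\<bar>s\<bar>"] by eventually_elim (auto simp: indicator_def)
      then show "((\<lambda>R. indicator {-R..R} s *\<^sub>R f s) \<longlongrightarrow> f s) at_top"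
        by (rule tendsto_eventually)
    qed
    show "\<forall>\<^sub>F R in at_top. AE s in lborel. norm (indicator {-R..R} s *\<^sub>R f s) \<le> norm (f s)"
      by (auto simp: indicator_def)
  qed (use assms in auto)
  moreover have "integral\<^sup>L lborel (\<lambda>s. indicator {-R..R} s *\<^sub>R f s) = integral {-R..R} f" for R
    using set_borel_integral_eq_integral(2)[of "{-R..R}" f] assms
    by (simp add: set_lebesgue_integral_def set_integrable_def integrable_mult_indicator)
  ultimately show ?thesis by simp
qed

definition airy_exp :: "complex \<Rightarrow> complex \<Rightarrow> complex" where
  "airy_exp z w = exp (w ^ 3 / 3 - z * w)"

text \<open>The integrand on the vertical line \<open>Re w = \<eta>\<close>. For
  \<open>\<eta> > 0\<close> its modulus has the Gaussian factor
  \<open>exp (- \<eta> * s\<^sup>2)\<close>; on the imaginary axis and for real \<open>z\<close> the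
  exponential only oscillates.\<close>

definition airy_integrand :: "nat \<Rightarrow> real \<Rightarrow> complex \<Rightarrow> real \<Rightarrow> complex" where
  "airy_integrand k \<eta> z s = Complex \<eta> s ^ k * airy_exp z (Complex \<eta> s)"

text \<open>Up to the sign \<open>(-1) ^ k\<close> this is the \<open>k\<close>-th derivative of the
  Airy function as a contour integral; the factor \<open>\<i>\<close> of \<open>dw\<close> cancels
  against that of \<open>2 * pi * \<i>\<close>.\<close>

definition airy_moment :: "nat \<Rightarrow> complex \<Rightarrow> complex" where
  "airy_moment k z = (LINT s|lborel. airy_integrand k 1 z s) / (2 * pi)"

lemma norm_airy_exp:
  "norm (airy_exp z (Complex \<eta> s)) = exp (\<eta> ^ 3 / 3 - \<eta> * s\<^sup>2 - \<eta> * Re z + s * Im z)"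
proof -
  have "Re (Complex \<eta> s ^ 3 / 3 - z * Complex \<eta> s) = \<eta> ^ 3 / 3 - \<eta> * s\<^sup>2 - \<eta> * Re z + s * Im z"
    by (simp add: power3_eq_cube power2_eq_square field_simps)
  then show ?thesis
    by (simp add: airy_exp_def norm_exp_eq_Re)
qed

text \<open>Two squares are completed: half of \<open>\<eta> * s\<^sup>2\<close> absorbs
  \<open>s * Im z\<close>, the other half absorbs the power of \<open>w\<close> and leaves
  \<open>exp (- \<bar>s\<bar>)\<close>. The dependence on \<open>\<eta>\<close> is explicit because
  the line is chosen later according to \<open>z\<close>.\<close>

lemma norm_airy_integrand:
  assumes "\<eta> \<ge> 1"
  shows "norm (airy_integrand k \<eta> z s)
    \<le> exp ((real k + 1)\<^sup>2 / 2) * (\<eta> ^ k * exp (\<eta> ^ 3 / 3 - \<eta> * Re z + (Im z)\<^sup>2 / (2 * \<eta>))) * exp (- \<bar>s\<bar>)"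
proof -
  have "norm (Complex \<eta> s) \<le> \<eta> + \<bar>s\<bar>"
    using cmod_le[of "Complex \<eta> s"] assms by simp
  also have "\<dots> \<le> \<eta> * (1 + \<bar>s\<bar>)"
    using assms by (simp add: algebra_simps mult_le_cancel_right1)
  also have "\<dots> \<le> \<eta> * exp \<bar>s\<bar>"
    using assms exp_ge_add_one_self[of "\<bar>s\<bar>"] by (intro mult_left_mono) auto
  finally have "norm (Complex \<eta> s) ^ k \<le> (\<eta> * exp \<bar>s\<bar>) ^ k"
    by (intro power_mono) auto
  then have 1: "norm (Complex \<eta> s) ^ k \<le> \<eta> ^ k * exp (k * \<bar>s\<bar>)"
    by (simp add: power_mult_distrib exp_of_nat_mult)
  have "0 \<le> (\<eta> * s - Im z)\<^sup>2" by simp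
  then have "s * Im z \<le> \<eta> * s\<^sup>2 / 2 + (Im z)\<^sup>2 / (2 * \<eta>)"
    using assms by (simp add: power2_eq_square field_simps)
  moreover have "s\<^sup>2 / 2 \<le> \<eta> * s\<^sup>2 / 2"
    using assms mult_right_mono[of 1 \<eta> "s\<^sup>2"] by simp
  moreover have "0 \<le> (\<bar>s\<bar> - (real k + 1))\<^sup>2" by simp
  then have "k * \<bar>s\<bar> - s\<^sup>2 / 2 \<le> - \<bar>s\<bar> + (real k + 1)\<^sup>2 / 2"
    unfolding power2_diff by (simp add: field_simps)
  ultimately have 2: "k * \<bar>s\<bar> + (\<eta> ^ 3 / 3 - \<eta> * s\<^sup>2 - \<eta> * Re z + s * Im z)
      \<le> (real k + 1)\<^sup>2 / 2 + (\<eta> ^ 3 / 3 - \<eta> * Re z + (Im z)\<^sup>2 / (2 * \<eta>)) + - \<bar>s\<bar>"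
    by linarith
  have "norm (airy_integrand k \<eta> z s)
      \<le> \<eta> ^ k * exp (k * \<bar>s\<bar>) * exp (\<eta> ^ 3 / 3 - \<eta> * s\<^sup>2 - \<eta> * Re z + s * Im z)"
    unfolding airy_integrand_def norm_mult norm_power norm_airy_exp
    by (intro mult_right_mono 1) auto
  also have "\<dots> = \<eta> ^ k * exp (k * \<bar>s\<bar> + (\<eta> ^ 3 / 3 - \<eta> * s\<^sup>2 - \<eta> * Re z + s * Im z))"
    by (simp only: exp_add mult.assoc)
  also have "\<dots> \<le> \<eta> ^ k * exp ((real k + 1)\<^sup>2 / 2 + (\<eta> ^ 3 / 3 - \<eta> * Re z + (Im z)\<^sup>2 / (2 * \<eta>)) + - \<bar>s\<bar>)"
    using assms 2 by (intro mult_left_mono) auto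
  finally show ?thesis
    by (simp only: exp_add mult_ac)
qed

lemma airy_integrand_measurable [measurable]: "airy_integrand k \<eta> z \<in> borel_measurable borel"
  unfolding airy_integrand_def airy_exp_def Complex_eq
  by (intro borel_measurable_continuous_onI continuous_intros) auto

lemma airy_integrand_integrable:
  assumes "\<eta> \<ge> 1"
  shows "integrable lborel (airy_integrand k \<eta> z)"
proof (rule Bochner_Integration.integrable_bound)
  show "integrable lborel (\<lambda>s. exp ((real k + 1)\<^sup>2 / 2) *
      (\<eta> ^ k * exp (\<eta> ^ 3 / 3 - \<eta> * Re z + (Im z)\<^sup>2 / (2 * \<eta>))) * exp (- \<bar>s\<bar>))"
    by (intro integrable_mult_right integrable_exp_minus_abs)
  show "AE s in lborel. norm (airy_integrand k \<eta> z s) \<le> norm (exp ((real k + 1)\<^sup>2 / 2) *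
      (\<eta> ^ k * exp (\<eta> ^ 3 / 3 - \<eta> * Re z + (Im z)\<^sup>2 / (2 * \<eta>))) * exp (- \<bar>s\<bar>))"
    unfolding real_norm_def by (intro AE_I2 order_trans[OF norm_airy_integrand[OF assms] abs_ge_self])
qed auto

text \<open>Shifting the contour of integration: both lines are compared through a primitive of the
  entire function \<open>airy_exp z\<close>.\<close>

lemma airy_exp_primitive:
  obtains P where "\<And>w. (P has_field_derivative w ^ k * airy_exp z w) (at w)"
proof -
  have "(\<lambda>w. w ^ k * airy_exp z w) holomorphic_on UNIV"
    unfolding airy_exp_def by (intro holomorphic_intros) auto
  then obtain P where "\<And>w. w \<in> UNIV \<Longrightarrow> (P has_field_derivative w ^ k * airy_exp z w) (at w within UNIV)"
    using holomorphic_convex_primitive'[of UNIV "\<lambda>w. w ^ k * airy_exp z w"] by auto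
  then show ?thesis using that by auto
qed

lemma norm_divide_ii: "norm (x / \<i>) = norm x"
  by (simp add: norm_mult)

lemma airy_vertical_integral:
  assumes "\<And>w. (P has_field_derivative w ^ k * airy_exp z w) (at w)" "0 \<le> R"
  shows "integral {-R..R} (airy_integrand k \<eta> z) = (P (Complex \<eta> R) - P (Complex \<eta> (-R))) / \<i>"
proof -
  have "(airy_integrand k \<eta> z has_integral P (Complex \<eta> R) / \<i> - P (Complex \<eta> (-R)) / \<i>) {-R..R}"
  proof (rule fundamental_theorem_of_calculus)
    fix s
    have "((\<lambda>s. of_real \<eta> + \<i> * of_real s) has_vector_derivative \<i>) (at s within {-R..R})"
      by (auto intro!: derivative_eq_intros)
    from field_vector_diff_chain_within[OF this has_field_derivative_at_within[OF assms(1)]]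
    have "((\<lambda>s. P (of_real \<eta> + \<i> * of_real s)) has_vector_derivative \<i> * airy_integrand k \<eta> z s)
        (at s within {-R..R})"
      by (simp add: o_def airy_integrand_def Complex_eq)
    then have "((\<lambda>s. P (of_real \<eta> + \<i> * of_real s) / \<i>) has_vector_derivative \<i> * airy_integrand k \<eta> z s / \<i>)
        (at s within {-R..R})"
      by (rule has_vector_derivative_divide)
    then show "((\<lambda>s. P (Complex \<eta> s) / \<i>) has_vector_derivative airy_integrand k \<eta> z s)
        (at s within {-R..R})"
      by (simp add: Complex_eq)
  qed (use assms in auto)
  then show ?thesis
    unfolding diff_divide_distrib by (rule integral_unique)
qed

lemma airy_horizontal_integral:
  assumes "\<And>w. (P has_field_derivative airy_exp z w) (at w)" "\<eta>1 \<le> \<eta>2"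
  shows "norm (P (Complex \<eta>2 R) - P (Complex \<eta>1 R))
    \<le> integral {\<eta>1..\<eta>2} (\<lambda>\<sigma>. exp (\<sigma> ^ 3 / 3 - \<sigma> * R\<^sup>2 - \<sigma> * Re z + R * Im z))"
proof -
  have "((\<lambda>\<sigma>. airy_exp z (Complex \<sigma> R)) has_integral P (Complex \<eta>2 R) - P (Complex \<eta>1 R)) {\<eta>1..\<eta>2}"
  proof (rule fundamental_theorem_of_calculus[OF assms(2)])
    fix s
    have "((\<lambda>s. of_real s + \<i> * of_real R) has_vector_derivative 1) (at s within {\<eta>1..\<eta>2})"
      by (auto intro!: derivative_eq_intros)
    from field_vector_diff_chain_within[OF this has_field_derivative_at_within[OF assms(1)]]
    show "((\<lambda>s. P (Complex s R)) has_vector_derivative airy_exp z (Complex s R)) (at s within {\<eta>1..\<eta>2})"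
      by (simp add: o_def Complex_eq)
  qed
  then show ?thesis
    by (subst integral_unique[symmetric], assumption, intro integral_norm_bound_integral)
      (auto simp: norm_airy_exp has_integral_integrable
        intro!: integrable_continuous_real continuous_intros)
qed

text \<open>Cauchy's theorem on a rectangle. The horizontal sides at height \<open>R\<close> carry
  the factor \<open>exp (\<bar>Im z\<bar> * R - R\<^sup>2)\<close>, so only the vertical lines
  survive.\<close>

lemma airy_moment_eq:
  assumes "\<eta> \<ge> 1"
  shows "airy_moment 0 z = (LINT s|lborel. airy_integrand 0 \<eta> z s) / (2 * pi)"
proof -
  obtain P where P': "\<And>w. (P has_field_derivative w ^ 0 * airy_exp z w) (at w)"
    using airy_exp_primitive by metis
  then have P: "\<And>w. (P has_field_derivative airy_exp z w) (at w)" by simp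
  define b where "b = (\<lambda>R. 2 * ((\<eta> - 1) * exp (\<eta> ^ 3 / 3 + \<eta> * \<bar>Re z\<bar> + \<bar>Im z\<bar> * R - R\<^sup>2)))"
  have h: "norm (P (Complex \<eta> R) - P (Complex 1 R)) \<le> (\<eta> - 1) * exp (\<eta> ^ 3 / 3 + \<eta> * \<bar>Re z\<bar> + \<bar>Im z\<bar> * \<bar>R\<bar> - R\<^sup>2)" for R
  proof -
    have "integral {1..\<eta>} (\<lambda>\<sigma>. exp (\<sigma> ^ 3 / 3 - \<sigma> * R\<^sup>2 - \<sigma> * Re z + R * Im z))
        \<le> integral {1..\<eta>} (\<lambda>\<sigma>. exp (\<eta> ^ 3 / 3 + \<eta> * \<bar>Re z\<bar> + \<bar>Im z\<bar> * \<bar>R\<bar> - R\<^sup>2))"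
    proof (rule integral_le)
      fix \<sigma> assume \<sigma>: "\<sigma> \<in> {1..\<eta>}"
      have "\<sigma> ^ 3 \<le> \<eta> ^ 3" using \<sigma> by (intro power_mono) auto
      moreover have "1 * R\<^sup>2 \<le> \<sigma> * R\<^sup>2" using \<sigma> by (intro mult_right_mono) auto
      moreover have "\<sigma> * - Re z \<le> \<sigma> * \<bar>Re z\<bar>" "\<sigma> * \<bar>Re z\<bar> \<le> \<eta> * \<bar>Re z\<bar>"
        using \<sigma> by (intro mult_left_mono mult_right_mono; simp)+
      moreover have "R * Im z \<le> \<bar>Im z\<bar> * \<bar>R\<bar>" by (metis abs_ge_self abs_mult mult.commute)
      ultimately show "exp (\<sigma> ^ 3 / 3 - \<sigma> * R\<^sup>2 - \<sigma> * Re z + R * Im z)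
          \<le> exp (\<eta> ^ 3 / 3 + \<eta> * \<bar>Re z\<bar> + \<bar>Im z\<bar> * \<bar>R\<bar> - R\<^sup>2)"
        by simp
    qed (auto intro!: integrable_continuous_real continuous_intros)
    then show ?thesis
      using airy_horizontal_integral[OF P assms, of R] assms by simp
  qed
  have "((\<lambda>R. integral {-R..R} (airy_integrand 0 \<eta> z) - integral {-R..R} (airy_integrand 0 1 z)) \<longlongrightarrow> 0) at_top"
  proof (rule Lim_null_comparison)
    show "\<forall>\<^sub>F R in at_top. norm (integral {-R..R} (airy_integrand 0 \<eta> z) - integral {-R..R} (airy_integrand 0 1 z)) \<le> b R"
      using eventually_ge_at_top[of 0]
    proof eventually_elim
      case (elim R)
      have "norm (integral {-R..R} (airy_integrand 0 \<eta> z) - integral {-R..R} (airy_integrand 0 1 z))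
          = norm ((P (Complex \<eta> R) - P (Complex 1 R)) - (P (Complex \<eta> (-R)) - P (Complex 1 (-R))))"
        unfolding airy_vertical_integral[OF P' elim]
        by (subst norm_divide_ii[symmetric]) (simp add: algebra_simps)
      also have "\<dots> \<le> b R"
        using h[of R] h[of "-R"] elim norm_triangle_ineq4[of "P (Complex \<eta> R) - P (Complex 1 R)" "P (Complex \<eta> (-R)) - P (Complex 1 (-R))"]
        by (simp add: b_def)
      finally show ?case .
    qed
    show "(b \<longlongrightarrow> 0) at_top"
      unfolding b_def by real_asymp
  qed
  moreover have "((\<lambda>R. integral {-R..R} (airy_integrand 0 \<eta> z) - integral {-R..R} (airy_integrand 0 1 z))
      \<longlongrightarrow> (LINT s|lborel. airy_integrand 0 \<eta> z s) - (LINT s|lborel. airy_integrand 0 1 z s)) at_top"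
    using assms by (intro tendsto_diff improper_integral_tendsto airy_integrand_integrable) auto
  ultimately show ?thesis
    using tendsto_unique[of "at_top :: real filter"] by (fastforce simp: airy_moment_def)
qed

text \<open>Moving the line to the imaginary axis loses absolute convergence. The horizontal sides
  still vanish, but only like \<open>1 / (R\<^sup>2 + x)\<close>, which bounds the integral of
  \<open>exp (- \<sigma> * (R\<^sup>2 + x))\<close> over the unit interval.\<close>

lemma airy_moment_of_real: "airy_moment 0 (of_real x) = of_real (airy_Ai x)"
proof -
  obtain P where P': "\<And>w. (P has_field_derivative w ^ 0 * airy_exp x w) (at w)"
    using airy_exp_primitive by metis
  then have P: "\<And>w. (P has_field_derivative airy_exp x w) (at w)" by simp
  define C where "C = (\<lambda>R. integral {0..R} (\<lambda>t. cos (t ^ 3 / 3 + x * t)))"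
  have h: "norm (P (Complex 1 R) - P (Complex 0 R)) \<le> exp (1/3) / (R\<^sup>2 + x)" if R: "R\<^sup>2 + x > 0" for R
  proof -
    have "((\<lambda>\<sigma>. exp (1/3) * exp (- \<sigma> * c)) has_integral
        - exp (1/3) * exp (- 1 * c) / c - - exp (1/3) * exp (- 0 * c) / c) {0..1}" if "c > 0" for c :: real
      using that by (intro fundamental_theorem_of_calculus)
        (auto intro!: derivative_eq_intros simp flip: has_real_derivative_iff_has_vector_derivative)
    note int = this[OF R]
    have "integral {0..1} (\<lambda>\<sigma>. exp (\<sigma> ^ 3 / 3 - \<sigma> * R\<^sup>2 - \<sigma> * Re x + R * Im x))
        \<le> integral {0..1} (\<lambda>\<sigma>. exp (1/3) * exp (- \<sigma> * (R\<^sup>2 + x)))"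
    proof (rule integral_le)
      fix \<sigma> :: real assume \<sigma>: "\<sigma> \<in> {0..1}"
      then have "\<sigma> ^ 3 \<le> 1" by (simp add: power_le_one)
      then show "exp (\<sigma> ^ 3 / 3 - \<sigma> * R\<^sup>2 - \<sigma> * Re x + R * Im x) \<le> exp (1/3) * exp (- \<sigma> * (R\<^sup>2 + x))"
        unfolding exp_add[symmetric] by (simp add: algebra_simps)
    qed (auto intro!: integrable_continuous_real continuous_intros)
    also have "\<dots> = exp (1/3) / (R\<^sup>2 + x) - exp (1/3) * exp (- (R\<^sup>2 + x)) / (R\<^sup>2 + x)"
      unfolding integral_unique[OF int] by simp
    also have "\<dots> \<le> exp (1/3) / (R\<^sup>2 + x)"
      using R by simp
    finally show ?thesis
      using airy_horizontal_integral[OF P, of 0 1 R] by simp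
  qed
  \<comment> \<open>On the imaginary axis the integrand has modulus 1, and the values at
    \<open>s\<close> and \<open>- s\<close> add up to twice the cosine.\<close>
  have vert0: "integral {-R..R} (airy_integrand 0 0 x) = of_real (2 * C R)" if R: "0 \<le> R" for R
  proof -
    define g where "g = airy_integrand 0 0 x"
    have "Complex 0 s ^ 3 / 3 - of_real x * Complex 0 s = \<i> * of_real (- (s ^ 3 / 3 + x * s))" for s
      by (simp add: complex_eq_iff power3_eq_cube)
    then have g_eq: "g s = cis (- (s ^ 3 / 3 + x * s))" for s
      by (simp add: g_def airy_integrand_def airy_exp_def cis_conv_exp)
    have gi: "g integrable_on {c..d}" for c d
      unfolding g_eq by (intro integrable_continuous_real continuous_intros) auto
    have "integral {-R..R} g = integral {-R..0} g + integral {0..R} g"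
      using R gi by (intro Henstock_Kurzweil_Integration.integral_combine[symmetric]) auto
    also have "integral {-R..0} g = integral {0..R} (\<lambda>s. g (- s))"
      using Henstock_Kurzweil_Integration.integral_reflect_real[of R 0 "\<lambda>s. g (-s)"] by simp
    also have "\<dots> + integral {0..R} g = integral {0..R} (\<lambda>s. g (- s) + g s)"
      unfolding g_eq by (intro integral_add[symmetric] integrable_continuous_real continuous_intros) auto
    also have "\<dots> = integral {0..R} (\<lambda>s. of_real (2 * cos (s ^ 3 / 3 + x * s)))"
      unfolding g_eq by (intro integral_cong) (auto simp: complex_eq_iff cos_diff cos_add sin_diff sin_add)
    also have "\<dots> = of_real (integral {0..R} (\<lambda>s. 2 * cos (s ^ 3 / 3 + x * s)))"
      by (intro integral_unique has_integral_of_real integrable_integral integrable_continuous_real continuous_intros) auto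
    finally show ?thesis by (simp add: C_def g_def)
  qed
  have "((\<lambda>R. integral {-R..R} (airy_integrand 0 1 x) - integral {-R..R} (airy_integrand 0 0 x)) \<longlongrightarrow> 0) at_top"
  proof (rule Lim_null_comparison)
    have "\<forall>\<^sub>F R in at_top. R\<^sup>2 + x > 0" by real_asymp
    then show "\<forall>\<^sub>F R in at_top. norm (integral {-R..R} (airy_integrand 0 1 x) - integral {-R..R} (airy_integrand 0 0 x))
        \<le> 2 * (exp (1/3) / (R\<^sup>2 + x))"
      using eventually_ge_at_top[of 0]
    proof eventually_elim
      case (elim R)
      have "norm (integral {-R..R} (airy_integrand 0 1 x) - integral {-R..R} (airy_integrand 0 0 x))
          = norm ((P (Complex 1 R) - P (Complex 0 R)) - (P (Complex 1 (-R)) - P (Complex 0 (-R))))"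
        unfolding airy_vertical_integral[OF P' elim(2)]
        by (subst norm_divide_ii[symmetric]) (simp add: algebra_simps)
      also have "\<dots> \<le> 2 * (exp (1/3) / (R\<^sup>2 + x))"
        using h[of R] h[of "-R"] elim norm_triangle_ineq4[of "P (Complex 1 R) - P (Complex 0 R)" "P (Complex 1 (-R)) - P (Complex 0 (-R))"]
        by simp
      finally show ?case .
    qed
    show "((\<lambda>R. 2 * (exp (1/3) / (R\<^sup>2 + x))) \<longlongrightarrow> 0) at_top"
      by real_asymp
  qed
  moreover have "((\<lambda>R. integral {-R..R} (airy_integrand 0 1 x)) \<longlongrightarrow> (LINT s|lborel. airy_integrand 0 1 x s)) at_top"
    by (intro improper_integral_tendsto airy_integrand_integrable) auto
  ultimately have "((\<lambda>R. integral {-R..R} (airy_integrand 0 1 x) - (integral {-R..R} (airy_integrand 0 1 x) - integral {-R..R} (airy_integrand 0 0 x)))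
      \<longlongrightarrow> (LINT s|lborel. airy_integrand 0 1 x s) - 0) at_top"
    by (intro tendsto_diff)
  moreover have "\<forall>\<^sub>F R in at_top. integral {-R..R} (airy_integrand 0 1 x) -
      (integral {-R..R} (airy_integrand 0 1 x) - integral {-R..R} (airy_integrand 0 0 x)) = complex_of_real (2 * C R)"
    using eventually_ge_at_top[of 0] by eventually_elim (simp add: vert0)
  ultimately have "((\<lambda>R. complex_of_real (2 * C R)) \<longlongrightarrow> (LINT s|lborel. airy_integrand 0 1 x s) - 0) at_top"
    by (rule Lim_transform_eventually)
  then have lim: "((\<lambda>R. complex_of_real (2 * C R) / 2) \<longlongrightarrow> 2 * pi * airy_moment 0 x / 2) at_top"
    by (intro tendsto_divide) (auto simp: airy_moment_def)
  \<comment> \<open>This also proves that the limit in \<open>airy_Ai\<close> exists; without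
    convergence \<open>Lim\<close> would carry no information.\<close>
  from tendsto_Re[OF this] tendsto_Im[OF this]
  have "(C \<longlongrightarrow> Re (pi * airy_moment 0 x)) at_top" and im: "Im (pi * airy_moment 0 x) = 0"
    by (auto simp: tendsto_const_iff)
  then have "airy_Ai x = 1 / pi * Re (pi * airy_moment 0 x)"
    unfolding airy_Ai_def C_def[symmetric] by (simp add: tendsto_Lim)
  then show ?thesis
    using im by (simp add: complex_eq_iff)
qed


text \<open>A quadratic remainder bound takes the place of differentiation under the integral
  sign.\<close>

lemma has_field_derivative_quadratic_remainder:
  fixes f :: "complex \<Rightarrow> complex"
  assumes "\<And>\<zeta>. norm \<zeta> \<le> 1 \<Longrightarrow> norm (f (z + \<zeta>) - f z - d * \<zeta>) \<le> C * (norm \<zeta>)\<^sup>2"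
  shows "(f has_field_derivative d) (at z)"
  unfolding DERIV_def
proof (rule LIM_zero_cancel, rule Lim_null_comparison)
  have "\<forall>\<^sub>F \<zeta> in at 0. norm (\<zeta>::complex) < 1"
    unfolding eventually_at by (intro exI[of _ 1]) (auto simp: dist_norm)
  moreover have "\<forall>\<^sub>F \<zeta> in at 0. (\<zeta>::complex) \<noteq> 0"
    by (simp add: eventually_at_filter)
  ultimately show "\<forall>\<^sub>F \<zeta> in at 0. norm ((f (z + \<zeta>) - f z) / \<zeta> - d) \<le> C * norm \<zeta>"
  proof eventually_elim
    case (elim \<zeta>)
    then have "(f (z + \<zeta>) - f z) / \<zeta> - d = (f (z + \<zeta>) - f z - d * \<zeta>) / \<zeta>"
      by (simp add: field_simps)
    then show ?case
      using assms[of \<zeta>] elim by (simp add: norm_divide divide_le_eq power2_eq_square mult.assoc)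
  qed
  show "((\<lambda>\<zeta>. C * norm \<zeta>) \<longlongrightarrow> 0) (at (0::complex))"
    by (auto intro!: tendsto_eq_intros)
qed

text \<open>The increment of the integrand minus its linear part is governed by the second order
  remainder of \<open>exp (- \<zeta> * w)\<close>, hence dominated by the square of
  \<open>norm \<zeta>\<close> times an integrable function.\<close>

lemma airy_moment_deriv:
  "(airy_moment k has_field_derivative - airy_moment (Suc k) z) (at z)"
proof -
  \<comment> \<open>The \<open>k + 3\<close> exponentials of \<open>norm w\<close> dominate
    \<open>w ^ k\<close>, the square of \<open>w\<close> and the exponential in the Taylor
    remainder; \<open>\<bar>Im z\<bar>\<close> comes from \<open>s * Im z\<close>. Completing the
    square with \<open>c + 1\<close> leaves \<open>exp (- \<bar>s\<bar>)\<close>.\<close>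
  define c where "c = real (k + 3) + \<bar>Im z\<bar>"
  define D where "D = exp (real k + 3 + 1 / 3 - Re z + (c + 1)\<^sup>2 / 4)"
  have kernel: "norm (airy_integrand k 1 (z + \<zeta>) s - airy_integrand k 1 z s + \<zeta> * airy_integrand (Suc k) 1 z s)
      \<le> (norm \<zeta>)\<^sup>2 * D * exp (- \<bar>s\<bar>)" if \<zeta>: "norm \<zeta> \<le> 1" for \<zeta> s
  proof -
    define w where "w = Complex 1 s"
    have w: "norm w \<le> 1 + \<bar>s\<bar>"
      using cmod_le[of w] by (simp add: w_def)
    have ew: "norm w \<le> exp (norm w)"
      using exp_ge_add_one_self[of "norm w"] by linarith
    have "norm (exp (- \<zeta> * w) - (1 + - \<zeta> * w)) \<le> exp \<bar>Re (- \<zeta> * w)\<bar> * norm (- \<zeta> * w) ^ Suc 1 / fact 1"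
      using Taylor_exp[of "- \<zeta> * w" 1] by simp
    also have "\<dots> \<le> exp (norm w) * (norm \<zeta> * norm w)\<^sup>2"
    proof -
      have "\<bar>Re (- \<zeta> * w)\<bar> \<le> norm (- \<zeta> * w)" by (rule abs_Re_le_cmod)
      also have "\<dots> \<le> 1 * norm w" unfolding norm_mult using \<zeta> by (intro mult_right_mono) auto
      finally show ?thesis by (auto simp: norm_mult power2_eq_square intro!: mult_right_mono)
    qed
    also have "\<dots> \<le> exp (norm w) * ((norm \<zeta>)\<^sup>2 * (exp (norm w))\<^sup>2)"
      unfolding power_mult_distrib by (intro mult_left_mono power_mono ew) auto
    finally have e: "norm (exp (- \<zeta> * w) - (1 + - \<zeta> * w)) \<le> exp (norm w) * ((norm \<zeta>)\<^sup>2 * (exp (norm w))\<^sup>2)" .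
    have p: "norm w ^ k \<le> exp (norm w) ^ k"
      by (intro power_mono ew) auto
    have "airy_integrand k 1 (z + \<zeta>) s - airy_integrand k 1 z s + \<zeta> * airy_integrand (Suc k) 1 z s
        = w ^ k * airy_exp z w * (exp (- \<zeta> * w) - (1 + - \<zeta> * w))"
    proof -
      have "airy_exp (z + \<zeta>) w = airy_exp z w * exp (- \<zeta> * w)"
        unfolding airy_exp_def exp_add[symmetric] by (simp add: algebra_simps)
      then show ?thesis
        unfolding airy_integrand_def w_def[symmetric] by (simp add: algebra_simps)
    qed
    also have "norm \<dots> \<le> exp (norm w) ^ k * norm (airy_exp z w) * (exp (norm w) * ((norm \<zeta>)\<^sup>2 * (exp (norm w))\<^sup>2))"
      unfolding norm_mult norm_power by (intro mult_mono e p mult_right_mono) auto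
    also have "\<dots> = (norm \<zeta>)\<^sup>2 * (exp (real (k + 3) * norm w) * norm (airy_exp z w))"
      unfolding exp_of_nat_mult by (simp add: power_add power2_eq_square power3_eq_cube)
    also have "\<dots> = (norm \<zeta>)\<^sup>2 * exp (real (k + 3) * norm w + (1 / 3 - s\<^sup>2 - Re z + s * Im z))"
      unfolding w_def norm_airy_exp by (simp flip: exp_add)
    also have "\<dots> \<le> (norm \<zeta>)\<^sup>2 * (D * exp (- \<bar>s\<bar>))"
    proof -
      have "real (k + 3) * norm w \<le> real (k + 3) * (1 + \<bar>s\<bar>)"
        using w by (intro mult_left_mono) auto
      moreover have "s * Im z \<le> \<bar>Im z\<bar> * \<bar>s\<bar>"
        by (metis abs_ge_self abs_mult mult.commute)
      moreover have "0 \<le> (\<bar>s\<bar> - (c + 1) / 2)\<^sup>2" by simp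
      then have "(c + 1) * \<bar>s\<bar> \<le> s\<^sup>2 + (c + 1)\<^sup>2 / 4"
        unfolding power2_diff by (simp add: field_simps)
      ultimately have "real (k + 3) * norm w + (1 / 3 - s\<^sup>2 - Re z + s * Im z)
          \<le> real k + 3 + 1 / 3 - Re z + (c + 1)\<^sup>2 / 4 + - \<bar>s\<bar>"
        unfolding c_def by (simp add: algebra_simps)
      then show ?thesis
        unfolding D_def exp_add[symmetric] by (intro mult_left_mono) auto
    qed
    finally show ?thesis by (simp only: mult.assoc)
  qed
  define I where "I = (LINT s|lborel. exp (- \<bar>s\<bar>) :: real)"
  have "norm (airy_moment k (z + \<zeta>) - airy_moment k z - (- airy_moment (Suc k) z) * \<zeta>)
      \<le> (D * I / (2 * pi)) * (norm \<zeta>)\<^sup>2" if \<zeta>: "norm \<zeta> \<le> 1" for \<zeta>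
  proof -
    have int: "integrable lborel (airy_integrand k 1 z)" for k z
      by (intro airy_integrand_integrable) auto
    have "airy_moment k (z + \<zeta>) - airy_moment k z - (- airy_moment (Suc k) z) * \<zeta> =
      (LINT s|lborel. airy_integrand k 1 (z + \<zeta>) s - airy_integrand k 1 z s + \<zeta> * airy_integrand (Suc k) 1 z s) / (2 * pi)"
      unfolding airy_moment_def using int by (simp add: field_simps)
    also have "norm \<dots> = norm (LINT s|lborel. airy_integrand k 1 (z + \<zeta>) s - airy_integrand k 1 z s + \<zeta> * airy_integrand (Suc k) 1 z s) / (2 * pi)"
      by (simp add: norm_divide norm_mult)
    also have "norm (LINT s|lborel. airy_integrand k 1 (z + \<zeta>) s - airy_integrand k 1 z s + \<zeta> * airy_integrand (Suc k) 1 z s)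
        \<le> (LINT s|lborel. (norm \<zeta>)\<^sup>2 * D * exp (- \<bar>s\<bar>))"
    proof (rule Bochner_Integration.integral_norm_bound_integral)
      show "integrable lborel (\<lambda>s. (norm \<zeta>)\<^sup>2 * D * exp (- \<bar>s\<bar>))"
        by (intro integrable_mult_right integrable_exp_minus_abs)
    qed (use kernel[OF \<zeta>] int in auto)
    finally show ?thesis by (simp add: I_def field_simps divide_right_mono)
  qed
  then show ?thesis by (rule has_field_derivative_quadratic_remainder)
qed

text \<open>Along the line \<open>(w\<^sup>2 - z) * airy_exp z w\<close> is an exact derivative,
  that of \<open>airy_exp z\<close>, so its integral reduces to end values, which vanish in the
  limit.\<close>

lemma airy_moment_ode: "airy_moment 2 z = z * airy_moment 0 z"
proof -
  have int: "integrable lborel (airy_integrand k 1 z)" for k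
    by (intro airy_integrand_integrable) auto
  define g where "g = (\<lambda>s. airy_integrand 2 1 z s - z * airy_integrand 0 1 z s)"
  have "((\<lambda>R. integral {-R..R} g) \<longlongrightarrow> integral\<^sup>L lborel g) at_top"
    unfolding g_def by (intro improper_integral_tendsto Bochner_Integration.integrable_diff integrable_mult_right int)
  moreover have "((\<lambda>R. integral {-R..R} g) \<longlongrightarrow> 0) at_top"
  proof (rule Lim_null_comparison)
    show "\<forall>\<^sub>F R in at_top. norm (integral {-R..R} g) \<le> 2 * exp (1 / 3 - R\<^sup>2 - Re z + R * \<bar>Im z\<bar>)"
      using eventually_ge_at_top[of 0]
    proof eventually_elim
      case (elim R)
      have "(g has_integral airy_exp z (Complex 1 R) / \<i> - airy_exp z (Complex 1 (-R)) / \<i>) {-R..R}"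
      proof (rule fundamental_theorem_of_calculus)
        fix s
        have d: "(airy_exp z has_field_derivative (w\<^sup>2 - z) * airy_exp z w) (at w)" for w
          unfolding airy_exp_def
          by (auto intro!: derivative_eq_intros)
        have "((\<lambda>s. 1 + \<i> * of_real s) has_vector_derivative \<i>) (at s within {-R..R})"
          by (auto intro!: derivative_eq_intros)
        from field_vector_diff_chain_within[OF this has_field_derivative_at_within[OF d]]
        have "((\<lambda>s. airy_exp z (1 + \<i> * of_real s)) has_vector_derivative \<i> * g s) (at s within {-R..R})"
          by (simp add: o_def g_def airy_integrand_def Complex_eq algebra_simps)
        then have "((\<lambda>s. airy_exp z (1 + \<i> * of_real s) / \<i>) has_vector_derivative \<i> * g s / \<i>) (at s within {-R..R})"
          by (rule has_vector_derivative_divide)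
        then show "((\<lambda>s. airy_exp z (Complex 1 s) / \<i>) has_vector_derivative g s) (at s within {-R..R})"
          by (simp add: Complex_eq)
      qed (use elim in auto)
      then have "integral {-R..R} g = airy_exp z (Complex 1 R) / \<i> - airy_exp z (Complex 1 (-R)) / \<i>"
        by (rule integral_unique)
      also have "norm \<dots> \<le> norm (airy_exp z (Complex 1 R)) + norm (airy_exp z (Complex 1 (-R)))"
        by (rule order_trans[OF norm_triangle_ineq4]) (simp only: norm_divide_ii order_refl)
      also have "\<dots> \<le> 2 * exp (1 / 3 - R\<^sup>2 - Re z + R * \<bar>Im z\<bar>)"
      proof -
        have "R * Im z \<le> R * \<bar>Im z\<bar>" "R * - Im z \<le> R * \<bar>Im z\<bar>"
          using elim by (intro mult_left_mono; simp)+
        then have "exp (1 / 3 - R\<^sup>2 - Re z + R * Im z) \<le> exp (1 / 3 - R\<^sup>2 - Re z + R * \<bar>Im z\<bar>)"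
          "exp (1 / 3 - R\<^sup>2 - Re z - R * Im z) \<le> exp (1 / 3 - R\<^sup>2 - Re z + R * \<bar>Im z\<bar>)"
          by simp_all
        then have "exp (1 / 3 - R\<^sup>2 - Re z + R * Im z) + exp (1 / 3 - R\<^sup>2 - Re z - R * Im z)
            \<le> 2 * exp (1 / 3 - R\<^sup>2 - Re z + R * \<bar>Im z\<bar>)"
          by linarith
        then show ?thesis unfolding norm_airy_exp by simp
      qed
      finally show ?case .
    qed
    show "((\<lambda>R. 2 * exp (1 / 3 - R\<^sup>2 - Re z + R * \<bar>Im z\<bar>)) \<longlongrightarrow> 0) at_top"
      by real_asymp
  qed
  ultimately have "integral\<^sup>L lborel g = 0"
    by (intro tendsto_unique[OF trivial_limit_at_top_linorder])
  moreover have "integral\<^sup>L lborel g =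
      (LINT s|lborel. airy_integrand 2 1 z s) - z * (LINT s|lborel. airy_integrand 0 1 z s)"
    unfolding g_def using int by simp
  ultimately show ?thesis
    by (simp add: airy_moment_def)
qed

section \<open>The entire Airy function: bounds, decay and zeros\<close>

definition Airy :: "complex \<Rightarrow> complex" where "Airy = airy_moment 0"

definition Airy' :: "complex \<Rightarrow> complex" where "Airy' z = - airy_moment 1 z"

lemma Airy_deriv: "(Airy has_field_derivative Airy' z) (at z)"
  using airy_moment_deriv[of 0 z] by (simp add: Airy_def Airy'_def)

lemma Airy'_deriv: "(Airy' has_field_derivative z * Airy z) (at z)"
  using DERIV_minus[OF airy_moment_deriv[of 1 z]]
  by (simp add: Airy_def Airy'_def[abs_def] airy_moment_ode flip: numeral_2_eq_2)

lemma Airy_of_real: "Airy (of_real x) = of_real (airy_Ai x)"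
  by (simp add: Airy_def airy_moment_of_real)

text \<open>All lines \<open>Re w = \<eta>\<close> represent the same function, so
  \<open>\<eta>\<close> stays free: 1 is enough on horizontal rays, while the sector needs
  \<open>\<eta>\<close> to grow with the point.\<close>

lemma Airy_bound:
  obtains C where "C > 0"
    "\<And>\<eta> z. \<eta> \<ge> 1 \<Longrightarrow> norm (Airy z) \<le> C * exp (\<eta> ^ 3 / 3 - \<eta> * Re z + (Im z)\<^sup>2 / (2 * \<eta>))"
proof -
  define I where "I = (LINT s|lborel. exp (- \<bar>s\<bar>) :: real)"
  have I: "I \<ge> 0" unfolding I_def by (intro integral_nonneg_AE) auto
  \<comment> \<open>The summand 1 makes the constant positive, given
    \<open>I \<ge> 0\<close>.\<close>
  have "norm (Airy z) \<le> (exp (1 / 2) * I / (2 * pi) + 1) * exp (\<eta> ^ 3 / 3 - \<eta> * Re z + (Im z)\<^sup>2 / (2 * \<eta>))"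
    if "\<eta> \<ge> 1" for \<eta> z
  proof -
    define E where "E = exp (\<eta> ^ 3 / 3 - \<eta> * Re z + (Im z)\<^sup>2 / (2 * \<eta>))"
    have "norm (LINT s|lborel. airy_integrand 0 \<eta> z s)
        \<le> (LINT s|lborel. exp (1 / 2) * E * exp (- \<bar>s\<bar>))"
    proof (rule Bochner_Integration.integral_norm_bound_integral)
      show "integrable lborel (\<lambda>s. exp (1 / 2) * E * exp (- \<bar>s\<bar>))"
        by (intro integrable_mult_right integrable_exp_minus_abs)
      show "norm (airy_integrand 0 \<eta> z s) \<le> exp (1 / 2) * E * exp (- \<bar>s\<bar>)" for s
        using norm_airy_integrand[OF that, of 0 z s] by (simp add: E_def)
    qed (use airy_integrand_integrable[OF that] in auto)
    then have "norm (Airy z) \<le> exp (1 / 2) * E * I / (2 * pi)"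
      unfolding Airy_def airy_moment_eq[OF that]
      by (simp add: norm_divide norm_mult I_def divide_right_mono)
    also have "\<dots> \<le> (exp (1 / 2) * I / (2 * pi) + 1) * E"
      by (simp add: E_def algebra_simps)
    finally show ?thesis by (simp add: E_def)
  qed
  moreover have "exp (1 / 2) * I / (2 * pi) + 1 > 0"
    using I by (intro add_nonneg_pos) auto
  ultimately show ?thesis using that by blast
qed

lemma Airy_holomorphic: "Airy holomorphic_on S"
  using Airy_deriv field_differentiable_at_within
  unfolding holomorphic_on_def field_differentiable_def by blast

text \<open>Cauchy's inequality on the unit circle; it transfers each decay bound to the
  derivative.\<close>

lemma Airy'_bound:
  assumes "\<And>x. norm (z - x) = 1 \<Longrightarrow> norm (Airy x) \<le> B"
  shows "norm (Airy' z) \<le> B"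
proof -
  have "norm ((deriv ^^ 1) Airy z) \<le> fact 1 * B / 1 ^ 1"
    by (intro Cauchy_inequality Airy_holomorphic holomorphic_on_imp_continuous_on assms) auto
  then show ?thesis
    using DERIV_imp_deriv[OF Airy_deriv[of z]] by simp
qed

lemma Airy_decay_right:
  "((\<lambda>x. Airy (z + of_real x)) \<longlongrightarrow> 0) at_top" "((\<lambda>x. Airy' (z + of_real x)) \<longlongrightarrow> 0) at_top"
proof -
  obtain C where C: "C > 0"
    "\<And>\<eta> z. \<eta> \<ge> 1 \<Longrightarrow> norm (Airy z) \<le> C * exp (\<eta> ^ 3 / 3 - \<eta> * Re z + (Im z)\<^sup>2 / (2 * \<eta>))"
    by (rule Airy_bound) blast
  have lim: "((\<lambda>x. C * exp (1 / 3 - (c + x) + d)) \<longlongrightarrow> 0) at_top" for c d :: real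
    by real_asymp
  have b: "norm (Airy w) \<le> C * exp (1 / 3 - Re w + (Im w)\<^sup>2 / 2)" for w
    using C(2)[of 1 w] by simp
  show "((\<lambda>x. Airy (z + of_real x)) \<longlongrightarrow> 0) at_top"
    by (rule Lim_null_comparison[OF _ lim[of "Re z" "(Im z)\<^sup>2 / 2"]])
      (use b[of "z + of_real _"] in auto)
  show "((\<lambda>x. Airy' (z + of_real x)) \<longlongrightarrow> 0) at_top"
  proof (rule Lim_null_comparison[OF _ lim[of "Re z - 1" "(\<bar>Im z\<bar> + 1)\<^sup>2 / 2"]], rule always_eventually, rule allI)
    fix x
    show "norm (Airy' (z + of_real x)) \<le> C * exp (1 / 3 - (Re z - 1 + x) + (\<bar>Im z\<bar> + 1)\<^sup>2 / 2)"
    proof (rule Airy'_bound)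
      fix w assume w: "norm (z + of_real x - w) = 1"
      have "Re z + x - Re w \<le> 1" "\<bar>Im z - Im w\<bar> \<le> 1"
        using abs_Re_le_cmod[of "z + of_real x - w"] abs_Im_le_cmod[of "z + of_real x - w"] w by auto
      then have "(Im w)\<^sup>2 \<le> (\<bar>Im z\<bar> + 1)\<^sup>2"
        by (intro abs_le_square_iff[THEN iffD1]) linarith
      then have "C * exp (1 / 3 - Re w + (Im w)\<^sup>2 / 2) \<le> C * exp (1 / 3 - (Re z - 1 + x) + (\<bar>Im z\<bar> + 1)\<^sup>2 / 2)"
        using \<open>Re z + x - Re w \<le> 1\<close> C(1) by (intro mult_left_mono) auto
      then show "norm (Airy w) \<le> C * exp (1 / 3 - (Re z - 1 + x) + (\<bar>Im z\<bar> + 1)\<^sup>2 / 2)"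
        using b[of w] by linarith
    qed
  qed
qed

text \<open>If all points of the ray were zeros, they would accumulate at \<open>z\<close>, and the
  identity theorem would carry the vanishing to 0.\<close>

lemma Airy_not_zero_on_ray:
  assumes "Airy 0 \<noteq> 0"
  shows "\<exists>x>0. Airy (z + of_real x) \<noteq> 0"
proof (rule ccontr)
  assume "\<not> ?thesis"
  then have 0: "Airy (z + of_real x) = 0" if "x > 0" for x using that by auto
  define U where "U = (\<lambda>x. z + of_real x) ` {0<..}"
  have "z islimpt U"
    unfolding islimpt_approachable
  proof (intro allI impI)
    fix e :: real assume "e > 0"
    then have "z + of_real (e / 2) \<in> U"
      unfolding U_def by (intro imageI) simp
    then show "\<exists>x'\<in>U. x' \<noteq> z \<and> dist x' z < e"
      using \<open>e > 0\<close> by (intro bexI[of _ "z + of_real (e / 2)"]) (auto simp: dist_norm norm_divide)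
  qed
  then have "Airy 0 = 0"
    by (intro analytic_continuation[of Airy UNIV U z 0] Airy_holomorphic)
      (use 0 in \<open>auto simp: U_def\<close>)
  then show False using assms by contradiction
qed

text \<open>Monotonicity between two equal values forces a constant. With it, the sign of a
  derivative along a ray excludes a zero at the start of the ray.\<close>

lemma nondecreasing_vanishing:
  fixes f :: "real \<Rightarrow> real"
  assumes f: "\<And>x. 0 \<le> x \<Longrightarrow> (f has_real_derivative f' x) (at x)"
    and nonneg: "\<And>x. 0 \<le> x \<Longrightarrow> 0 \<le> f' x"
    and "f 0 = 0" and lim: "(f \<longlongrightarrow> 0) at_top" and "0 < x"
  shows "f' x = 0"
proof -
  have mono: "f s \<le> f t" if "0 \<le> s" "s \<le> t" for s t
    by (rule DERIV_nonneg_imp_nondecreasing[OF that(2)]) (meson f nonneg order_trans that(1))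
  have zero: "f t = 0" if "0 \<le> t" for t
  proof (rule antisym)
    have "\<forall>\<^sub>F s in at_top. f t \<le> f s"
      using eventually_ge_at_top[of t] by eventually_elim (use mono that in auto)
    then show "f t \<le> 0" using lim by (intro tendsto_lowerbound[OF lim]) auto
    show "0 \<le> f t" using mono[of 0 t] that assms(3) by simp
  qed
  have "(f has_real_derivative 0) (at x)"
  proof (rule has_field_derivative_transform_within_open[of "\<lambda>_. 0" 0 x "{0<..}"])
  qed (use assms(5) zero in auto)
  then show ?thesis
    using f[of x] assms(5) DERIV_unique by fastforce
qed

text \<open>Two exclusions come from this identity: its imaginary part has the sign of
  \<open>Im z\<close>, which treats nonreal zeros, and on the positive axis its real part is
  nonnegative, which treats \<open>Airy' 0\<close>.\<close>

lemma Airy_ray_derivative: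
  "((\<lambda>x. Airy' (z + of_real x) * cnj (Airy (z + of_real x))) has_vector_derivative
     (z + of_real x) * (norm (Airy (z + of_real x)))\<^sup>2 + (norm (Airy' (z + of_real x)))\<^sup>2) (at x)"
proof -
  have shift: "((\<lambda>x. z + of_real x) has_vector_derivative 1) (at x)"
    by (auto intro!: derivative_eq_intros)
  have 1: "((\<lambda>x. Airy (z + of_real x)) has_vector_derivative Airy' (z + of_real x)) (at x)"
    using field_vector_diff_chain_at[OF shift Airy_deriv] by (simp add: o_def)
  have 2: "((\<lambda>x. Airy' (z + of_real x)) has_vector_derivative (z + of_real x) * Airy (z + of_real x)) (at x)"
    using field_vector_diff_chain_at[OF shift Airy'_deriv] by (simp add: o_def)
  show ?thesis
    by (rule has_vector_derivative_eq_rhs[OF has_vector_derivative_mult[OF 2 has_vector_derivative_cnj[OF 1]]])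
      (simp add: complex_norm_square mult.assoc add.commute del: of_real_power flip: of_real_power)
qed

text \<open>Along a horizontal ray, \<open>Im (Airy' z * cnj (Airy z))\<close> is monotone and tends to \<open>0\<close>: this is
  the self-adjointness of \<open>- d\<^sup>2/dx\<^sup>2 + x\<close> on a half-line.\<close>

lemma Airy_zero_real:
  assumes "Airy 0 \<noteq> 0" "Airy z = 0"
  shows "Im z = 0"
proof (rule ccontr)
  assume "Im z \<noteq> 0"
  \<comment> \<open>The sign makes \<open>f\<close> nondecreasing in both half-planes, and
    \<open>f 0 = 0\<close> because \<open>Airy z = 0\<close>.\<close>
  define f where "f = (\<lambda>x. sgn (Im z) * Im (Airy' (z + of_real x) * cnj (Airy (z + of_real x))))"
  define f' where "f' = (\<lambda>x. \<bar>Im z\<bar> * (norm (Airy (z + of_real x)))\<^sup>2)"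
  obtain x where x: "x > 0" "Airy (z + of_real x) \<noteq> 0"
    using Airy_not_zero_on_ray[OF assms(1)] by blast
  have "f' x = 0"
  proof (rule nondecreasing_vanishing[where f = f and f' = f' and x = x])
    show "(f has_real_derivative f' x) (at x)" for x
    proof -
      have "((\<lambda>x. Im (Airy' (z + of_real x) * cnj (Airy (z + of_real x)))) has_real_derivative
          Im z * (norm (Airy (z + of_real x)))\<^sup>2) (at x)"
        unfolding has_real_derivative_iff_has_vector_derivative
        by (rule has_vector_derivative_eq_rhs[OF bounded_linear.has_vector_derivative[OF bounded_linear_Im Airy_ray_derivative]])
          (simp flip: of_real_power)
      from DERIV_cmult[OF this, of "sgn (Im z)"] show ?thesis
        by (simp add: f_def f'_def abs_sgn mult.assoc[symmetric] mult.commute)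
    qed
    have "(f \<longlongrightarrow> sgn (Im z) * Im (0 * cnj 0)) at_top"
      unfolding f_def by (intro tendsto_intros Airy_decay_right)
    then show "(f \<longlongrightarrow> 0) at_top" by simp
  qed (use x assms(2) in \<open>auto simp: f_def f'_def\<close>)
  then show False
    using x \<open>Im z \<noteq> 0\<close> by (simp add: f'_def)
qed

lemma Airy'_of_real: "Im (Airy' (of_real x)) = 0"
proof -
  have "((\<lambda>x. Airy (0 + of_real x)) has_vector_derivative Airy' (0 + of_real x)) (at x)"
  proof -
    have "((\<lambda>x. 0 + complex_of_real x) has_vector_derivative 1) (at x)"
      by (auto intro!: derivative_eq_intros)
    from field_vector_diff_chain_at[OF this Airy_deriv] show ?thesis by (simp add: o_def)
  qed
  from bounded_linear.has_vector_derivative[OF bounded_linear_Im this]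
  have "((\<lambda>x. 0) has_vector_derivative Im (Airy' (of_real x))) (at x)"
    by (simp add: Airy_of_real)
  then show ?thesis
    by (metis has_vector_derivative_const vector_derivative_at)
qed

text \<open>If \<open>Airy' 0\<close> vanished, \<open>Re (Airy' x * cnj (Airy x))\<close> would
  rise along the positive axis from 0 to its limit 0. As \<open>Airy\<close> is real on the real
  axis, this makes the quantity in \<open>profile_det\<close> nonzero.\<close>

lemma Airy'_0_nonzero:
  assumes "Airy 0 \<noteq> 0"
  shows "Airy' 0 \<noteq> 0"
proof
  assume 0: "Airy' 0 = 0"
  define f where "f = (\<lambda>x. Re (Airy' (0 + of_real x) * cnj (Airy (0 + of_real x))))"
  define f' where "f' = (\<lambda>x. x * (norm (Airy (0 + of_real x)))\<^sup>2 + (norm (Airy' (0 + of_real x)))\<^sup>2)"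
  obtain x where x: "x > 0" "Airy (0 + of_real x) \<noteq> 0"
    using Airy_not_zero_on_ray[OF assms(1)] by blast
  have "f' x = 0"
  proof (rule nondecreasing_vanishing[where f = f and f' = f' and x = x])
    show "(f has_real_derivative f' x) (at x)" for x
      unfolding has_real_derivative_iff_has_vector_derivative f_def f'_def
      by (rule has_vector_derivative_eq_rhs[OF bounded_linear.has_vector_derivative[OF bounded_linear_Re Airy_ray_derivative]])
        (simp flip: of_real_power)
    have "(f \<longlongrightarrow> Re (0 * cnj 0)) at_top"
      unfolding f_def by (intro tendsto_intros Airy_decay_right)
    then show "(f \<longlongrightarrow> 0) at_top" by simp
  qed (use x 0 in \<open>auto simp: f_def f'_def\<close>)
  moreover have "f' x > 0"
    unfolding f'_def using x by (intro add_pos_nonneg mult_pos_pos) auto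
  ultimately show False by simp
qed

text \<open>A double zero would propagate to 0 by uniqueness for \<open>y'' = t * y\<close>.\<close>

lemma Airy'_nonzero_at_zero:
  assumes "Airy 0 \<noteq> 0" "x \<le> 0" "Airy (of_real x) = 0"
  shows "Airy' (of_real x) \<noteq> 0"
proof
  assume 0: "Airy' (of_real x) = 0"
  have "ode_sol x 0 of_real (\<lambda>t. Airy (0 + of_real t)) (\<lambda>t. Airy' (0 + of_real t))"
    unfolding ode_sol_def
  proof (intro ballI)
    fix t
    have "((\<lambda>t. 0 + complex_of_real t) has_vector_derivative 1) (at t within {x..0})"
      by (auto intro!: derivative_eq_intros)
    from field_vector_diff_chain_within[OF this has_field_derivative_at_within[OF Airy_deriv]]
      field_vector_diff_chain_within[OF this has_field_derivative_at_within[OF Airy'_deriv]]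
    show "((\<lambda>t. Airy (0 + of_real t)) has_vector_derivative Airy' (0 + of_real t)) (at t within {x..0}) \<and>
        ((\<lambda>t. Airy' (0 + of_real t)) has_vector_derivative of_real t * Airy (0 + of_real t)) (at t within {x..0})"
      by (simp add: o_def)
  qed
  from ode_sol_zero(1)[OF this, of 0] have "Airy 0 = 0"
    using assms 0 by (auto intro!: continuous_intros)
  then show False using assms(1) by contradiction
qed

text \<open>In the sector the contour \<open>Re w = sqrt (1 + r)\<close> gives decay faster than any exponential.\<close>

lemma Airy_sector:
  obtains C where "C > 0"
    "\<And>r w. 0 \<le> r \<Longrightarrow> norm w \<le> B \<Longrightarrow> norm (Airy (cis (pi/6) * of_real r + w)) \<le> C * exp (- L * r)"
proof -
  obtain C where C: "C > 0"
    "\<And>\<eta> z. \<eta> \<ge> 1 \<Longrightarrow> norm (Airy z) \<le> C * exp (\<eta> ^ 3 / 3 - \<eta> * Re z + (Im z)\<^sup>2 / (2 * \<eta>))"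
    by (rule Airy_bound) blast
  \<comment> \<open>Collects the coefficients of all terms that grow at most like
    \<open>\<eta>\<^sup>2\<close>, including the prescribed rate \<open>L\<close>.\<close>
  define q where "q = 17 / 20 + \<bar>B\<bar> + (\<bar>B\<bar> + B\<^sup>2) / 2 + \<bar>L\<bar>"
  have q: "q \<ge> 0" unfolding q_def by (intro add_nonneg_nonneg divide_nonneg_pos) auto
  have "norm (Airy (cis (pi/6) * of_real r + w)) \<le> C * exp (9 * q ^ 3) * exp (- L * r)"
    if r: "0 \<le> r" and w: "norm w \<le> B" for r w
  proof -
    define \<eta> where "\<eta> = sqrt (1 + r)"
    have \<eta>: "\<eta> \<ge> 1" and \<eta>2: "\<eta>\<^sup>2 = 1 + r" using r by (simp_all add: \<eta>_def)
    define z where "z = cis (pi/6) * of_real r + w"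
    have B: "B \<ge> 0" using w norm_ge_zero order_trans by blast
    \<comment> \<open>A rational lower bound for \<open>cos (pi / 6)\<close>. It is good enough
      since \<open>1 / 3 + 1 / 8 - 17 / 20 < - 1 / 3\<close>, so that the cubic term stays
      negative.\<close>
    have "17 / 20 \<le> sqrt 3 / 2"
      using real_le_rsqrt[of "17/10" 3] by (simp add: power2_eq_square)
    then have "17 / 20 * r \<le> cos (pi/6) * r"
      unfolding cos_30 using r by (rule mult_right_mono)
    then have Re_z: "Re z \<ge> 17 / 20 * r - B"
      using abs_Re_le_cmod[of w] w by (simp add: z_def)
    have "\<bar>Im z\<bar> \<le> r / 2 + B"
      using abs_Im_le_cmod[of w] w r by (simp add: z_def sin_30)
    then have "(Im z)\<^sup>2 \<le> (r / 2 + B)\<^sup>2"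
      using r B by (intro abs_le_square_iff[THEN iffD1]) simp
    also have "\<dots> = r\<^sup>2 / 4 + r * B + B\<^sup>2"
      by (simp add: power2_eq_square field_simps)
    also have "\<dots> \<le> \<eta> ^ 4 / 4 + \<eta>\<^sup>2 * B + \<eta>\<^sup>2 * B\<^sup>2"
    proof -
      have r\<eta>: "r \<le> \<eta>\<^sup>2" "1 \<le> \<eta>\<^sup>2" using \<eta>2 r by auto
      then have "r\<^sup>2 \<le> (\<eta>\<^sup>2)\<^sup>2" using r by (intro power_mono) auto
      moreover have "r * B \<le> \<eta>\<^sup>2 * B" using r\<eta> B by (intro mult_right_mono)
      moreover have "1 * B\<^sup>2 \<le> \<eta>\<^sup>2 * B\<^sup>2" using r\<eta> by (intro mult_right_mono) auto
      ultimately show ?thesis by (simp flip: power_mult)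
    qed
    finally have "(Im z)\<^sup>2 / (2 * \<eta>) \<le> (\<eta> ^ 4 / 4 + \<eta>\<^sup>2 * B + \<eta>\<^sup>2 * B\<^sup>2) / (2 * \<eta>)"
      using \<eta> by (intro divide_right_mono) auto
    also have "\<dots> = \<eta> ^ 3 / 8 + \<eta> * ((B + B\<^sup>2) / 2)"
      using \<eta> by (simp add: field_simps power2_eq_square power3_eq_cube power4_eq_xxxx)
    finally have 1: "(Im z)\<^sup>2 / (2 * \<eta>) \<le> \<eta> ^ 3 / 8 + \<eta> * ((B + B\<^sup>2) / 2)" .
    have "\<eta> * (17 / 20 * (\<eta>\<^sup>2 - 1) - B) \<le> \<eta> * Re z"
      using Re_z \<eta>2 \<eta> by (intro mult_left_mono) auto
    then have 2: "17 / 20 * \<eta> ^ 3 - \<eta> * (17 / 20 + B) \<le> \<eta> * Re z"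
      by (simp add: field_simps power2_eq_square power3_eq_cube)
    have "L * r \<le> \<bar>L\<bar> * \<eta>\<^sup>2"
      using r \<eta>2 by (intro mult_mono) auto
    moreover have "\<eta> * (17 / 20 + B + (B + B\<^sup>2) / 2) \<le> \<eta>\<^sup>2 * (17 / 20 + B + (B + B\<^sup>2) / 2)"
      using \<eta> B by (intro mult_right_mono) (auto simp: power2_eq_square)
    ultimately have "\<eta> ^ 3 / 3 - \<eta> * Re z + (Im z)\<^sup>2 / (2 * \<eta>) + L * r
        \<le> \<eta> ^ 3 / 3 + \<eta> ^ 3 / 8 - 17 / 20 * \<eta> ^ 3 + q * \<eta>\<^sup>2"
      using 1 2 B unfolding q_def by (simp add: algebra_simps)
    also have "\<dots> \<le> q * \<eta>\<^sup>2 - \<eta> ^ 3 / 3"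
      using \<eta> zero_le_power[of \<eta> 3] by linarith
    \<comment> \<open>The cubic term wins once \<open>\<eta> > 3 * q\<close>; before that the
      quadratic one is at most \<open>9 * q ^ 3\<close>.\<close>
    also have "\<dots> \<le> 9 * q ^ 3"
    proof (cases "\<eta> \<le> 3 * q")
      case True
      then have "q * \<eta>\<^sup>2 \<le> q * (3 * q)\<^sup>2" using \<eta> q by (intro mult_left_mono power_mono) auto
      moreover have "0 \<le> \<eta> * \<eta> * \<eta>" using \<eta> by simp
      ultimately show ?thesis
        by (simp add: power2_eq_square power3_eq_cube)
    next
      case False
      then have "3 * q * \<eta>\<^sup>2 \<le> \<eta> * \<eta>\<^sup>2" by (intro mult_right_mono) auto
      then show ?thesis using zero_le_power[OF q, of 3]
        by (simp add: power2_eq_square power3_eq_cube)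
    qed
    finally have "C * exp (\<eta> ^ 3 / 3 - \<eta> * Re z + (Im z)\<^sup>2 / (2 * \<eta>)) \<le> C * exp (9 * q ^ 3 + - L * r)"
      using C(1) by (intro mult_left_mono) auto
    then show ?thesis
      using C(2)[OF \<eta>, of z] by (simp only: z_def exp_add mult.assoc)
  qed
  then show ?thesis
    using that[of "C * exp (9 * q ^ 3)"] C(1) by simp
qed

lemma Airy'_sector:
  obtains C where "C > 0"
    "\<And>r w. 0 \<le> r \<Longrightarrow> norm w \<le> B \<Longrightarrow> norm (Airy' (cis (pi/6) * of_real r + w)) \<le> C * exp (- L * r)"
proof -
  obtain C where C: "C > 0"
    "\<And>r w. 0 \<le> r \<Longrightarrow> norm w \<le> B + 1 \<Longrightarrow> norm (Airy (cis (pi/6) * of_real r + w)) \<le> C * exp (- L * r)"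
    by (rule Airy_sector[of "B + 1" L]) blast
  have "norm (Airy' (cis (pi/6) * of_real r + w)) \<le> C * exp (- L * r)" if "0 \<le> r" "norm w \<le> B" for r w
  proof (rule Airy'_bound)
    fix x assume x: "norm (cis (pi/6) * of_real r + w - x) = 1"
    have "norm (x - cis (pi/6) * of_real r) \<le> B + 1"
      using norm_triangle_ineq4[of w "cis (pi/6) * of_real r + w - x"] x that by simp
    then show "norm (Airy x) \<le> C * exp (- L * r)"
      using C(2)[OF that(1), of "x - cis (pi/6) * of_real r"] by simp
  qed
  then show ?thesis using that C(1) by blast
qed

subsection \<open>The decaying solution of the complex Airy equation\<close>

text \<open>Among the cube roots of \<open>\<i> * J\<close> this is the one whose ray lies in the
  sector \<open>\<bar>arg\<bar> < pi / 3\<close>, where \<open>Airy\<close> decays.\<close>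

definition airy_scale :: "real \<Rightarrow> complex" where
  "airy_scale J = cis (pi/6) * of_real (J powr (1/3))"

text \<open>The solution of \<open>y'' = (\<i> * J * t - \<nu>) * y\<close> that decays at plus
  infinity: the coefficient is \<open>\<i> * J\<close> times the shifted variable
  \<open>t + \<i> * \<nu> / J\<close>.\<close>

definition profile :: "real \<Rightarrow> complex \<Rightarrow> real \<Rightarrow> complex" where
  "profile J \<nu> t = Airy (airy_scale J * (of_real t + \<i> * \<nu> / of_real J))"

definition profile' :: "real \<Rightarrow> complex \<Rightarrow> real \<Rightarrow> complex" where
  "profile' J \<nu> t = airy_scale J * Airy' (airy_scale J * (of_real t + \<i> * \<nu> / of_real J))"

lemma airy_scale_cube:
  assumes "J > 0"
  shows "airy_scale J ^ 3 = \<i> * of_real J"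
proof -
  have "cis (pi/6) ^ 3 = cis (pi/2)"
    unfolding Complex.DeMoivre by (rule arg_cong[of _ _ cis]) simp
  then have "cis (pi/6) ^ 3 = \<i>"
    by simp
  moreover have "(J powr (1/3)) ^ 3 = (J powr (1/3)) powr 3"
    using assms by (simp add: powr_numeral)
  then have "(J powr (1/3)) ^ 3 = J"
    using assms by (simp add: powr_powr)
  ultimately show ?thesis
    by (simp add: airy_scale_def power_mult_distrib flip: of_real_power)
qed

lemma profile_ode_sol:
  assumes "J > 0"
  shows "ode_sol a b (\<lambda>t. \<i> * (J * t) - \<nu>) (profile J \<nu>) (profile' J \<nu>)"
  unfolding ode_sol_def
proof (intro ballI conjI)
  fix t
  define z where "z = (\<lambda>t::real. airy_scale J * (of_real t + \<i> * \<nu> / of_real J))"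
  have z: "(z has_vector_derivative airy_scale J) (at t within {a..b})"
    unfolding z_def by (auto intro!: derivative_eq_intros)
  show "(profile J \<nu> has_vector_derivative profile' J \<nu> t) (at t within {a..b})"
    using field_vector_diff_chain_within[OF z has_field_derivative_at_within[OF Airy_deriv]]
    by (simp add: o_def profile_def[abs_def] profile'_def z_def)
  have "((\<lambda>t. airy_scale J * Airy' (z t)) has_vector_derivative
      airy_scale J * (airy_scale J * (z t * Airy (z t)))) (at t within {a..b})"
    using field_vector_diff_chain_within[OF z has_field_derivative_at_within[OF Airy'_deriv]]
    by (intro has_vector_derivative_mult_right) (simp add: o_def)
  moreover have "airy_scale J * (airy_scale J * (z t * Airy (z t))) = (\<i> * (J * t) - \<nu>) * profile J \<nu> t"
  proof -
    have "airy_scale J * (airy_scale J * z t) = airy_scale J ^ 3 * (of_real t + \<i> * \<nu> / of_real J)"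
      by (simp add: z_def power3_eq_cube)
    also have "\<dots> = \<i> * (J * t) - \<nu>"
      using assms by (simp add: airy_scale_cube field_simps)
    finally show ?thesis
      by (simp add: profile_def z_def mult.assoc[symmetric])
  qed
  ultimately show "(profile' J \<nu> has_vector_derivative (\<i> * (J * t) - \<nu>) * profile J \<nu> t) (at t within {a..b})"
    by (simp add: profile'_def[abs_def] z_def)
qed

text \<open>Uniformity in \<open>J\<close> and \<open>\<nu>\<close> is the point, because
  \<open>J = V' x0\<close> varies with the eigenvalue. The sector bound holds with any exponential
  rate, and this pays for the weight \<open>1 + t ^ 4\<close>.\<close>

lemma profile_bound:
  assumes "0 < J0"
  obtains B where "\<And>J \<nu> t. J0 \<le> J \<Longrightarrow> J \<le> J1 \<Longrightarrow> norm \<nu> \<le> N \<Longrightarrow> 0 \<le> t \<Longrightarrow>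
    (1 + t ^ 4) * (norm (profile J \<nu> t))\<^sup>2 + (norm (profile' J \<nu> t))\<^sup>2 \<le> B * exp (- t)"
proof -
  define j0 where "j0 = J0 powr (1/3)"
  define j1 where "j1 = J1 powr (1/3)"
  have j0: "j0 > 0" using assms by (simp add: j0_def)
  have j1: "0 \<le> j1" by (simp add: j1_def)
  \<comment> \<open>With \<open>r = j * t\<close> and \<open>j \<ge> j0\<close> the rate
    \<open>2 / j0\<close> becomes at least 2 in \<open>t\<close>; after squaring,
    \<open>exp (- (3 * t))\<close> is spent on the weight and \<open>exp (- t)\<close>
    remains.\<close>
  obtain C where C: "C > 0" "\<And>r w. 0 \<le> r \<Longrightarrow> norm w \<le> j1 * N / J0 \<Longrightarrow>
      norm (Airy (cis (pi/6) * of_real r + w)) \<le> C * exp (- (2 / j0) * r)"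
    by (rule Airy_sector[of "j1 * N / J0" "2 / j0"]) blast
  obtain C' where C': "C' > 0" "\<And>r w. 0 \<le> r \<Longrightarrow> norm w \<le> j1 * N / J0 \<Longrightarrow>
      norm (Airy' (cis (pi/6) * of_real r + w)) \<le> C' * exp (- (2 / j0) * r)"
    by (rule Airy'_sector[of "j1 * N / J0" "2 / j0"]) blast
  have "(1 + t ^ 4) * (norm (profile J \<nu> t))\<^sup>2 + (norm (profile' J \<nu> t))\<^sup>2
      \<le> (257 * C\<^sup>2 + (j1 * C')\<^sup>2) * exp (- t)"
    if J: "J0 \<le> J" "J \<le> J1" and \<nu>: "norm \<nu> \<le> N" and t: "0 \<le> t" for J \<nu> t
  proof -
    define j where "j = J powr (1/3)"
    have j: "j0 \<le> j" "j \<le> j1" "0 < j"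
      using assms J by (auto simp: j0_def j1_def j_def powr_mono2)
    define w where "w = airy_scale J * (\<i> * \<nu> / of_real J)"
    have "norm w = j * (norm \<nu> / J)"
      using assms J by (simp add: w_def airy_scale_def norm_mult norm_divide j_def)
    also have "\<dots> \<le> j1 * (N / J0)"
      using j J \<nu> assms order_trans[OF norm_ge_zero \<nu>] by (intro mult_mono frac_le) auto
    finally have w: "norm w \<le> j1 * N / J0" by simp
    have arg: "airy_scale J * (of_real t + \<i> * \<nu> / of_real J) = cis (pi/6) * of_real (j * t) + w"
      by (simp add: w_def airy_scale_def j_def algebra_simps)
    have decay: "exp (- (2 / j0) * (j * t)) \<le> exp (- (2 * t))"
    proof -
      have "j0 * t \<le> j * t" using j t by (intro mult_right_mono)
      then have "2 * t \<le> 2 / j0 * (j * t)" using j0 by (simp add: field_simps)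
      then show ?thesis by simp
    qed
    have 1: "norm (profile J \<nu> t) \<le> C * exp (- (2 * t))"
      unfolding profile_def arg using C(2)[of "j * t" w] w t j decay C(1)
      by (intro order_trans[OF _ mult_left_mono[OF decay]]) auto
    have "norm (Airy' (cis (pi/6) * of_real (j * t) + w)) \<le> C' * exp (- (2 * t))"
      using C'(2)[of "j * t" w] w t j decay C'(1)
      by (intro order_trans[OF _ mult_left_mono[OF decay]]) auto
    then have 2: "norm (profile' J \<nu> t) \<le> j1 * (C' * exp (- (2 * t)))"
      unfolding profile'_def arg norm_mult using j j1
      by (intro mult_mono) (auto simp: airy_scale_def norm_mult j_def)
    have e4: "(exp (- (2 * t)))\<^sup>2 = exp (- (3 * t)) * exp (- t)"
      by (simp add: power2_eq_square flip: exp_add)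
    \<comment> \<open>Its fourth power is \<open>t ^ 4 \<le> 256 * exp t\<close>.\<close>
    have "t / 4 \<le> exp (t / 4)"
      using exp_ge_add_one_self[of "t / 4"] by linarith
    then have "(t / 4) ^ 4 \<le> exp (t / 4) ^ 4"
      using t by (intro power_mono) auto
    then have "t ^ 4 \<le> 256 * exp t"
      by (simp add: power_divide flip: exp_of_nat_mult)
    moreover have "1 \<le> exp t" using t by simp
    ultimately have "1 + t ^ 4 \<le> 257 * exp t"
      by linarith
    also have "\<dots> \<le> 257 * exp (3 * t)" using t by simp
    finally have p: "1 + t ^ 4 \<le> 257 * exp (3 * t)" .
    have "(1 + t ^ 4) * (norm (profile J \<nu> t))\<^sup>2 \<le> 257 * exp (3 * t) * (C * exp (- (2 * t)))\<^sup>2"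
      by (intro mult_mono p power_mono 1) auto
    also have "\<dots> = 257 * C\<^sup>2 * exp (- t)"
      unfolding power_mult_distrib e4 by (simp add: exp_minus)
    finally have 3: "(1 + t ^ 4) * (norm (profile J \<nu> t))\<^sup>2 \<le> 257 * C\<^sup>2 * exp (- t)" .
    have "(norm (profile' J \<nu> t))\<^sup>2 \<le> (j1 * (C' * exp (- (2 * t))))\<^sup>2"
      by (intro power_mono 2) auto
    also have "\<dots> = (j1 * C')\<^sup>2 * (exp (- (3 * t)) * exp (- t))"
      unfolding power_mult_distrib e4 by simp
    also have "\<dots> \<le> (j1 * C')\<^sup>2 * (1 * exp (- t))"
      using t by (intro mult_left_mono mult_right_mono) auto
    finally show ?thesis
      using 3 by (simp add: distrib_right)
  qed
  then show ?thesis by (rule that)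
qed

text \<open>A real shift of \<open>\<nu>\<close> moves the argument of \<open>Airy\<close> in the
  direction \<open>\<kappa> * \<i>\<close>. Along it both terms in the derivative of the product are
  purely imaginary, because \<open>\<kappa> ^ 3 = \<i> * J\<close>; so the real part keeps its value
  at \<open>\<nu> = 0\<close>.\<close>

lemma profile_det:
  fixes \<nu> :: real
  assumes "0 < J"
  shows "Re (profile' J \<nu> 0 * cnj (profile J \<nu> 0)) =
    J powr (1/3) * cos (pi/6) * Re (Airy' 0 * cnj (Airy 0))"
proof -
  define \<kappa> where "\<kappa> = airy_scale J"
  define H where "H = (\<lambda>s. Re (\<kappa> * Airy' (\<kappa> * \<i> * of_real s) * cnj (Airy (\<kappa> * \<i> * of_real s))))"
  have "(H has_real_derivative 0) (at s)" for s
  proof -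
    have shift: "((\<lambda>s. \<kappa> * \<i> * of_real s) has_vector_derivative \<kappa> * \<i>) (at s)"
      by (auto intro!: derivative_eq_intros)
    define A where "A = Airy (\<kappa> * \<i> * of_real s)"
    define A' where "A' = Airy' (\<kappa> * \<i> * of_real s)"
    have 1: "((\<lambda>s. Airy (\<kappa> * \<i> * of_real s)) has_vector_derivative \<kappa> * \<i> * A') (at s)"
      using field_vector_diff_chain_at[OF shift Airy_deriv] by (simp add: o_def A'_def)
    have 2: "((\<lambda>s. \<kappa> * Airy' (\<kappa> * \<i> * of_real s)) has_vector_derivative
        \<kappa> * (\<kappa> * \<i> * (\<kappa> * \<i> * of_real s * A))) (at s)"
      using field_vector_diff_chain_at[OF shift Airy'_deriv]
      by (intro has_vector_derivative_mult_right) (simp add: o_def A_def)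
    have "\<kappa> * (\<kappa> * \<i> * (\<kappa> * \<i> * of_real s * A)) = - (\<kappa> ^ 3) * of_real s * A"
      by (simp add: power3_eq_cube algebra_simps)
    also have "\<dots> = - \<i> * of_real (J * s) * A"
      using assms by (simp add: \<kappa>_def airy_scale_cube)
    finally have 3: "\<kappa> * (\<kappa> * \<i> * (\<kappa> * \<i> * of_real s * A)) = - \<i> * of_real (J * s) * A" .
    have "Re (\<kappa> * A' * cnj (\<kappa> * \<i> * A') + - \<i> * of_real (J * s) * A * cnj A) = 0"
      by (simp add: algebra_simps)
    then show ?thesis
      unfolding has_real_derivative_iff_has_vector_derivative H_def
      by (intro has_vector_derivative_eq_rhs[OF bounded_linear.has_vector_derivative[OF bounded_linear_Re
          has_vector_derivative_mult[OF 2[unfolded 3] has_vector_derivative_cnj[OF 1]]]])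
        (simp only: A_def A'_def)
  qed
  then have "H (\<nu> / J) = H 0"
    by (intro DERIV_isconst_all) auto
  moreover have "H 0 = J powr (1/3) * cos (pi/6) * Re (Airy' 0 * cnj (Airy 0))"
    using Airy'_of_real[of 0] Airy_of_real[of 0]
    by (simp add: H_def \<kappa>_def airy_scale_def)
  ultimately show ?thesis
    by (simp add: H_def profile_def profile'_def \<kappa>_def mult.assoc)
qed

lemma profile_at_0:
  assumes "0 < J"
  shows "profile J \<nu> 0 = Airy (cis (2 * pi / 3) * \<nu> / of_real (J powr (2/3)))"
    and "profile' J \<nu> 0 = airy_scale J * Airy' (cis (2 * pi / 3) * \<nu> / of_real (J powr (2/3)))"
proof -
  have "complex_of_real (J powr (1/3)) / of_real J = 1 / of_real (J powr (2/3))"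
  proof -
    have "J powr (1/3) * J powr (2/3) = J"
      using assms by (simp flip: powr_add)
    then have "J powr (1/3) / J = 1 / J powr (2/3)"
      using assms by (simp add: field_simps)
    then show ?thesis by (metis of_real_1 of_real_divide)
  qed
  moreover have "cis (pi/6) * \<i> = cis (2 * pi / 3)"
    by (simp add: cis_mult flip: cis_pi_half)
  moreover have "airy_scale J * (of_real 0 + \<i> * \<nu> / of_real J) =
      cis (pi/6) * \<i> * \<nu> * (complex_of_real (J powr (1/3)) / of_real J)"
    by (simp add: airy_scale_def)
  ultimately have "airy_scale J * (of_real 0 + \<i> * \<nu> / of_real J) = cis (2 * pi / 3) * \<nu> / of_real (J powr (2/3))"
    by simp
  then show "profile J \<nu> 0 = Airy (cis (2 * pi / 3) * \<nu> / of_real (J powr (2/3)))"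
    "profile' J \<nu> 0 = airy_scale J * Airy' (cis (2 * pi / 3) * \<nu> / of_real (J powr (2/3)))"
    by (simp_all add: profile_def profile'_def)
qed

text \<open>Zeros of \<open>Airy\<close> are real, so \<open>\<nu>\<close> is a real number at most
  \<open>\<mu>\<close>, rotated by \<open>- 2 * pi / 3\<close> and scaled; the cosine of this angle
  is where the factor 1/2 arises.\<close>

lemma profile_zero:
  assumes "0 < J" "profile J \<nu> 0 = 0" "Airy 0 \<noteq> 0"
    and \<mu>: "\<And>x. airy_Ai x = 0 \<Longrightarrow> x \<le> \<mu>"
  shows "Re \<nu> \<ge> - \<mu> / 2 * J powr (2/3)"
proof -
  define z where "z = cis (2 * pi / 3) * \<nu> / of_real (J powr (2/3))"
  have "Airy z = 0" using assms(2) profile_at_0(1)[OF assms(1)] by (simp add: z_def)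
  then have z: "z = of_real (Re z)"
    using Airy_zero_real[OF assms(3)] by (simp add: complex_eq_iff)
  then have "Re z \<le> \<mu>"
    using \<open>Airy z = 0\<close> by (intro \<mu>) (metis Airy_of_real of_real_eq_0_iff)
  have "\<nu> = cis (- (2 * pi / 3)) * z * of_real (J powr (2/3))"
    using assms(1) unfolding z_def by (simp add: mult.assoc[symmetric] cis_mult)
  also have "\<dots> = cis (- (2 * pi / 3)) * of_real (Re z * J powr (2/3))"
    by (subst z) simp
  finally have "Re \<nu> = - (Re z) / 2 * J powr (2/3)"
    by (simp add: cos_120)
  then show ?thesis
    using \<open>Re z \<le> \<mu>\<close> by (simp add: mult_right_mono)
qed

text \<open>Difference inequalities instead of smoothness: they are what the rescaled estimates use,
  and the reflected potential inherits them with the same constants, so that each result at the left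
  end also gives one at the right end.\<close>

locale increasing_potential =
  fixes a b :: real and V V' :: "real \<Rightarrow> real" and m J1 K :: real
  assumes ab: "a < b" and m: "0 < m" and K: "0 \<le> K"
    and lower: "\<And>x y. a \<le> x \<Longrightarrow> x \<le> y \<Longrightarrow> y \<le> b \<Longrightarrow> m * (y - x) \<le> V y - V x"
    and upper: "\<And>x y. a \<le> x \<Longrightarrow> x \<le> y \<Longrightarrow> y \<le> b \<Longrightarrow> V y - V x \<le> J1 * (y - x)"
    and taylor: "\<And>x y. x \<in> {a..b} \<Longrightarrow> y \<in> {a..b} \<Longrightarrow> \<bar>V y - V x - V' x * (y - x)\<bar> \<le> K * (y - x)\<^sup>2"
    and V'_bounds: "\<And>x. x \<in> {a..b} \<Longrightarrow> m \<le> V' x \<and> V' x \<le> J1"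
begin

lemma continuous_V: "continuous_on {a..b} V"
proof (rule continuous_on_subset[OF lipschitz_on_continuous_on[of J1 "{a..b}"]])
  show "J1-lipschitz_on {a..b} V"
  proof (rule lipschitz_onI)
    show "0 \<le> J1" using V'_bounds[of a] m ab by auto
    show "dist (V x) (V y) \<le> J1 * dist x y" if "x \<in> {a..b}" "y \<in> {a..b}" for x y
    proof (cases "x \<le> y")
      case True
      have "0 \<le> m * (y - x)" using m True by simp
      then show ?thesis using that True lower[of x y] upper[of x y] by (auto simp: dist_real_def)
    next
      case False
      then have "0 \<le> m * (x - y)" using m by simp
      then show ?thesis using that False lower[of y x] upper[of y x] by (auto simp: dist_real_def)
    qed
  qed
qed auto

text \<open>Conjugation changes \<open>\<i> * V\<close> into \<open>- \<i> * V\<close>, and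
  reversing the interval makes \<open>- V\<close> increasing again. This symmetry exchanges the
  endpoints and conjugates the spectral parameter.\<close>

lemma reflected: "increasing_potential a b (\<lambda>x. - V (a + b - x)) (\<lambda>x. V' (a + b - x)) m J1 K"
proof unfold_locales
  show "m * (y - x) \<le> - V (a + b - y) - - V (a + b - x)" "- V (a + b - y) - - V (a + b - x) \<le> J1 * (y - x)"
    if "a \<le> x" "x \<le> y" "y \<le> b" for x y
    using that lower[of "a + b - y" "a + b - x"] upper[of "a + b - y" "a + b - x"] by auto
  show "\<bar>- V (a + b - y) - - V (a + b - x) - V' (a + b - x) * (y - x)\<bar> \<le> K * (y - x)\<^sup>2"
    if "x \<in> {a..b}" "y \<in> {a..b}" for x y
  proof -
    have "\<bar>V (a + b - y) - V (a + b - x) - V' (a + b - x) * ((a + b - y) - (a + b - x))\<bar>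
        \<le> K * ((a + b - y) - (a + b - x))\<^sup>2"
      using that by (intro taylor) auto
    then show ?thesis by (simp add: abs_minus_commute power2_commute algebra_simps)
  qed
  show "m \<le> V' (a + b - x) \<and> V' (a + b - x) \<le> J1" if "x \<in> {a..b}" for x
    using that by (intro V'_bounds) auto
qed (use ab m K in auto)

text \<open>This is \<open>halfline_wronskian\<close> in the variable
  \<open>t = (x - x0) / \<delta>\<close>. The errors are the inverse length
  \<open>\<delta> / (b - x0)\<close> of the interval and the rescaled Taylor constant
  \<open>K * \<delta>\<close>; \<open>C\<close> is uniform in the base point.\<close>

lemma right_estimate:
  obtains C where "C > 0"
    "\<And>x0 \<delta> \<nu> u u'. a \<le> x0 \<Longrightarrow> x0 < b \<Longrightarrow> 0 < \<delta> \<Longrightarrow> norm \<nu> \<le> N \<Longrightarrow>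
       ode_sol x0 b (\<lambda>x. (\<i> * of_real (V x - V x0) - of_real \<delta> * \<nu>) / of_real (\<delta> ^ 3)) u u' \<Longrightarrow> u b = 0 \<Longrightarrow>
       (norm (u x0))\<^sup>2 + (norm (of_real \<delta> * u' x0))\<^sup>2 = 1 \<Longrightarrow>
       norm (u x0 * profile' (V' x0) \<nu> 0 - of_real \<delta> * u' x0 * profile (V' x0) \<nu> 0) \<le> C * (\<delta> / (b - x0) + \<delta>)"
proof -
  obtain B where B: "\<And>J \<nu> t. m \<le> J \<Longrightarrow> J \<le> J1 \<Longrightarrow> norm \<nu> \<le> N \<Longrightarrow> 0 \<le> t \<Longrightarrow>
    (1 + t ^ 4) * (norm (profile J \<nu> t))\<^sup>2 + (norm (profile' J \<nu> t))\<^sup>2 \<le> B * exp (- t)"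
    by (rule profile_bound[OF m, of J1 N]) blast
  define C0 where "C0 = \<bar>halfline_const m J1 N + B\<bar>"
  have "norm (u x0 * profile' (V' x0) \<nu> 0 - of_real \<delta> * u' x0 * profile (V' x0) \<nu> 0)
      \<le> (C0 * (1 + K) + 1) * (\<delta> / (b - x0) + \<delta>)"
    if x0: "a \<le> x0" "x0 < b" and \<delta>: "0 < \<delta>" and \<nu>: "norm \<nu> \<le> N"
      and u: "ode_sol x0 b (\<lambda>x. (\<i> * of_real (V x - V x0) - of_real \<delta> * \<nu>) / of_real (\<delta> ^ 3)) u u'"
      and ub: "u b = 0" and init: "(norm (u x0))\<^sup>2 + (norm (of_real \<delta> * u' x0))\<^sup>2 = 1"
    for x0 \<delta> \<nu> u u'
  proof -
    define S where "S = (b - x0) / \<delta>"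
    define W where "W = (\<lambda>t. (V (\<delta> * t + x0) - V x0) / \<delta>)"
    define w where "w = (\<lambda>t. u (\<delta> * t + x0))"
    define w' where "w' = (\<lambda>t. of_real \<delta> * u' (\<delta> * t + x0))"
    have S: "0 < S" using x0 \<delta> by (simp add: S_def)
    have range: "\<delta> * t + x0 \<in> {x0..b}" if "t \<in> {0..S}" for t
      using that \<delta> by (auto simp: S_def field_simps)
    have range': "(\<lambda>t. \<delta> * t + x0) ` {0..S} \<subseteq> {a..b}"
      using range x0 by fastforce
    have "ode_sol 0 S (\<lambda>t. (of_real \<delta>)\<^sup>2 * ((\<i> * of_real (V (\<delta> * t + x0) - V x0) - of_real \<delta> * \<nu>) / of_real (\<delta> ^ 3))) w w'"
      unfolding w_def w'_def by (rule ode_sol_affine[OF u range])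
    moreover have "(of_real \<delta>)\<^sup>2 * ((\<i> * of_real (V (\<delta> * t + x0) - V x0) - of_real \<delta> * \<nu>) / of_real (\<delta> ^ 3))
        = \<i> * W t - \<nu>" for t
      using \<delta> by (simp add: W_def field_simps power2_eq_square power3_eq_cube)
    ultimately have w: "ode_sol 0 S (\<lambda>t. \<i> * W t - \<nu>) w w'"
      by simp
    have "norm (w 0 * profile' (V' x0) \<nu> 0 - w' 0 * profile (V' x0) \<nu> 0)
        \<le> (halfline_const m J1 N + B) * (1 / S + K * \<delta>)"
    proof (rule halfline_wronskian[OF S w])
      show "w S = 0" using \<delta> ub by (simp add: w_def S_def)
      show "(norm (w 0))\<^sup>2 + (norm (w' 0))\<^sup>2 = 1" using init by (simp add: w_def w'_def)
      show "continuous_on {0..S} W"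
        unfolding W_def using \<delta> range'
        by (intro continuous_intros continuous_on_compose2[OF continuous_V, of "{0..S}" "\<lambda>t. \<delta> * t + x0"]) auto
      show "0 < m" by (rule m)
      fix t assume t: "t \<in> {0..S}"
      note r = range[OF t]
      have "m * (\<delta> * t) \<le> V (\<delta> * t + x0) - V x0"
        using lower[of x0 "\<delta> * t + x0"] r x0 by simp
      then show "m * t \<le> W t" using \<delta> by (simp add: W_def field_simps)
      have "V (\<delta> * t + x0) - V x0 \<le> J1 * (\<delta> * t)"
        using upper[of x0 "\<delta> * t + x0"] r x0 by simp
      then show "W t \<le> J1 * t" using \<delta> by (simp add: W_def field_simps)
      have "\<bar>V (\<delta> * t + x0) - V x0 - V' x0 * (\<delta> * t)\<bar> \<le> K * (\<delta> * t)\<^sup>2"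
        using taylor[of x0 "\<delta> * t + x0"] r x0 by simp
      moreover have "W t - V' x0 * t = (V (\<delta> * t + x0) - V x0 - V' x0 * (\<delta> * t)) / \<delta>"
        using \<delta> by (simp add: W_def field_simps)
      ultimately show "\<bar>W t - V' x0 * t\<bar> \<le> K * \<delta> * t\<^sup>2"
        using \<delta> by (simp add: abs_divide divide_le_eq power2_eq_square algebra_simps)
      show "(1 + t ^ 4) * (norm (profile (V' x0) \<nu> t))\<^sup>2 + (norm (profile' (V' x0) \<nu> t))\<^sup>2 \<le> B * exp (- t)"
        using t V'_bounds[of x0] x0 \<nu> by (intro B) auto
    next
      show "ode_sol 0 S (\<lambda>t. \<i> * (V' x0 * t) - \<nu>) (profile (V' x0) \<nu>) (profile' (V' x0) \<nu>)"
        using V'_bounds[of x0] m x0 by (intro profile_ode_sol) auto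
    qed (use K \<delta> \<nu> in auto)
    also have "\<dots> \<le> C0 * (1 / S + K * \<delta>)"
      unfolding C0_def using S K \<delta> by (intro mult_right_mono) auto
    also have "\<dots> \<le> C0 * ((1 + K) * (\<delta> / (b - x0) + \<delta>))"
    proof (rule mult_left_mono)
      have "0 \<le> K * (\<delta> / (b - x0))" using K \<delta> x0 by simp
      then show "1 / S + K * \<delta> \<le> (1 + K) * (\<delta> / (b - x0) + \<delta>)"
        using \<delta> by (simp add: S_def algebra_simps add_divide_distrib)
    qed (simp add: C0_def)
    also have "\<dots> \<le> (C0 * (1 + K) + 1) * (\<delta> / (b - x0) + \<delta>)"
      using \<delta> x0 unfolding distrib_right[of _ 1] mult.assoc by simp
    finally show ?thesis by (simp add: w_def w'_def)
  qed
  moreover have "C0 * (1 + K) + 1 > 0" using K by (intro add_nonneg_pos mult_nonneg_nonneg) (auto simp: C0_def)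
  ultimately show ?thesis using that by blast
qed

end

subsection \<open>Dirichlet eigenvalues\<close>

lemma ode_sol_reverse:
  assumes "ode_sol a b q y y'"
  shows "ode_sol a b (\<lambda>x. q (a + b - x)) (\<lambda>x. y (a + b - x)) (\<lambda>x. - y' (a + b - x))"
  using ode_sol_affine[OF assms, of a b "-1" "a + b"] by simp

lemma ode_sol_reverse_cnj:
  assumes "ode_sol a b q y y'"
  shows "ode_sol a b (\<lambda>x. cnj (q (a + b - x))) (\<lambda>x. cnj (y (a + b - x))) (\<lambda>x. - cnj (y' (a + b - x)))"
  using ode_sol_cnj[OF ode_sol_reverse[OF assms]] by simp

text \<open>The Wronskian of the solutions at \<open>\<mu>\<close> and \<open>\<nu>\<close> gives
  the difference quotient in closed form: an integral of their product, divided by their values at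
  \<open>b\<close>. Hence continuity of the solution in \<open>\<nu>\<close> already yields a
  complex derivative, and no variational equation is solved.\<close>

lemma shooting_holomorphic:
  fixes y y' :: "complex \<Rightarrow> real \<Rightarrow> complex"
  assumes "a < b" and q: "continuous_on {a..b} q"
    and y: "\<And>\<nu>. ode_sol a b (\<lambda>x. q x - \<kappa> * \<nu>) (y \<nu>) (y' \<nu>)"
    and init: "\<And>\<nu>. y \<nu> a = 0" "\<And>\<nu>. y' \<nu> a = 1"
    and nz: "y \<mu> b \<noteq> 0"
  shows "\<exists>D. ((\<lambda>\<nu>. y' \<nu> b / y \<nu> b) has_field_derivative D) (at \<mu>)"
proof -
  note cont = ode_sol_continuous[OF y]
  obtain K where K: "K > 0" "\<And>x. x \<in> {a..b} \<Longrightarrow> norm (q x) \<le> K"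
    using compact_imp_bounded[OF compact_continuous_image[OF q compact_Icc]]
    unfolding bounded_pos by blast
  obtain Y where Y: "Y > 0" "\<And>x. x \<in> {a..b} \<Longrightarrow> norm (y \<mu> x) \<le> Y"
    using compact_imp_bounded[OF compact_continuous_image[OF cont(1)[of \<mu>] compact_Icc]]
    unfolding bounded_pos by blast
  define k where "k = K + norm \<kappa> * (norm \<mu> + 1)"
  define L where "L = sqrt (exp ((k + 2) * (b - a)) * (b - a)) * (norm \<kappa> * Y)"
  have k: "k \<ge> 0" using K(1) by (simp add: k_def)
  \<comment> \<open>The difference of the two solutions has zero data at \<open>a\<close> and is
    driven by \<open>- \<kappa> * (\<nu> - \<mu>) * y \<mu>\<close>; \<open>k\<close> bounds the
    potential for all \<open>\<nu>\<close> within distance 1 of \<open>\<mu>\<close>.\<close>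
  have close: "norm (y \<nu> x - y \<mu> x) \<le> L * norm (\<nu> - \<mu>)"
    if \<nu>: "norm (\<nu> - \<mu>) \<le> 1" and x: "x \<in> {a..b}" for \<nu> x
  proof -
    define \<gamma> where "\<gamma> = norm \<kappa> * Y * norm (\<nu> - \<mu>)"
    have "(norm (y \<nu> x - y \<mu> x))\<^sup>2 + (norm (y' \<nu> x - y' \<mu> x))\<^sup>2
        \<le> exp ((k + 2) * (x - a)) * ((norm (y \<nu> a - y \<mu> a))\<^sup>2 + (norm (y' \<nu> a - y' \<mu> a))\<^sup>2 + \<gamma>\<^sup>2 * (x - a))"
    proof (rule gronwall_second_order[where b = b])
      fix t assume t: "t \<in> {a..b}"
      show "((\<lambda>t. y \<nu> t - y \<mu> t) has_vector_derivative y' \<nu> t - y' \<mu> t) (at t within {a..b})"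
        using y t unfolding ode_sol_def by (intro has_vector_derivative_diff) auto
      have "((\<lambda>t. y' \<nu> t - y' \<mu> t) has_vector_derivative (q t - \<kappa> * \<nu>) * y \<nu> t - (q t - \<kappa> * \<mu>) * y \<mu> t) (at t within {a..b})"
        using y t unfolding ode_sol_def by (intro has_vector_derivative_diff) auto
      then show "((\<lambda>t. y' \<nu> t - y' \<mu> t) has_vector_derivative
          (q t - \<kappa> * \<nu>) * (y \<nu> t - y \<mu> t) + - \<kappa> * (\<nu> - \<mu>) * y \<mu> t) (at t within {a..b})"
        by (rule has_vector_derivative_eq_rhs) (simp add: algebra_simps)
      have "norm \<nu> \<le> norm \<mu> + 1" using \<nu> norm_triangle_sub[of \<nu> \<mu>] by linarith
      then have "norm \<kappa> * norm \<nu> \<le> norm \<kappa> * (norm \<mu> + 1)" by (intro mult_left_mono) auto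
      then show "norm (q t - \<kappa> * \<nu>) \<le> k"
        using norm_triangle_ineq4[of "q t" "\<kappa> * \<nu>"] K(2)[OF t] by (simp add: k_def norm_mult)
      show "norm (- \<kappa> * (\<nu> - \<mu>) * y \<mu> t) \<le> \<gamma>"
        unfolding \<gamma>_def norm_mult norm_minus_cancel
        using mult_left_mono[OF Y(2)[OF t], of "norm \<kappa> * norm (\<nu> - \<mu>)"] by (simp add: mult_ac)
    qed (use assms(1) x in auto)
    also have "\<dots> \<le> exp ((k + 2) * (b - a)) * (\<gamma>\<^sup>2 * (b - a))"
      using init x k by (auto intro!: mult_mono)
    also have "\<dots> = (L * norm (\<nu> - \<mu>))\<^sup>2"
      using assms(1) by (simp add: L_def \<gamma>_def power_mult_distrib)
    finally have "(norm (y \<nu> x - y \<mu> x))\<^sup>2 \<le> (L * norm (\<nu> - \<mu>))\<^sup>2"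
      by (smt (verit) zero_le_power2)
    moreover have "0 \<le> L * norm (\<nu> - \<mu>)" using Y assms(1) by (simp add: L_def)
    ultimately show ?thesis by (rule power2_le_imp_le)
  qed
  have ev1: "\<forall>\<^sub>F \<nu> in at \<mu>. norm (\<nu> - \<mu>) \<le> 1"
    unfolding eventually_at by (intro exI[of _ 1]) (auto simp: dist_norm)
  have lim_small: "((\<lambda>\<nu>. C * norm (\<nu> - \<mu>)) \<longlongrightarrow> 0) (at \<mu>)" for C
    by (rule tendsto_eq_intros refl | simp)+
  have lim_b: "((\<lambda>\<nu>. y \<nu> b) \<longlongrightarrow> y \<mu> b) (at \<mu>)"
    by (rule LIM_zero_cancel, rule Lim_null_comparison[OF _ lim_small[of L]],
        use ev1 in eventually_elim) (use close assms(1) in auto)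
  have lim_int: "((\<lambda>\<nu>. integral {a..b} (\<lambda>x. y \<mu> x * y \<nu> x)) \<longlongrightarrow> integral {a..b} (\<lambda>x. y \<mu> x * y \<mu> x)) (at \<mu>)"
  proof (rule LIM_zero_cancel, rule Lim_null_comparison[OF _ lim_small[of "Y * L * (b - a)"]],
        use ev1 in eventually_elim)
    fix \<nu> assume \<nu>: "norm (\<nu> - \<mu>) \<le> 1"
    have "integral {a..b} (\<lambda>x. y \<mu> x * y \<nu> x) - integral {a..b} (\<lambda>x. y \<mu> x * y \<mu> x)
        = integral {a..b} (\<lambda>x. y \<mu> x * (y \<nu> x - y \<mu> x))"
      unfolding right_diff_distrib
      by (intro integral_diff[symmetric] integrable_continuous_real continuous_intros cont)
    also have "norm \<dots> \<le> integral {a..b} (\<lambda>x. Y * (L * norm (\<nu> - \<mu>)))"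
      using close[OF \<nu>] Y
      by (intro integral_norm_bound_integral)
        (auto simp: norm_mult intro!: integrable_continuous_real continuous_intros cont mult_mono)
    also have "\<dots> = Y * L * (b - a) * norm (\<nu> - \<mu>)"
      using assms(1) by simp
    finally show "norm (integral {a..b} (\<lambda>x. y \<mu> x * y \<nu> x) - integral {a..b} (\<lambda>x. y \<mu> x * y \<mu> x))
        \<le> Y * L * (b - a) * norm (\<nu> - \<mu>)" .
  qed
  define Q where "Q = (\<lambda>\<nu>. - \<kappa> * integral {a..b} (\<lambda>x. y \<mu> x * y \<nu> x) / (y \<mu> b * y \<nu> b))"
  have "(Q \<longlongrightarrow> Q \<mu>) (at \<mu>)"
    unfolding Q_def using nz by (intro tendsto_intros lim_int lim_b) auto
  moreover have "\<forall>\<^sub>F \<nu> in at \<mu>. Q \<nu> = (y' \<nu> b / y \<nu> b - y' \<mu> b / y \<mu> b) / (\<nu> - \<mu>)"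
    using tendsto_imp_eventually_ne[OF lim_b nz] eventually_neq_at_within[of \<mu> \<mu> UNIV]
  proof eventually_elim
    case (elim \<nu>)
    have "((\<lambda>x. (q x - \<kappa> * \<nu> - (q x - \<kappa> * \<mu>)) * y \<mu> x * y \<nu> x) has_integral
        (y \<mu> b * y' \<nu> b - y' \<mu> b * y \<nu> b) - (y \<mu> a * y' \<nu> a - y' \<mu> a * y \<nu> a)) {a..b}"
      using assms(1) by (intro ode_sol_wronskian[OF y y]) auto
    moreover have "(\<lambda>x. (q x - \<kappa> * \<nu> - (q x - \<kappa> * \<mu>)) * y \<mu> x * y \<nu> x) = (\<lambda>x. - \<kappa> * (\<nu> - \<mu>) * (y \<mu> x * y \<nu> x))"
      by (auto simp: algebra_simps)
    ultimately have "((\<lambda>x. - \<kappa> * (\<nu> - \<mu>) * (y \<mu> x * y \<nu> x)) has_integral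
        y \<mu> b * y' \<nu> b - y' \<mu> b * y \<nu> b) {a..b}"
      using init by simp
    moreover have "((\<lambda>x. - \<kappa> * (\<nu> - \<mu>) * (y \<mu> x * y \<nu> x)) has_integral
        - \<kappa> * (\<nu> - \<mu>) * integral {a..b} (\<lambda>x. y \<mu> x * y \<nu> x)) {a..b}"
      by (intro has_integral_mult_right integrable_integral integrable_continuous_real continuous_intros cont)
    ultimately have "y \<mu> b * y' \<nu> b - y' \<mu> b * y \<nu> b = - \<kappa> * (\<nu> - \<mu>) * integral {a..b} (\<lambda>x. y \<mu> x * y \<nu> x)"
      by (rule has_integral_unique)
    then have "- \<kappa> * integral {a..b} (\<lambda>x. y \<mu> x * y \<nu> x) = (y \<mu> b * y' \<nu> b - y' \<mu> b * y \<nu> b) / (\<nu> - \<mu>)"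
      using elim by (simp add: field_simps)
    moreover have "y' \<nu> b / y \<nu> b - y' \<mu> b / y \<mu> b = (y \<mu> b * y' \<nu> b - y' \<mu> b * y \<nu> b) / (y \<mu> b * y \<nu> b)"
      using elim nz by (simp add: diff_frac_eq mult.commute)
    ultimately show ?case
      unfolding Q_def by (simp only: divide_divide_eq_left mult.commute)
  qed
  ultimately have "((\<lambda>\<nu>. (y' \<nu> b / y \<nu> b - y' \<mu> b / y \<mu> b) / (\<nu> - \<mu>)) \<longlongrightarrow> Q \<mu>) (at \<mu>)"
    by (rule Lim_transform_eventually)
  then show ?thesis
    unfolding has_field_derivative_iff by blast
qed

text \<open>Here \<open>e\<close> stands for \<open>h\<^sup>2 = \<delta> ^ 3\<close>. Given
  \<open>u a = 0\<close>, the condition \<open>u' a \<noteq> 0\<close> expresses that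
  \<open>u\<close> is not trivial, in a form that can be normalised.\<close>

definition dirichlet_eigenvalue :: "real \<Rightarrow> real \<Rightarrow> (real \<Rightarrow> real) \<Rightarrow> real \<Rightarrow> complex \<Rightarrow> bool" where
  "dirichlet_eigenvalue a b V e z \<longleftrightarrow> (\<exists>u u'. ode_sol a b (\<lambda>x. (\<i> * V x - z) / of_real e) u u' \<and>
     u a = 0 \<and> u b = 0 \<and> u' a \<noteq> 0)"

lemma dirichlet_eigenvalue_reflect:
  assumes "dirichlet_eigenvalue a b V e z" "a < b" "continuous_on {a..b} V"
  shows "dirichlet_eigenvalue a b (\<lambda>x. - V (a + b - x)) e (cnj z)"
proof -
  obtain u u' where u: "ode_sol a b (\<lambda>x. (\<i> * V x - z) / of_real e) u u'" "u a = 0" "u b = 0" "u' a \<noteq> 0"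
    using assms(1) by (auto simp: dirichlet_eigenvalue_def)
  define w where "w = (\<lambda>x. cnj (u (a + b - x)))"
  define w' where "w' = (\<lambda>x. - cnj (u' (a + b - x)))"
  have w: "ode_sol a b (\<lambda>x. (\<i> * of_real (- V (a + b - x)) - cnj z) / of_real e) w w'"
    using ode_sol_reverse_cnj[OF u(1)] by (simp add: w_def w'_def)
  have "continuous_on {a..b} (\<lambda>x. (\<i> * of_real (- V (a + b - x)) - cnj z) / of_real e)"
    unfolding divide_inverse
    by (intro continuous_intros continuous_on_compose2[OF assms(3), of "{a..b}" "\<lambda>x. a + b - x"]) auto
  from ode_sol_zero(2)[OF w this, of b] have "w' a \<noteq> 0"
    using u assms(2) by (auto simp: w_def w'_def)
  then show ?thesis
    unfolding dirichlet_eigenvalue_def using w u by (intro exI[of _ w] exI[of _ w']) (auto simp: w_def)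
qed

text \<open>Pair the equation with the conjugate of \<open>u\<close>: the real part balances
  \<open>u'\<close> against \<open>Re z\<close>, and in the imaginary part \<open>V - Im z\<close>
  has zero weighted mean, so it cannot have a fixed sign. The second fact yields the base point at
  which the rescaled parameter is real.\<close>

lemma dirichlet_eigenvalue_location:
  assumes ev: "dirichlet_eigenvalue a b V e z" and e: "0 < e" and "a < b" and V: "continuous_on {a..b} V"
  shows "0 \<le> Re z" "\<exists>x\<in>{a..b}. Im z = V x"
proof -
  obtain u u' where u: "ode_sol a b (\<lambda>x. (\<i> * V x - z) / of_real e) u u'" "u a = 0" "u b = 0" "u' a \<noteq> 0"
    using ev by (auto simp: dirichlet_eigenvalue_def)
  note cont = ode_sol_continuous[OF u(1)]
  have re: "((\<lambda>x. (norm (u' x))\<^sup>2 - Re z / e * (norm (u x))\<^sup>2) has_integral 0) {a..b}"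
    using has_integral_FTC_real[OF less_imp_le[OF assms(3)] ode_sol_energy(1)[OF u(1)]] u(2,3) by simp
  have im: "((\<lambda>x. (V x - Im z) / e * (norm (u x))\<^sup>2) has_integral 0) {a..b}"
    using has_integral_FTC_real[OF less_imp_le[OF assms(3)] ode_sol_energy(2)[OF u(1)]] u(2,3) by simp
  have zero: "f x = 0" if "continuous_on {a..b} f" "\<And>x. x \<in> {a..b} \<Longrightarrow> 0 \<le> f x"
    "(f has_integral 0) {a..b}" "x \<in> {a..b}" for f :: "real \<Rightarrow> real" and x
    using has_integral_0_cbox_imp_0[of a b f x] that assms(3) by auto
  show "0 \<le> Re z"
  proof (rule ccontr)
    assume "\<not> 0 \<le> Re z"
    then have neg: "Re z / e * (norm (u x))\<^sup>2 \<le> 0" for x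
      using e by (intro mult_nonpos_nonneg divide_nonpos_pos) auto
    have "0 \<le> (norm (u' x))\<^sup>2 - Re z / e * (norm (u x))\<^sup>2" for x
      using neg[of x] zero_le_power2[of "norm (u' x)"] by linarith
    then have "(norm (u' a))\<^sup>2 - Re z / e * (norm (u a))\<^sup>2 = 0"
      using assms(3) by (intro zero[OF _ _ re] continuous_intros cont) auto
    then show False using u by simp
  qed
  show "\<exists>x\<in>{a..b}. Im z = V x"
  proof (rule ccontr)
    assume "\<not> ?thesis"
    then have ne: "V x \<noteq> Im z" if "x \<in> {a..b}" for x using that by metis
    have conn: "connected (V ` {a..b})"
      by (intro connected_continuous_image V connected_Icc)
    have sign: "(\<forall>x\<in>{a..b}. V x < Im z) \<or> (\<forall>x\<in>{a..b}. Im z < V x)"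
    proof (rule ccontr)
      assume "\<not> ?thesis"
      then obtain x y where xy: "x \<in> {a..b}" "y \<in> {a..b}" "V y \<le> Im z" "Im z \<le> V x"
        by (meson not_less)
      then have "Im z \<in> V ` {a..b}"
        using connectedD_interval[OF conn, of "V y" "V x" "Im z"] by blast
      then show False using ne by force
    qed
    have "u x = 0" if x: "x \<in> {a..b}" for x
    proof -
      have "\<bar>V x - Im z\<bar> / e * (norm (u x))\<^sup>2 = 0"
      proof (rule zero[OF _ _ _ x])
        show "continuous_on {a..b} (\<lambda>x. \<bar>V x - Im z\<bar> / e * (norm (u x))\<^sup>2)"
          by (intro continuous_intros cont V) (use e in auto)
        obtain s where s: "\<And>x. x \<in> {a..b} \<Longrightarrow> \<bar>V x - Im z\<bar> = s * (V x - Im z)"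
          using sign
        proof
          assume "\<forall>x\<in>{a..b}. V x < Im z"
          then show thesis by (intro that[of "-1"]) (auto simp: abs_if)
        next
          assume "\<forall>x\<in>{a..b}. Im z < V x"
          then show thesis by (intro that[of 1]) (force simp: abs_if)
        qed
        then have s: "\<bar>V x - Im z\<bar> / e * (norm (u x))\<^sup>2 = s * ((V x - Im z) / e * (norm (u x))\<^sup>2)"
          if "x \<in> {a..b}" for x using that by simp
        show "((\<lambda>x. \<bar>V x - Im z\<bar> / e * (norm (u x))\<^sup>2) has_integral 0) {a..b}"
          by (subst has_integral_cong[OF s]) (use has_integral_mult_right[OF im, of s] in simp_all)
      qed (use e in auto)
      then show ?thesis using ne[OF x] e by simp
    qed
    then have "((\<lambda>x. (norm (u' x))\<^sup>2) has_integral 0) {a..b}"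
      using re by (subst has_integral_cong[of _ _ "\<lambda>x. (norm (u' x))\<^sup>2 - Re z / e * (norm (u x))\<^sup>2"]) auto
    then have "(norm (u' a))\<^sup>2 = 0"
      using assms(3) by (intro zero) (auto intro!: continuous_intros cont)
    then show False using u by simp
  qed
qed

section \<open>Low eigenvalues of an increasing potential\<close>

context increasing_potential
begin

lemma profile_continuous:
  assumes "0 < J"
  shows "continuous_on S (\<lambda>\<nu>. profile J \<nu> 0)"
proof -
  have "continuous_on S (\<lambda>\<nu>. cis (2 * pi / 3) * \<nu> / of_real (J powr (2/3)))"
    using assms by (intro continuous_intros) auto
  then show ?thesis
    unfolding profile_at_0(1)[OF assms]
    by (rule continuous_on_compose2[OF holomorphic_on_imp_continuous_on[OF Airy_holomorphic[of UNIV]]]) simp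
qed

lemma V'_pos: "x \<in> {a..b} \<Longrightarrow> 0 < V' x"
  using V'_bounds[of x] m by simp

text \<open>With \<open>u a = 0\<close> the Wronskian estimate at \<open>a\<close> says that
  \<open>profile J \<nu> 0\<close> is of order \<open>\<delta>\<close>. Where
  \<open>Re \<nu>\<close> is below the threshold the profile has no zero, and by compactness it is
  bounded away from 0 there.\<close>

lemma left_endpoint_bound:
  assumes Airy0: "Airy 0 \<noteq> 0" and \<mu>: "\<And>x. airy_Ai x = 0 \<Longrightarrow> x \<le> \<mu>" and "0 < \<epsilon>"
  obtains \<delta>0 where "0 < \<delta>0"
    "\<And>\<delta> z. 0 < \<delta> \<Longrightarrow> \<delta> < \<delta>0 \<Longrightarrow> dirichlet_eigenvalue a b V (\<delta> ^ 3) z \<Longrightarrow> norm (z - \<i> * V a) \<le> N * \<delta> \<Longrightarrow>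
       Re z \<ge> (- \<mu> / 2 * V' a powr (2/3) - \<epsilon>) * \<delta>"
proof -
  define J where "J = V' a"
  have J: "0 < J" using V'_pos[of a] ab by (simp add: J_def)
  define S where "S = cball 0 N \<inter> {\<nu>. Re \<nu> \<le> - \<mu> / 2 * J powr (2/3) - \<epsilon>}"
  have "compact S"
    unfolding S_def by (intro compact_Int_closed compact_cball closed_halfspace_Re_le)
  moreover have "profile J \<nu> 0 \<noteq> 0" if "\<nu> \<in> S" for \<nu>
    using profile_zero[OF J _ Airy0 \<mu>, of \<nu>] that \<open>0 < \<epsilon>\<close> by (fastforce simp: S_def)
  ultimately obtain c where c: "0 < c" "\<And>\<nu>. \<nu> \<in> S \<Longrightarrow> c \<le> norm (profile J \<nu> 0)"
  proof (cases "S = {}")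
    case False
    assume "compact S" and nz: "\<And>\<nu>. \<nu> \<in> S \<Longrightarrow> profile J \<nu> 0 \<noteq> 0"
    then obtain \<nu>1 where "\<nu>1 \<in> S" "\<forall>\<nu>\<in>S. norm (profile J \<nu>1 0) \<le> norm (profile J \<nu> 0)"
      using continuous_attains_inf[of S "\<lambda>\<nu>. norm (profile J \<nu> 0)"] False
        continuous_on_norm[OF profile_continuous[OF J]] by blast
    then show thesis using nz[of \<nu>1] by (intro that[of "norm (profile J \<nu>1 0)"]) auto
  qed (auto intro: that[of 1])
  obtain C where C: "C > 0"
    "\<And>x0 \<delta> \<nu> u u'. a \<le> x0 \<Longrightarrow> x0 < b \<Longrightarrow> 0 < \<delta> \<Longrightarrow> norm \<nu> \<le> N \<Longrightarrow>
       ode_sol x0 b (\<lambda>x. (\<i> * of_real (V x - V x0) - of_real \<delta> * \<nu>) / of_real (\<delta> ^ 3)) u u' \<Longrightarrow> u b = 0 \<Longrightarrow>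
       (norm (u x0))\<^sup>2 + (norm (of_real \<delta> * u' x0))\<^sup>2 = 1 \<Longrightarrow>
       norm (u x0 * profile' (V' x0) \<nu> 0 - of_real \<delta> * u' x0 * profile (V' x0) \<nu> 0) \<le> C * (\<delta> / (b - x0) + \<delta>)"
    by (rule right_estimate[of N]) blast
  \<comment> \<open>Makes the error \<open>C * (\<delta> / (b - a) + \<delta>)\<close> smaller than
    the lower bound \<open>c\<close>.\<close>
  define \<delta>0 where "\<delta>0 = c / (C * (1 / (b - a) + 1))"
  have w: "0 < C * (1 / (b - a) + 1)"
    using C(1) ab by (intro mult_pos_pos add_pos_pos) auto
  have "Re z \<ge> (- \<mu> / 2 * V' a powr (2/3) - \<epsilon>) * \<delta>"
    if \<delta>: "0 < \<delta>" "\<delta> < \<delta>0" and ev: "dirichlet_eigenvalue a b V (\<delta> ^ 3) z"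
      and z: "norm (z - \<i> * V a) \<le> N * \<delta>" for \<delta> z
  proof (rule ccontr)
    assume neg: "\<not> ?thesis"
    define \<nu> where "\<nu> = (z - \<i> * V a) / of_real \<delta>"
    have z_eq: "z = \<i> * V a + of_real \<delta> * \<nu>" using \<delta> by (simp add: \<nu>_def)
    obtain u u' where u: "ode_sol a b (\<lambda>x. (\<i> * V x - z) / of_real (\<delta> ^ 3)) u u'" "u a = 0" "u b = 0" "u' a \<noteq> 0"
      using ev by (auto simp: dirichlet_eigenvalue_def)
    \<comment> \<open>Normalises the data at \<open>a\<close>: the value is 0 and the rescaled
      derivative becomes 1.\<close>
    define s where "s = 1 / (of_real \<delta> * u' a)"
    have "norm (s * u a * profile' (V' a) \<nu> 0 - of_real \<delta> * (s * u' a) * profile (V' a) \<nu> 0) \<le> C * (\<delta> / (b - a) + \<delta>)"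
    proof (rule C(2)[where u = "\<lambda>x. s * u x" and u' = "\<lambda>x. s * u' x"])
      show "norm \<nu> \<le> N" using z \<delta> by (simp add: \<nu>_def norm_divide divide_le_eq)
      have "(\<lambda>x. (\<i> * V x - z) / of_real (\<delta> ^ 3)) = (\<lambda>x. (\<i> * of_real (V x - V a) - of_real \<delta> * \<nu>) / of_real (\<delta> ^ 3))"
        by (simp add: z_eq algebra_simps)
      then show "ode_sol a b (\<lambda>x. (\<i> * of_real (V x - V a) - of_real \<delta> * \<nu>) / of_real (\<delta> ^ 3)) (\<lambda>x. s * u x) (\<lambda>x. s * u' x)"
        using ode_sol_scale[OF u(1), of s] by simp
      show "(norm (s * u a))\<^sup>2 + (norm (of_real \<delta> * (s * u' a)))\<^sup>2 = 1"
        using u \<delta> by (simp add: s_def)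
    qed (use ab \<delta> u in auto)
    then have "norm (profile J \<nu> 0) \<le> C * (\<delta> / (b - a) + \<delta>)"
      using u \<delta> by (simp add: s_def J_def)
    also have "\<dots> = C * (1 / (b - a) + 1) * \<delta>" by (simp add: algebra_simps)
    also have "\<dots> < c" using \<delta>(2) w by (simp add: \<delta>0_def pos_less_divide_eq mult.commute)
    finally have "\<nu> \<notin> S" using c(2)[of \<nu>] by auto
    moreover have "norm \<nu> \<le> N" using z \<delta> by (simp add: \<nu>_def norm_divide divide_le_eq)
    moreover have "Re \<nu> = Re z / \<delta>" by (simp add: \<nu>_def)
    then have "Re \<nu> \<le> - \<mu> / 2 * J powr (2/3) - \<epsilon>"
      using neg \<delta> by (simp add: J_def divide_le_eq)
    ultimately show False by (simp add: S_def)
  qed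
  moreover have "0 < \<delta>0" using c w by (simp add: \<delta>0_def)
  ultimately show ?thesis using that by blast
qed

end

context increasing_potential
begin

text \<open>If both endpoints are far from \<open>x0\<close>, then up to small errors the data of \<open>u\<close> at \<open>x0\<close> are
  proportional to those of the decaying profile and also to those of its reflected conjugate.\<close>

lemma interior_excluded:
  assumes Airy0: "Airy 0 \<noteq> 0"
  obtains R \<delta>0 where "0 < R" "0 < \<delta>0"
    "\<And>\<delta> x0 \<nu>. 0 < \<delta> \<Longrightarrow> \<delta> < \<delta>0 \<Longrightarrow> x0 \<in> {a..b} \<Longrightarrow> \<bar>\<nu>\<bar> \<le> N \<Longrightarrow>
       dirichlet_eigenvalue a b V (\<delta> ^ 3) (\<i> * V x0 + of_real (\<delta> * \<nu>)) \<Longrightarrow> x0 - a < R * \<delta> \<or> b - x0 < R * \<delta>"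
proof -
  interpret r: increasing_potential a b "\<lambda>x. - V (a + b - x)" "\<lambda>x. V' (a + b - x)" m J1 K
    by (rule reflected)
  obtain C where C: "C > 0"
    "\<And>x0 \<delta> \<nu> u u'. a \<le> x0 \<Longrightarrow> x0 < b \<Longrightarrow> 0 < \<delta> \<Longrightarrow> norm \<nu> \<le> N \<Longrightarrow>
       ode_sol x0 b (\<lambda>x. (\<i> * of_real (V x - V x0) - of_real \<delta> * \<nu>) / of_real (\<delta> ^ 3)) u u' \<Longrightarrow> u b = 0 \<Longrightarrow>
       (norm (u x0))\<^sup>2 + (norm (of_real \<delta> * u' x0))\<^sup>2 = 1 \<Longrightarrow>
       norm (u x0 * profile' (V' x0) \<nu> 0 - of_real \<delta> * u' x0 * profile (V' x0) \<nu> 0) \<le> C * (\<delta> / (b - x0) + \<delta>)"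
    by (rule right_estimate[of N]) blast
  obtain C2 where C2: "C2 > 0"
    "\<And>x0 \<delta> \<nu> u u'. a \<le> x0 \<Longrightarrow> x0 < b \<Longrightarrow> 0 < \<delta> \<Longrightarrow> norm \<nu> \<le> N \<Longrightarrow>
       ode_sol x0 b (\<lambda>x. (\<i> * of_real (- V (a + b - x) - - V (a + b - x0)) - of_real \<delta> * \<nu>) / of_real (\<delta> ^ 3)) u u' \<Longrightarrow> u b = 0 \<Longrightarrow>
       (norm (u x0))\<^sup>2 + (norm (of_real \<delta> * u' x0))\<^sup>2 = 1 \<Longrightarrow>
       norm (u x0 * profile' (V' (a + b - x0)) \<nu> 0 - of_real \<delta> * u' x0 * profile (V' (a + b - x0)) \<nu> 0) \<le> C2 * (\<delta> / (b - x0) + \<delta>)"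
    by (rule r.right_estimate[of N]) blast
  obtain B where B: "\<And>J \<nu> t. m \<le> J \<Longrightarrow> J \<le> J1 \<Longrightarrow> norm \<nu> \<le> N \<Longrightarrow> 0 \<le> t \<Longrightarrow>
    (1 + t ^ 4) * (norm (profile J \<nu> t))\<^sup>2 + (norm (profile' J \<nu> t))\<^sup>2 \<le> B * exp (- t)"
    by (rule profile_bound[OF m, of J1 N]) blast
  define P where "P = sqrt \<bar>B\<bar> + 1"
  define D where "D = m powr (1/3) * cos (pi/6) * \<bar>Re (Airy' 0 * cnj (Airy 0))\<bar>"
  have "Re (Airy' 0 * cnj (Airy 0)) \<noteq> 0"
    using Airy0 Airy'_0_nonzero[OF Airy0] Airy'_of_real[of 0] Airy_of_real[of 0]
    by (auto simp: complex_eq_iff)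
  then have D: "D > 0" using m by (simp add: D_def cos_30)
  have P: "P > 0" by (simp add: P_def add_nonneg_pos)
  \<comment> \<open>The tolerated Wronskian error. By Cramer's rule below it forces both normalised
    data to be at most 1/2 in modulus, so their squares cannot add up to 1.\<close>
  define \<eta> where "\<eta> = D / (2 * P)"
  have \<eta>: "\<eta> > 0" using D P by (simp add: \<eta>_def)
  \<comment> \<open>Each of \<open>1 / R\<close> and \<open>\<delta>\<close> contributes at most
    \<open>\<eta> / 4\<close> to the error.\<close>
  define R where "R = 4 * (C + C2) / \<eta>"
  define \<delta>0 where "\<delta>0 = \<eta> / (4 * (C + C2))"
  have R: "0 < R" and \<delta>0: "0 < \<delta>0" using C C2 \<eta> by (auto simp: R_def \<delta>0_def)
  have "x0 - a < R * \<delta> \<or> b - x0 < R * \<delta>"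
    if \<delta>: "0 < \<delta>" "\<delta> < \<delta>0" and x0: "x0 \<in> {a..b}" and \<nu>: "\<bar>\<nu>\<bar> \<le> N"
      and ev: "dirichlet_eigenvalue a b V (\<delta> ^ 3) (\<i> * V x0 + of_real (\<delta> * \<nu>))" for \<delta> x0 \<nu>
  proof (rule ccontr)
    assume neg: "\<not> ?thesis"
    define z where "z = \<i> * V x0 + of_real (\<delta> * \<nu>)"
    have "0 < R * \<delta>" using R \<delta> by simp
    then have inner: "a < x0" "x0 < b" "R * \<delta> \<le> x0 - a" "R * \<delta> \<le> b - x0" using neg by auto
    define J where "J = V' x0"
    have J: "m \<le> J" "J \<le> J1" "0 < J" using V'_bounds[OF x0] m by (auto simp: J_def)
    obtain u u' where u: "ode_sol a b (\<lambda>x. (\<i> * V x - z) / of_real (\<delta> ^ 3)) u u'" "u a = 0" "u b = 0" "u' a \<noteq> 0"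
      using ev by (auto simp: dirichlet_eigenvalue_def z_def)
    have cont_q: "continuous_on {a..b} (\<lambda>x. (\<i> * V x - z) / of_real (\<delta> ^ 3))"
      unfolding divide_inverse by (intro continuous_intros continuous_V)
    \<comment> \<open>Nontriviality is given at \<open>a\<close>; uniqueness, run backwards from
      \<open>x0\<close> to \<open>a\<close>, transfers it to the data at \<open>x0\<close>.\<close>
    have nz: "u x0 \<noteq> 0 \<or> u' x0 \<noteq> 0"
    proof (rule ccontr)
      assume "\<not> ?thesis"
      then have 0: "u (a + b - (a + b - x0)) = 0" "u' (a + b - (a + b - x0)) = 0" by auto
      have rev: "ode_sol (a + b - x0) b (\<lambda>x. (\<i> * V (a + b - x) - z) / of_real (\<delta> ^ 3))
          (\<lambda>x. u (a + b - x)) (\<lambda>x. - u' (a + b - x))"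
        by (rule ode_sol_subinterval[OF ode_sol_reverse[OF u(1)]]) (use x0 in auto)
      have "continuous_on {a + b - x0..b} (\<lambda>x. (\<i> * V (a + b - x) - z) / of_real (\<delta> ^ 3))"
        by (rule continuous_on_compose2[OF cont_q]) (use x0 in \<open>auto intro!: continuous_intros\<close>)
      from ode_sol_zero(2)[OF rev this, of b] have "- u' (a + b - b) = 0"
        using 0 x0 by simp
      then show False using u(4) by simp
    qed
    define n where "n = sqrt ((norm (u x0))\<^sup>2 + (norm (of_real \<delta> * u' x0))\<^sup>2)"
    have n2: "n\<^sup>2 = (norm (u x0))\<^sup>2 + (norm (of_real \<delta> * u' x0))\<^sup>2"
      by (simp add: n_def)
    have n: "n > 0"
      using nz \<delta> by (auto simp: n_def sum_power2_gt_zero_iff)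
    define s where "s = complex_of_real (1 / n)"
    define p where "p = s * u x0"
    define q where "q = of_real \<delta> * (s * u' x0)"
    have pq: "(norm p)\<^sup>2 + (norm q)\<^sup>2 = 1"
    proof -
      have "(norm p)\<^sup>2 + (norm q)\<^sup>2 = (1 / n)\<^sup>2 * n\<^sup>2"
        unfolding n2 using n by (simp add: p_def q_def s_def norm_mult norm_divide power_mult_distrib power_divide field_simps)
      then show ?thesis using n by (simp add: power_divide)
    qed
    define f where "f = profile J \<nu> 0"
    define f' where "f' = profile' J \<nu> 0"
    have sol: "ode_sol a b (\<lambda>x. (\<i> * of_real (V x - V x0) - of_real \<delta> * of_real \<nu>) / of_real (\<delta> ^ 3)) (\<lambda>x. s * u x) (\<lambda>x. s * u' x)"
    proof -
      have "(\<lambda>x. (\<i> * V x - z) / of_real (\<delta> ^ 3)) = (\<lambda>x. (\<i> * of_real (V x - V x0) - of_real \<delta> * of_real \<nu>) / of_real (\<delta> ^ 3))"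
        by (simp add: z_def algebra_simps)
      then show ?thesis using ode_sol_scale[OF u(1), of s] by simp
    qed
    have "norm (p * f' - q * f) \<le> C * (\<delta> / (b - x0) + \<delta>)"
      unfolding p_def q_def f_def f'_def J_def
    proof (rule C(2)[where u = "\<lambda>x. s * u x" and u' = "\<lambda>x. s * u' x"])
      show "ode_sol x0 b (\<lambda>x. (\<i> * of_real (V x - V x0) - of_real \<delta> * of_real \<nu>) / of_real (\<delta> ^ 3)) (\<lambda>x. s * u x) (\<lambda>x. s * u' x)"
        by (rule ode_sol_subinterval[OF sol]) (use x0 in auto)
    qed (use inner \<delta> \<nu> u pq in \<open>auto simp: p_def q_def\<close>)
    also have "\<dots> \<le> C * (1 / R + \<delta>)"
      using inner R \<delta> C(1) by (intro mult_left_mono add_mono) (auto simp: field_simps)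
    finally have right: "norm (p * f' - q * f) \<le> C * (1 / R + \<delta>)" .
    have "norm (cnj p * f' - (- cnj q) * f) \<le> C2 * (\<delta> / (b - (a + b - x0)) + \<delta>)"
    proof -
      \<comment> \<open>The reflected conjugate of the solution. It has the same parameter because
        \<open>\<nu>\<close> is real, and its rescaled data at the reflected point are
        \<open>cnj p\<close> and \<open>- cnj q\<close>.\<close>
      define w where "w = (\<lambda>x. cnj (s * u (a + b - x)))"
      define w' where "w' = (\<lambda>x. - cnj (s * u' (a + b - x)))"
      have "ode_sol a b (\<lambda>x. (\<i> * of_real (- V (a + b - x) - - V (a + b - (a + b - x0))) - of_real \<delta> * of_real \<nu>) / of_real (\<delta> ^ 3)) w w'"
      proof -
        have "(\<lambda>x. (\<i> * of_real (- V (a + b - x) - - V (a + b - (a + b - x0))) - of_real \<delta> * of_real \<nu>) / of_real (\<delta> ^ 3))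
            = (\<lambda>x. cnj ((\<i> * of_real (V (a + b - x) - V x0) - of_real \<delta> * of_real \<nu>) / of_real (\<delta> ^ 3)))"
          by (simp add: algebra_simps)
        then show ?thesis
          using ode_sol_reverse_cnj[OF sol] by (simp only: w_def w'_def)
      qed
      then have sol': "ode_sol (a + b - x0) b (\<lambda>x. (\<i> * of_real (- V (a + b - x) - - V (a + b - (a + b - x0))) - of_real \<delta> * of_real \<nu>) / of_real (\<delta> ^ 3)) w w'"
        by (rule ode_sol_subinterval) (use x0 in auto)
      have "norm (w (a + b - x0) * profile' (V' (a + b - (a + b - x0))) \<nu> 0
          - of_real \<delta> * w' (a + b - x0) * profile (V' (a + b - (a + b - x0))) \<nu> 0)
          \<le> C2 * (\<delta> / (b - (a + b - x0)) + \<delta>)"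
      proof (rule C2(2)[OF _ _ \<delta>(1) _ sol'])
        have "norm (w (a + b - x0)) = norm p" "norm (of_real \<delta> * w' (a + b - x0)) = norm q"
          by (simp_all add: w_def w'_def p_def q_def norm_mult)
        then show "(norm (w (a + b - x0)))\<^sup>2 + (norm (of_real \<delta> * w' (a + b - x0)))\<^sup>2 = 1"
          using pq by simp
      qed (use inner \<nu> u in \<open>auto simp: w_def\<close>)
      moreover have "w (a + b - x0) = cnj p" "of_real \<delta> * w' (a + b - x0) = - cnj q"
        by (simp_all add: w_def w'_def p_def q_def)
      ultimately show ?thesis by (simp add: f_def f'_def J_def)
    qed
    also have "\<dots> \<le> C2 * (1 / R + \<delta>)"
      using inner R \<delta> C2(1) by (intro mult_left_mono add_mono) (auto simp: field_simps)
    finally have "norm (cnj p * f' - (- cnj q) * f) \<le> C2 * (1 / R + \<delta>)" .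
    moreover have "norm (cnj p * f' - (- cnj q) * f) = norm (p * cnj f' + q * cnj f)"
      by (subst complex_mod_cnj[symmetric]) simp
    ultimately have left: "norm (p * cnj f' + q * cnj f) \<le> C2 * (1 / R + \<delta>)"
      by simp
    have small: "(C + C2) * (1 / R + \<delta>) < \<eta>"
    proof -
      have "(C + C2) * \<delta> < \<eta> / 4" using \<delta>(2) C(1) C2(1) by (simp add: \<delta>0_def field_simps)
      moreover have "(C + C2) * (1 / R) = \<eta> / 4" using C(1) C2(1) \<eta> by (simp add: R_def field_simps)
      ultimately show ?thesis unfolding distrib_left using \<eta> by linarith
    qed
    have fB: "(norm f)\<^sup>2 + (norm f')\<^sup>2 \<le> \<bar>B\<bar>"
      using B[of J "of_real \<nu>" 0] J \<nu> by (simp add: f_def f'_def)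
    have "norm f \<le> sqrt \<bar>B\<bar>" "norm f' \<le> sqrt \<bar>B\<bar>"
      using fB zero_le_power2[of "norm f"] zero_le_power2[of "norm f'"] by (intro real_le_rsqrt; linarith)+
    then have fP: "norm f \<le> P" "norm f' \<le> P" by (simp_all add: P_def)
    define E where "E = Re (f' * cnj f)"
    have "\<bar>E\<bar> = J powr (1/3) * cos (pi/6) * \<bar>Re (Airy' 0 * cnj (Airy 0))\<bar>"
      unfolding E_def f_def f'_def profile_det[OF J(3)] abs_mult by (simp add: cos_30)
    then have "D \<le> \<bar>E\<bar>"
      unfolding D_def using J m by (auto intro!: mult_right_mono powr_mono2 simp: cos_30)
    \<comment> \<open>The determinant of the two nearly homogeneous linear equations for
      \<open>p\<close> and \<open>q\<close>; by \<open>profile_det\<close> its modulus is bounded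
      below independently of \<open>\<nu>\<close>.\<close>
    have two_E: "f' * cnj f + cnj f' * f = of_real (2 * E)"
      by (simp add: E_def complex_eq_iff)
    have sum_bound: "norm x * norm (p * f' - q * f) + norm y * norm (p * cnj f' + q * cnj f) \<le> P * \<eta>"
      if "norm x \<le> P" "norm y \<le> P" for x y :: complex
    proof -
      have "norm x * norm (p * f' - q * f) + norm y * norm (p * cnj f' + q * cnj f)
          \<le> P * (C * (1 / R + \<delta>)) + P * (C2 * (1 / R + \<delta>))"
        using that left right P by (intro add_mono mult_mono) auto
      also have "\<dots> = P * ((C + C2) * (1 / R + \<delta>))" by (simp add: algebra_simps add_divide_distrib)
      also have "\<dots> \<le> P * \<eta>" using small P by (intro mult_left_mono) auto
      finally show ?thesis .
    qed
    have half: "norm w \<le> 1/2" if "norm (w * of_real (2 * E)) \<le> P * \<eta>" for w :: complex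
    proof -
      have "norm w * (2 * D) \<le> norm w * (2 * \<bar>E\<bar>)"
        using \<open>D \<le> \<bar>E\<bar>\<close> by (intro mult_left_mono) auto
      also have "\<dots> \<le> D / 2" using that P by (simp add: norm_mult \<eta>_def)
      finally have "4 * norm w * D \<le> 1 * D" by simp
      then have "4 * norm w \<le> 1" using D by (simp only: mult_le_cancel_right_pos)
      then show ?thesis by linarith
    qed
    have "p * of_real (2 * E) = cnj f * (p * f' - q * f) + f * (p * cnj f' + q * cnj f)"
      unfolding two_E[symmetric] by (simp add: algebra_simps)
    also have "norm \<dots> \<le> norm (cnj f) * norm (p * f' - q * f) + norm f * norm (p * cnj f' + q * cnj f)"
      by (metis norm_mult norm_triangle_ineq)
    also have "\<dots> \<le> P * \<eta>" using fP by (intro sum_bound) auto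
    finally have p_half: "norm p \<le> 1/2" by (rule half)
    have "q * of_real (2 * E) = (- cnj f') * (p * f' - q * f) + f' * (p * cnj f' + q * cnj f)"
      unfolding two_E[symmetric] by (simp add: algebra_simps)
    also have "norm \<dots> \<le> norm (- cnj f') * norm (p * f' - q * f) + norm f' * norm (p * cnj f' + q * cnj f)"
      by (metis norm_mult norm_triangle_ineq)
    also have "\<dots> \<le> P * \<eta>" using fP by (intro sum_bound) auto
    finally have q_half: "norm q \<le> 1/2" by (rule half)
    have "(norm p)\<^sup>2 + (norm q)\<^sup>2 \<le> (1/2)\<^sup>2 + (1/2)\<^sup>2"
      using p_half q_half by (intro add_mono power_mono) auto
    then show False using pq by (simp add: power2_eq_square)
  qed
  then show ?thesis using that R \<delta>0 by blast
qed

text \<open>An eigenvalue violating the bound has, at a suitable base point, a real rescaled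
  parameter between 0 and \<open>c\<close>, so \<open>interior_excluded\<close> puts this point
  within \<open>R * \<delta>\<close> of an endpoint. Moving the base point to the endpoint costs at
  most \<open>J1 * R\<close> in the parameter, and \<open>left_endpoint_bound\<close> applies to
  \<open>V\<close> or to its reflection.\<close>

lemma eigenvalue_lower_bound:
  assumes Airy0: "Airy 0 \<noteq> 0" and \<mu>: "\<And>x. airy_Ai x = 0 \<Longrightarrow> x \<le> \<mu>" and "\<mu> < 0" and "0 < \<epsilon>"
  obtains \<delta>0 where "0 < \<delta>0"
    "\<And>\<delta> z. 0 < \<delta> \<Longrightarrow> \<delta> < \<delta>0 \<Longrightarrow> dirichlet_eigenvalue a b V (\<delta> ^ 3) z \<Longrightarrow>
       Re z \<ge> (- \<mu> / 2 * (min (V' a) (V' b)) powr (2/3) - \<epsilon>) * \<delta>"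
proof -
  interpret r: increasing_potential a b "\<lambda>x. - V (a + b - x)" "\<lambda>x. V' (a + b - x)" m J1 K
    by (rule reflected)
  define c where "c = - \<mu> / 2 * (min (V' a) (V' b)) powr (2/3)"
  have c0: "0 \<le> c" using \<open>\<mu> < 0\<close> by (simp add: c_def mult_nonpos_nonneg)
  have pos: "0 < V' a" "0 < V' b" using V'_pos ab by auto
  have c: "c \<le> - \<mu> / 2 * V' a powr (2/3)" "c \<le> - \<mu> / 2 * V' b powr (2/3)"
    unfolding c_def using \<open>\<mu> < 0\<close> pos by (auto intro!: mult_left_mono powr_mono2)
  obtain R \<delta>1 where R: "0 < R" "0 < \<delta>1"
    "\<And>\<delta> x0 \<nu>. 0 < \<delta> \<Longrightarrow> \<delta> < \<delta>1 \<Longrightarrow> x0 \<in> {a..b} \<Longrightarrow> \<bar>\<nu>\<bar> \<le> c \<Longrightarrow>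
       dirichlet_eigenvalue a b V (\<delta> ^ 3) (\<i> * V x0 + of_real (\<delta> * \<nu>)) \<Longrightarrow> x0 - a < R * \<delta> \<or> b - x0 < R * \<delta>"
    by (rule interior_excluded[OF Airy0, of c]) blast
  obtain \<delta>2 where \<delta>2: "0 < \<delta>2"
    "\<And>\<delta> z. 0 < \<delta> \<Longrightarrow> \<delta> < \<delta>2 \<Longrightarrow> dirichlet_eigenvalue a b V (\<delta> ^ 3) z \<Longrightarrow> norm (z - \<i> * V a) \<le> (c + J1 * R) * \<delta> \<Longrightarrow>
       Re z \<ge> (- \<mu> / 2 * V' a powr (2/3) - \<epsilon>) * \<delta>"
    by (rule left_endpoint_bound[OF Airy0 \<mu> \<open>0 < \<epsilon>\<close>, of "c + J1 * R"]) blast+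
  obtain \<delta>3 where \<delta>3: "0 < \<delta>3"
    "\<And>\<delta> z. 0 < \<delta> \<Longrightarrow> \<delta> < \<delta>3 \<Longrightarrow> dirichlet_eigenvalue a b (\<lambda>x. - V (a + b - x)) (\<delta> ^ 3) z \<Longrightarrow>
       norm (z - \<i> * of_real (- V (a + b - a))) \<le> (c + J1 * R) * \<delta> \<Longrightarrow>
       Re z \<ge> (- \<mu> / 2 * V' (a + b - a) powr (2/3) - \<epsilon>) * \<delta>"
    by (rule r.left_endpoint_bound[OF Airy0 \<mu> \<open>0 < \<epsilon>\<close>, of "c + J1 * R"]) blast+
  have "Re z \<ge> (c - \<epsilon>) * \<delta>"
    if \<delta>: "0 < \<delta>" "\<delta> < min \<delta>1 (min \<delta>2 \<delta>3)" and ev: "dirichlet_eigenvalue a b V (\<delta> ^ 3) z" for \<delta> z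
  proof (rule ccontr)
    assume neg: "\<not> ?thesis"
    obtain x0 where Re_z: "0 \<le> Re z" and x0: "x0 \<in> {a..b}" "Im z = V x0"
      using dirichlet_eigenvalue_location[OF ev _ ab continuous_V] \<delta> by auto
    have "0 < \<epsilon> * \<delta>" using \<open>0 < \<epsilon>\<close> \<delta> by simp
    then have Re_le: "Re z \<le> c * \<delta>" using neg by (simp add: left_diff_distrib)
    have J1: "0 \<le> J1" using V'_bounds[of a] ab m by auto
    have z_eq: "z = \<i> * V x0 + of_real (\<delta> * (Re z / \<delta>))"
      using \<delta> x0(2) by (simp add: complex_eq_iff)
    have "x0 - a < R * \<delta> \<or> b - x0 < R * \<delta>"
    proof (rule R(3))
      show "dirichlet_eigenvalue a b V (\<delta> ^ 3) (\<i> * V x0 + of_real (\<delta> * (Re z / \<delta>)))"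
        using ev z_eq by simp
      show "\<bar>Re z / \<delta>\<bar> \<le> c" using \<delta> Re_z Re_le by (simp add: divide_le_eq)
    qed (use \<delta> x0 in auto)
    then show False
    proof
      assume near: "x0 - a < R * \<delta>"
      have "norm (z - \<i> * V a) \<le> \<bar>Re z\<bar> + \<bar>Im z - V a\<bar>"
        using cmod_le[of "z - \<i> * V a"] by simp
      also have "\<bar>Im z - V a\<bar> = V x0 - V a"
      proof -
        have "0 \<le> m * (x0 - a)" using x0 m by simp
        then show ?thesis using lower[of a x0] x0 by simp
      qed
      also have "\<dots> \<le> J1 * (R * \<delta>)"
        using upper[of a x0] x0 mult_left_mono[OF less_imp_le[OF near] J1] by auto
      also have "\<bar>Re z\<bar> + J1 * (R * \<delta>) \<le> (c + J1 * R) * \<delta>"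
        using Re_z Re_le by (simp add: algebra_simps)
      finally have "Re z \<ge> (- \<mu> / 2 * V' a powr (2/3) - \<epsilon>) * \<delta>"
        using \<delta> ev by (intro \<delta>2(2)) auto
      moreover have "(c - \<epsilon>) * \<delta> \<le> (- \<mu> / 2 * V' a powr (2/3) - \<epsilon>) * \<delta>"
        using c \<delta> by (intro mult_right_mono) auto
      ultimately show False using neg by linarith
    next
      assume near: "b - x0 < R * \<delta>"
      have "norm (cnj z - \<i> * of_real (- V (a + b - a))) \<le> \<bar>Re z\<bar> + \<bar>V b - Im z\<bar>"
        using cmod_le[of "cnj z - \<i> * of_real (- V (a + b - a))"] by simp
      also have "\<bar>V b - Im z\<bar> = V b - V x0"
      proof -
        have "0 \<le> m * (b - x0)" using x0 m by simp
        then show ?thesis using lower[of x0 b] x0 by simp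
      qed
      also have "\<dots> \<le> J1 * (R * \<delta>)"
        using upper[of x0 b] x0 mult_left_mono[OF less_imp_le[OF near] J1] by auto
      also have "\<bar>Re z\<bar> + J1 * (R * \<delta>) \<le> (c + J1 * R) * \<delta>"
        using Re_z Re_le by (simp add: algebra_simps)
      finally have "Re (cnj z) \<ge> (- \<mu> / 2 * V' (a + b - a) powr (2/3) - \<epsilon>) * \<delta>"
        using \<delta> dirichlet_eigenvalue_reflect[OF ev ab continuous_V] by (intro \<delta>3(2)) auto
      moreover have "(c - \<epsilon>) * \<delta> \<le> (- \<mu> / 2 * V' b powr (2/3) - \<epsilon>) * \<delta>"
        using c \<delta> by (intro mult_right_mono) auto
      ultimately show False using neg by simp
    qed
  qed
  moreover have "0 < min \<delta>1 (min \<delta>2 \<delta>3)" using R \<delta>2 \<delta>3 by simp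
  ultimately show ?thesis using that unfolding c_def by blast
qed

text \<open>Shooting from \<open>b\<close> gives the function \<open>\<psi>' / \<psi>\<close> at \<open>a\<close>, holomorphic in the spectral
  parameter as long as there is no eigenvalue.  It is close to the logarithmic derivative of the
  profile, hence bounded on a circle around a zero of the profile and large at its centre.\<close>

lemma eigenvalue_exists:
  assumes Airy0: "Airy 0 \<noteq> 0" and \<mu>: "airy_Ai \<mu> = 0" and "\<mu> < 0" and "0 < \<epsilon>"
  obtains \<delta>0 where "0 < \<delta>0"
    "\<And>\<delta>. 0 < \<delta> \<Longrightarrow> \<delta> < \<delta>0 \<Longrightarrow> \<exists>z. dirichlet_eigenvalue a b V (\<delta> ^ 3) z \<and>
       Re z \<le> (- \<mu> / 2 * V' a powr (2/3) + \<epsilon>) * \<delta>"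
proof -
  define J where "J = V' a"
  have J: "0 < J" using V'_pos[of a] ab by (simp add: J_def)
  \<comment> \<open>The parameter at which the argument of \<open>Airy\<close> in the profile equals
    \<open>\<mu>\<close>.\<close>
  define \<nu>0 where "\<nu>0 = of_real (\<mu> * J powr (2/3)) * cis (- (2 * pi / 3))"
  have arg0: "cis (2 * pi / 3) * \<nu>0 / of_real (J powr (2/3)) = of_real \<mu>"
    using J by (simp add: \<nu>0_def mult.assoc[symmetric] cis_mult)
  have Airy_\<mu>: "Airy (of_real \<mu>) = 0" using \<mu> by (simp add: Airy_of_real)
  have zero: "profile J \<nu>0 0 = 0"
    unfolding profile_at_0(1)[OF J] arg0 by (rule Airy_\<mu>)
  have zero': "profile' J \<nu>0 0 \<noteq> 0"
    unfolding profile_at_0(2)[OF J] arg0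
    using Airy'_nonzero_at_zero[OF Airy0 _ Airy_\<mu>] \<open>\<mu> < 0\<close> J by (simp add: airy_scale_def)
  have Re_\<nu>0: "Re \<nu>0 = - \<mu> / 2 * J powr (2/3)"
    by (simp add: \<nu>0_def cos_120)
  have hol: "(\<lambda>\<nu>. profile J \<nu> 0) holomorphic_on UNIV"
    unfolding profile_at_0(1)[OF J]
    by (rule holomorphic_on_compose_gen[OF _ Airy_holomorphic[of UNIV], unfolded o_def])
      (use J in \<open>auto intro!: holomorphic_intros\<close>)
  \<comment> \<open>At \<open>\<nu> = 0\<close> the profile equals \<open>Airy 0\<close>, so it is
    not identically zero in \<open>\<nu>\<close> and its zeros are isolated.\<close>
  have "profile J 0 0 \<noteq> 0"
    unfolding profile_at_0(1)[OF J] using Airy0 by simp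
  then obtain r0 where r0: "0 < r0" "\<And>\<nu>. \<nu> \<in> ball \<nu>0 r0 - {\<nu>0} \<Longrightarrow> profile J \<nu> 0 \<noteq> 0"
    using isolated_zeros[OF hol open_UNIV connected_UNIV UNIV_I zero UNIV_I] by blast
  \<comment> \<open>Below \<open>r0\<close> the circle avoids all zeros of the profile, and
    \<open>r \<le> \<epsilon>\<close> keeps the real parts in the disc within
    \<open>\<epsilon>\<close> of \<open>Re \<nu>0\<close>.\<close>
  define r where "r = min (r0 / 2) \<epsilon>"
  have r: "0 < r" "r < r0" "r \<le> \<epsilon>" using r0 \<open>0 < \<epsilon>\<close> by (auto simp: r_def)
  define N where "N = norm \<nu>0 + r"
  have norm_N: "norm \<nu> \<le> N" if "\<nu> \<in> cball \<nu>0 r" for \<nu>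
    using that norm_triangle_sub[of \<nu> \<nu>0] by (simp add: N_def dist_norm norm_minus_commute)
  have sphere_nz: "profile J \<nu> 0 \<noteq> 0" if "\<nu> \<in> sphere \<nu>0 r" for \<nu>
    using that r by (intro r0(2)) (auto simp: dist_norm)
  have "sphere \<nu>0 r \<noteq> {}" using r by simp
  then obtain \<nu>1 where \<nu>1: "\<nu>1 \<in> sphere \<nu>0 r"
    "\<And>\<nu>. \<nu> \<in> sphere \<nu>0 r \<Longrightarrow> norm (profile J \<nu>1 0) \<le> norm (profile J \<nu> 0)"
    using continuous_attains_inf[OF compact_sphere, of \<nu>0 r "\<lambda>\<nu>. norm (profile J \<nu> 0)"]
      continuous_on_norm[OF profile_continuous[OF J]] by blast
  define k where "k = norm (profile J \<nu>1 0)"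
  have k: "0 < k" "\<And>\<nu>. \<nu> \<in> sphere \<nu>0 r \<Longrightarrow> k \<le> norm (profile J \<nu> 0)"
    using \<nu>1 sphere_nz by (auto simp: k_def)
  obtain B where B: "\<And>J \<nu> t. m \<le> J \<Longrightarrow> J \<le> J1 \<Longrightarrow> norm \<nu> \<le> N \<Longrightarrow> 0 \<le> t \<Longrightarrow>
    (1 + t ^ 4) * (norm (profile J \<nu> t))\<^sup>2 + (norm (profile' J \<nu> t))\<^sup>2 \<le> B * exp (- t)"
    by (rule profile_bound[OF m, of J1 N]) blast
  define P where "P = sqrt \<bar>B\<bar>"
  have P: "norm (profile' J \<nu> 0) \<le> P" if "\<nu> \<in> cball \<nu>0 r" for \<nu>
  proof -
    have "(norm (profile J \<nu> 0))\<^sup>2 + (norm (profile' J \<nu> 0))\<^sup>2 \<le> \<bar>B\<bar>"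
      using B[of J \<nu> 0] V'_bounds[of a] ab norm_N[OF that] by (simp add: J_def)
    then show ?thesis
      unfolding P_def using zero_le_power2[of "norm (profile J \<nu> 0)"]
      by (intro real_le_rsqrt) linarith
  qed
  obtain C where C: "C > 0"
    "\<And>x0 \<delta> \<nu> u u'. a \<le> x0 \<Longrightarrow> x0 < b \<Longrightarrow> 0 < \<delta> \<Longrightarrow> norm \<nu> \<le> N \<Longrightarrow>
       ode_sol x0 b (\<lambda>x. (\<i> * of_real (V x - V x0) - of_real \<delta> * \<nu>) / of_real (\<delta> ^ 3)) u u' \<Longrightarrow> u b = 0 \<Longrightarrow>
       (norm (u x0))\<^sup>2 + (norm (of_real \<delta> * u' x0))\<^sup>2 = 1 \<Longrightarrow>
       norm (u x0 * profile' (V' x0) \<nu> 0 - of_real \<delta> * u' x0 * profile (V' x0) \<nu> 0) \<le> C * (\<delta> / (b - x0) + \<delta>)"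
    by (rule right_estimate[of N]) blast
  \<comment> \<open>On the circle \<open>X = norm (\<delta> * M \<nu>)\<close> will satisfy
    \<open>X * k \<le> E * (1 + X) + P\<close>; with \<open>E \<le> k / 2\<close> and
    \<open>E \<le> 1\<close> this gives \<open>X \<le> X1\<close>. The last term of
    \<open>\<eta>\<close> produces the contradiction at the centre.\<close>
  define X1 where "X1 = 2 * (P + 1) / k"
  define \<eta> where "\<eta> = min 1 (min (k / 2) (norm (profile' J \<nu>0 0) / (2 * (1 + X1))))"
  have P0: "0 \<le> P" by (simp add: P_def)
  have X1: "0 \<le> X1" using k P0 by (simp add: X1_def)
  have \<eta>: "0 < \<eta>" using k zero' X1 by (simp add: \<eta>_def)
  have w: "0 < C * (1 / (b - a) + 1)"
    using C(1) ab by (intro mult_pos_pos add_pos_pos) auto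
  define \<delta>0 where "\<delta>0 = \<eta> / (C * (1 / (b - a) + 1))"
  have "\<exists>z. dirichlet_eigenvalue a b V (\<delta> ^ 3) z \<and> Re z \<le> (- \<mu> / 2 * V' a powr (2/3) + \<epsilon>) * \<delta>"
    if \<delta>: "0 < \<delta>" "\<delta> < \<delta>0" for \<delta>
  proof (rule ccontr)
    assume neg: "\<not> ?thesis"
    define E where "E = C * (\<delta> / (b - a) + \<delta>)"
    have "E = C * (1 / (b - a) + 1) * \<delta>" by (simp add: E_def algebra_simps)
    also have "\<dots> < \<eta>" using \<delta>(2) w by (simp add: \<delta>0_def pos_less_divide_eq mult.commute)
    finally have E: "E < \<eta>" .
    have E0: "0 \<le> E" using C(1) \<delta> ab by (simp add: E_def)
    \<comment> \<open>The reversed potential: starting at \<open>a\<close> in the reversed variable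
      is shooting from \<open>b\<close>.\<close>
    define q where "q = (\<lambda>x. \<i> * of_real (V (a + b - x) - V a) / of_real (\<delta> ^ 3))"
    define \<kappa> where "\<kappa> = complex_of_real \<delta> / of_real (\<delta> ^ 3)"
    have cont_q: "continuous_on {a..b} q"
      unfolding q_def divide_inverse
      by (intro continuous_intros continuous_on_compose2[OF continuous_V, of "{a..b}" "\<lambda>x. a + b - x"]) auto
    have "\<exists>y y'. ode_sol a b (\<lambda>x. q x - \<kappa> * \<nu>) y y' \<and> y a = 0 \<and> y' a = 1" for \<nu>
      using ab by (intro ode_sol_exists continuous_intros cont_q) auto
    then obtain y y' where y: "\<And>\<nu>. ode_sol a b (\<lambda>x. q x - \<kappa> * \<nu>) (y \<nu>) (y' \<nu>)"
      and init: "\<And>\<nu>. y \<nu> a = 0" "\<And>\<nu>. y' \<nu> a = 1"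
      by metis
    have rev: "ode_sol a b (\<lambda>x. (\<i> * of_real (V x - V a) - of_real \<delta> * \<nu>) / of_real (\<delta> ^ 3))
        (\<lambda>x. y \<nu> (a + b - x)) (\<lambda>x. - y' \<nu> (a + b - x))" for \<nu>
      using ode_sol_reverse[OF y[of \<nu>]] by (simp add: q_def \<kappa>_def diff_divide_distrib)
    have b_nz: "y \<nu> b \<noteq> 0" if \<nu>: "\<nu> \<in> cball \<nu>0 r" for \<nu>
    proof
      assume 0: "y \<nu> b = 0"
      define z where "z = \<i> * V a + of_real \<delta> * \<nu>"
      have "ode_sol a b (\<lambda>x. (\<i> * V x - z) / of_real (\<delta> ^ 3)) (\<lambda>x. y \<nu> (a + b - x)) (\<lambda>x. - y' \<nu> (a + b - x))"
        using rev[of \<nu>] by (simp add: z_def algebra_simps)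
      moreover have "y' \<nu> b \<noteq> 0"
      proof
        assume "y' \<nu> b = 0"
        have "continuous_on {a..b} (\<lambda>x. (\<i> * of_real (V x - V a) - of_real \<delta> * \<nu>) / of_real (\<delta> ^ 3))"
          unfolding divide_inverse by (intro continuous_intros continuous_V)
        from ode_sol_zero(2)[OF rev this, of b] have "y' \<nu> a = 0"
          using 0 \<open>y' \<nu> b = 0\<close> ab by simp
        then show False using init by simp
      qed
      ultimately have "dirichlet_eigenvalue a b V (\<delta> ^ 3) z"
        unfolding dirichlet_eigenvalue_def using 0 init
        by (intro exI[of _ "\<lambda>x. y \<nu> (a + b - x)"] exI[of _ "\<lambda>x. - y' \<nu> (a + b - x)"]) auto
      moreover have "Re z \<le> (- \<mu> / 2 * V' a powr (2/3) + \<epsilon>) * \<delta>"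
      proof -
        have "Re \<nu> \<le> Re \<nu>0 + \<epsilon>"
          using abs_Re_le_cmod[of "\<nu>0 - \<nu>"] \<nu> r by (simp add: dist_norm)
        then have "\<delta> * Re \<nu> \<le> \<delta> * (Re \<nu>0 + \<epsilon>)" using \<delta> by (intro mult_left_mono) auto
        then show ?thesis unfolding Re_\<nu>0 by (simp add: z_def J_def mult.commute)
      qed
      ultimately show False using neg by blast
    qed
    define M where "M = (\<lambda>\<nu>. y' \<nu> b / y \<nu> b)"
    have M_hol: "M holomorphic_on cball \<nu>0 r"
      unfolding holomorphic_on_def field_differentiable_def M_def
      using shooting_holomorphic[OF ab cont_q y init b_nz] has_field_derivative_at_within by blast
    \<comment> \<open>The Wronskian estimate at \<open>a\<close>, divided by the value of the shot
      solution there. The plus sign appears because, by the reversal, \<open>M\<close> is minus the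
      logarithmic derivative at \<open>a\<close>.\<close>
    have key: "norm (profile' J \<nu> 0 + of_real \<delta> * M \<nu> * profile J \<nu> 0) \<le> E * (1 + norm (of_real \<delta> * M \<nu>))"
      if \<nu>: "\<nu> \<in> cball \<nu>0 r" for \<nu>
    proof -
      define n where "n = sqrt ((norm (y \<nu> b))\<^sup>2 + (norm (of_real \<delta> * y' \<nu> b))\<^sup>2)"
      have n2: "n\<^sup>2 = (norm (y \<nu> b))\<^sup>2 + (norm (of_real \<delta> * y' \<nu> b))\<^sup>2"
        by (simp add: n_def)
      have n: "n > 0"
        using b_nz[OF \<nu>] by (auto simp: n_def sum_power2_gt_zero_iff)
      have n_le: "n \<le> norm (y \<nu> b) + norm (of_real \<delta> * y' \<nu> b)"
        unfolding n_def by (rule sqrt_sum_squares_le_sum) auto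
      define s where "s = complex_of_real (1 / n)"
      have "norm (s * y \<nu> (a + b - a) * profile' (V' a) \<nu> 0 - of_real \<delta> * (s * - y' \<nu> (a + b - a)) * profile (V' a) \<nu> 0)
          \<le> C * (\<delta> / (b - a) + \<delta>)"
      proof (rule C(2)[OF _ ab \<delta>(1) norm_N[OF \<nu>] ode_sol_scale[OF rev]])
        have "(norm (s * y \<nu> b))\<^sup>2 + (norm (of_real \<delta> * (s * y' \<nu> b)))\<^sup>2 = (1 / n)\<^sup>2 * n\<^sup>2"
          unfolding n2 using n by (simp add: s_def norm_mult norm_divide power_mult_distrib power_divide field_simps)
        then show "(norm (s * y \<nu> (a + b - a)))\<^sup>2 + (norm (of_real \<delta> * (s * - y' \<nu> (a + b - a))))\<^sup>2 = 1"
          using n by (simp add: power_divide)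
      qed (use init in auto)
      moreover have "s * y \<nu> (a + b - a) * profile' (V' a) \<nu> 0 - of_real \<delta> * (s * - y' \<nu> (a + b - a)) * profile (V' a) \<nu> 0
          = s * y \<nu> b * (profile' J \<nu> 0 + of_real \<delta> * M \<nu> * profile J \<nu> 0)"
        using b_nz[OF \<nu>] by (simp add: M_def J_def field_simps)
      ultimately have "1 / n * norm (y \<nu> b) * norm (profile' J \<nu> 0 + of_real \<delta> * M \<nu> * profile J \<nu> 0) \<le> E"
        using n by (simp add: norm_mult s_def E_def norm_divide)
      then have "norm (y \<nu> b) * norm (profile' J \<nu> 0 + of_real \<delta> * M \<nu> * profile J \<nu> 0) \<le> E * n"
        using n by (simp add: divide_le_eq)
      also have "\<dots> \<le> E * (norm (y \<nu> b) + norm (of_real \<delta> * y' \<nu> b))"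
        using n_le E0 by (intro mult_left_mono)
      also have "\<dots> = norm (y \<nu> b) * (E * (1 + norm (of_real \<delta> * M \<nu>)))"
        using b_nz[OF \<nu>] by (simp add: M_def norm_mult norm_divide field_simps)
      finally show ?thesis using b_nz[OF \<nu>] by simp
    qed
    have circle: "norm (of_real \<delta> * M \<nu>) \<le> X1" if \<nu>: "\<nu> \<in> sphere \<nu>0 r" for \<nu>
    proof -
      define X where "X = norm (of_real \<delta> * M \<nu>)"
      have \<nu>': "\<nu> \<in> cball \<nu>0 r" using \<nu> by auto
      have "X * k \<le> norm (of_real \<delta> * M \<nu> * profile J \<nu> 0)"
        unfolding X_def norm_mult[of _ "profile J \<nu> 0"] using k(2)[OF \<nu>] by (intro mult_left_mono) auto
      also have "\<dots> \<le> norm (profile' J \<nu> 0 + of_real \<delta> * M \<nu> * profile J \<nu> 0) + norm (profile' J \<nu> 0)"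
        by (metis add.commute norm_triangle_sub diff_add_cancel norm_triangle_ineq4 add_diff_cancel_left')
      also have "\<dots> \<le> E * (1 + X) + P"
        using key[OF \<nu>'] P[OF \<nu>'] by (simp add: X_def)
      finally have "X * (k - E) \<le> P + E" by (simp add: algebra_simps)
      moreover have "X * (k / 2) \<le> X * (k - E)"
        using E by (intro mult_left_mono) (auto simp: \<eta>_def X_def)
      moreover have "E \<le> 1" using E by (simp add: \<eta>_def)
      ultimately have "X * (k / 2) \<le> P + 1" by linarith
      then have "X \<le> X1" using k(1) by (simp add: X1_def field_simps)
      then show ?thesis by (simp only: X_def)
    qed
    \<comment> \<open>The maximum principle carries \<open>X1\<close> to the centre; there the
      profile vanishes and \<open>key\<close> bounds \<open>profile'\<close> by half of
      itself.\<close>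
    have "norm (of_real \<delta> * M \<nu>0) \<le> X1"
    proof (rule maximum_modulus_frontier[of "\<lambda>\<nu>. of_real \<delta> * M \<nu>" "cball \<nu>0 r"])
      show "(\<lambda>\<nu>. of_real \<delta> * M \<nu>) holomorphic_on interior (cball \<nu>0 r)"
        by (intro holomorphic_intros holomorphic_on_subset[OF M_hol] interior_subset)
      show "continuous_on (closure (cball \<nu>0 r)) (\<lambda>\<nu>. of_real \<delta> * M \<nu>)"
        by (simp add: holomorphic_on_imp_continuous_on[OF M_hol] continuous_on_mult_left)
    qed (use circle r in \<open>auto simp: frontier_cball\<close>)
    then have le1: "norm (profile' J \<nu>0 0) \<le> E * (1 + X1)"
      using key[of \<nu>0] zero r E0 by (smt (verit) add.right_neutral centre_in_cball mult_left_mono mult_zero_right)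
    have le2: "E * (1 + X1) \<le> norm (profile' J \<nu>0 0) / (2 * (1 + X1)) * (1 + X1)"
      using E X1 by (intro mult_right_mono) (auto simp: \<eta>_def)
    have eq: "norm (profile' J \<nu>0 0) / (2 * (1 + X1)) * (1 + X1) = norm (profile' J \<nu>0 0) / 2"
    proof -
      have h: "n / (2 * x) * x = n / 2" if "x \<noteq> 0" for n x :: real
        using that by (simp add: field_simps)
      show ?thesis by (rule h) (use X1 in simp)
    qed
    have "norm (profile' J \<nu>0 0) \<le> norm (profile' J \<nu>0 0) / 2"
      using order_trans[OF le1 le2] unfolding eq .
    then show False using zero' by simp
  qed
  moreover have "0 < \<delta>0" using \<eta> w by (simp add: \<delta>0_def)
  ultimately show ?thesis using that by blast
qed

end

subsection \<open>Smooth functions\<close>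

text \<open>Polynomials in \<open>1 / x\<close> times \<open>exp (- 1 / x)\<close>, extended by
  zero, form a family closed under differentiation, so the smoothness of cutoffs becomes algebra on
  polynomials.\<close>

definition flat :: "real poly \<Rightarrow> real \<Rightarrow> real" where
  "flat p x = (if x > 0 then poly p (1 / x) * exp (- (1 / x)) else 0)"

lemma poly_exp_tendsto_0: "((\<lambda>y. poly p y * exp (- y)) \<longlongrightarrow> (0::real)) at_top"
proof -
  have "((\<lambda>y. \<Sum>i\<le>degree p. coeff p i * (y ^ i / exp y)) \<longlongrightarrow> (\<Sum>i\<le>degree p. coeff p i * 0)) at_top"
    by (intro tendsto_sum tendsto_mult tendsto_const tendsto_power_div_exp_0)
  moreover have "poly p y * exp (- y) = (\<Sum>i\<le>degree p. coeff p i * (y ^ i / exp y))" for y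
    by (simp add: poly_altdef sum_distrib_right exp_minus divide_inverse mult.assoc)
  ultimately show ?thesis by simp
qed

text \<open>With \<open>y = 1 / x\<close> the derivative is
  \<open>y\<^sup>2 * (p y - p' y) * exp (- y)\<close>. At 0 the difference quotient from the right
  is \<open>y * p y * exp (- y)\<close>, which tends to 0.\<close>

lemma flat_deriv:
  "(flat p has_real_derivative flat (monom 1 2 * (p - pderiv p)) x) (at x)"
proof (cases x "0 :: real" rule: linorder_cases)
  case less
  have "((\<lambda>_. 0) has_real_derivative 0) (at x)" by simp
  then have "(flat p has_real_derivative 0) (at x)"
    by (rule has_field_derivative_transform_within_open[of _ _ _ "{..<0}"]) (use less in \<open>auto simp: flat_def\<close>)
  then show ?thesis using less by (simp add: flat_def)
next
  case greater
  have "((\<lambda>x. poly p (1 / x) * exp (- (1 / x))) has_real_derivative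
      poly (monom 1 2 * (p - pderiv p)) (1 / x) * exp (- (1 / x))) (at x)"
    using greater
    by (auto intro!: derivative_eq_intros poly_DERIV[THEN DERIV_chain2]
      simp: poly_monom power2_eq_square field_simps)
  then have "(flat p has_real_derivative poly (monom 1 2 * (p - pderiv p)) (1 / x) * exp (- (1 / x))) (at x)"
    by (rule has_field_derivative_transform_within_open[of _ _ _ "{0<..}"]) (use greater in \<open>auto simp: flat_def\<close>)
  then show ?thesis using greater by (simp add: flat_def)
next
  case equal
  have right: "((\<lambda>h. flat p h / h) \<longlongrightarrow> 0) (at_right 0)"
  proof (rule Lim_transform_eventually)
    show "((\<lambda>h. poly (pCons 0 p) (inverse h) * exp (- inverse h)) \<longlongrightarrow> (0::real)) (at_right 0)"
      by (rule filterlim_compose[OF poly_exp_tendsto_0 filterlim_inverse_at_top_right])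
    show "\<forall>\<^sub>F h in at_right 0. poly (pCons 0 p) (inverse h) * exp (- inverse h) = flat p h / h"
      by (auto simp: eventually_at_filter flat_def field_simps intro!: always_eventually)
  qed
  have left: "((\<lambda>h. flat p h / h) \<longlongrightarrow> 0) (at_left 0)"
    by (rule tendsto_eventually) (auto simp: eventually_at_filter flat_def intro!: always_eventually)
  have "((\<lambda>h. (flat p (0 + h) - flat p 0) / h) \<longlongrightarrow> 0) (at 0)"
    using filterlim_split_at[OF left right] by (simp add: flat_def)
  then have "(flat p has_real_derivative 0) (at 0)"
    unfolding DERIV_def .
  then show ?thesis using equal by (simp add: flat_def)
qed

text \<open>A set of functions closed under differentiation consists of smooth functions. This one
  is generated by the ingredients of the test functions built below: polynomials and cutoffs on
  either side.\<close>

inductive_set smooth_algebra :: "(real \<Rightarrow> complex) set" where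
  const: "(\<lambda>_. c) \<in> smooth_algebra"
| ident: "of_real \<in> smooth_algebra"
| flat_left: "(\<lambda>x. of_real (flat p (x - c))) \<in> smooth_algebra"
| flat_right: "(\<lambda>x. of_real (flat p (c - x))) \<in> smooth_algebra"
| add: "f \<in> smooth_algebra \<Longrightarrow> g \<in> smooth_algebra \<Longrightarrow> (\<lambda>x. f x + g x) \<in> smooth_algebra"
| mult: "f \<in> smooth_algebra \<Longrightarrow> g \<in> smooth_algebra \<Longrightarrow> (\<lambda>x. f x * g x) \<in> smooth_algebra"

lemma smooth_algebra_deriv:
  assumes "f \<in> smooth_algebra"
  shows "\<exists>g\<in>smooth_algebra. \<forall>x. (f has_vector_derivative g x) (at x)"
  using assms
proof induction
  case (const c)
  show ?case by (rule bexI[OF _ smooth_algebra.const[of 0]]) auto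
next
  case ident
  show ?case by (rule bexI[OF _ smooth_algebra.const[of 1]]) (auto intro!: derivative_eq_intros)
next
  case (flat_left p c)
  have "((\<lambda>x. flat p (x - c)) has_real_derivative flat (monom 1 2 * (p - pderiv p)) (x - c)) (at x)" for x
  proof -
    have "((\<lambda>x. x - c) has_real_derivative 1) (at x)" by (auto intro!: derivative_eq_intros)
    from DERIV_chain2[OF flat_deriv this] show ?thesis by simp
  qed
  then show ?case
    by (intro bexI[OF _ smooth_algebra.flat_left[of "monom 1 2 * (p - pderiv p)" c]] allI
      has_vector_derivative_of_real) (simp add: has_real_derivative_iff_has_vector_derivative)
next
  case (flat_right p c)
  have "((\<lambda>x. flat p (c - x)) has_real_derivative - flat (monom 1 2 * (p - pderiv p)) (c - x)) (at x)" for x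
  proof -
    have "((\<lambda>x. c - x) has_real_derivative - 1) (at x)" by (auto intro!: derivative_eq_intros)
    from DERIV_chain2[OF flat_deriv this] show ?thesis by simp
  qed
  then have "((\<lambda>x. complex_of_real (flat p (c - x))) has_vector_derivative
      of_real (- flat (monom 1 2 * (p - pderiv p)) (c - x))) (at x)" for x
    by (intro has_vector_derivative_of_real) (simp add: has_real_derivative_iff_has_vector_derivative)
  then show ?case
    by (intro bexI[OF _ smooth_algebra.mult[OF smooth_algebra.const[of "-1"]
      smooth_algebra.flat_right[of "monom 1 2 * (p - pderiv p)" c]]]) simp
next
  case (add f g)
  then obtain f' g' where "f' \<in> smooth_algebra" "\<forall>x. (f has_vector_derivative f' x) (at x)"
    "g' \<in> smooth_algebra" "\<forall>x. (g has_vector_derivative g' x) (at x)" by blast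
  then show ?case
    by (intro bexI[OF _ smooth_algebra.add[of f' g']]) (auto intro!: has_vector_derivative_add)
next
  case (mult f g)
  then obtain f' g' where "f' \<in> smooth_algebra" "\<forall>x. (f has_vector_derivative f' x) (at x)"
    "g' \<in> smooth_algebra" "\<forall>x. (g has_vector_derivative g' x) (at x)" by blast
  then show ?case
    using mult
    by (intro bexI[OF _ smooth_algebra.add[OF smooth_algebra.mult[of f g'] smooth_algebra.mult[of f' g]]])
      (auto intro!: has_vector_derivative_mult)
qed

lemma smooth_algebra_smooth:
  assumes "f \<in> smooth_algebra"
  shows "smooth_on UNIV f"
proof -
  obtain d where d: "\<And>f. f \<in> smooth_algebra \<Longrightarrow> d f \<in> smooth_algebra"
    "\<And>f x. f \<in> smooth_algebra \<Longrightarrow> (f has_vector_derivative d f x) (at x)"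
    using smooth_algebra_deriv by metis
  have "(d ^^ k) f \<in> smooth_algebra" for k
    by (induction k) (auto intro: d assms)
  then show ?thesis
    unfolding smooth_on_def using d by (intro exI[of _ "\<lambda>k. (d ^^ k) f"]) auto
qed

lemma real_polynomial_smooth_algebra:
  "real_polynomial_function p \<Longrightarrow> (\<lambda>x. of_real (p x)) \<in> smooth_algebra"
proof (induction rule: real_polynomial_function.induct)
  case (linear f)
  have "f x = f 1 * x" for x
    using linear_simps(5)[OF linear, of x 1] by simp
  then show ?case
    using smooth_algebra.mult[OF smooth_algebra.const[of "of_real (f 1)"] smooth_algebra.ident]
    by (metis (no_types, lifting) ext of_real_mult)
qed (auto intro: smooth_algebra.intros)

lemma polynomial_smooth_algebra:
  fixes g :: "real \<Rightarrow> complex"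
  assumes "polynomial_function g"
  shows "g \<in> smooth_algebra"
proof -
  have "real_polynomial_function (\<lambda>x. Re (g x))" "real_polynomial_function (\<lambda>x. Im (g x))"
    using assms bounded_linear_Re bounded_linear_Im unfolding polynomial_function_def o_def by blast+
  then have "(\<lambda>x. of_real (Re (g x)) + \<i> * of_real (Im (g x))) \<in> smooth_algebra"
    by (intro smooth_algebra.add smooth_algebra.mult smooth_algebra.const real_polynomial_smooth_algebra)
  then show ?thesis by (simp add: complex_eq[symmetric])
qed

lemma smooth_on_lincomb:
  fixes f g :: "real \<Rightarrow> complex"
  assumes "smooth_on S f" "smooth_on S g"
  shows "smooth_on S (\<lambda>x. f x - c * g x)"
proof -
  obtain D E where "\<forall>x\<in>S. D 0 x = f x" "\<forall>k. \<forall>x\<in>S. (D k has_vector_derivative D (Suc k) x) (at x within S)"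
    "\<forall>x\<in>S. E 0 x = g x" "\<forall>k. \<forall>x\<in>S. (E k has_vector_derivative E (Suc k) x) (at x within S)"
    using assms unfolding smooth_on_def by blast
  then show ?thesis
    unfolding smooth_on_def
    by (intro exI[of _ "\<lambda>k x. D k x - c * E k x"])
      (auto intro!: has_vector_derivative_diff has_vector_derivative_mult_right)
qed

lemma smooth_on_antiderivative:
  assumes "smooth_on UNIV \<psi>" "\<And>x. (\<phi> has_vector_derivative \<psi> x) (at x)"
  shows "smooth_on UNIV \<phi>"
proof -
  obtain D where D: "\<forall>x. D 0 x = \<psi> x" "\<forall>k x. (D k has_vector_derivative D (Suc k) x) (at x)"
    using assms(1) unfolding smooth_on_def by auto
  define E where "E = (\<lambda>k. case k of 0 \<Rightarrow> \<phi> | Suc k \<Rightarrow> D k)"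
  have "(E k has_vector_derivative E (Suc k) x) (at x)" for k x
    by (cases k) (use D assms(2) in \<open>auto simp: E_def\<close>)
  then show ?thesis
    unfolding smooth_on_def by (intro exI[of _ E]) (auto simp: E_def)
qed

lemma smooth_on_UNIV_deriv:
  assumes "smooth_on UNIV \<phi>"
  shows "(\<phi> has_vector_derivative derivative_of \<phi> x) (at x)" "continuous_on S (derivative_of \<phi>)"
    "smooth_on UNIV (derivative_of \<phi>)"
proof -
  obtain D where D: "\<forall>x. D 0 x = \<phi> x" "\<forall>k x. (D k has_vector_derivative D (Suc k) x) (at x)"
    using assms unfolding smooth_on_def by auto
  have "D 0 = \<phi>" using D(1) by auto
  then have d: "(\<phi> has_vector_derivative D 1 x) (at x)" for x
    using D(2)[rule_format, of 0] by simp
  then have eq: "derivative_of \<phi> = D 1"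
    unfolding derivative_of_def by (auto intro: vector_derivative_at)
  show "(\<phi> has_vector_derivative derivative_of \<phi> x) (at x)" using d eq by simp
  have "isCont (D 1) x" for x
    using D(2)[rule_format, of 1 x] has_vector_derivative_continuous by blast
  then show "continuous_on S (derivative_of \<phi>)"
    unfolding eq by (intro continuous_at_imp_continuous_on) auto
  show "smooth_on UNIV (derivative_of \<phi>)"
    unfolding smooth_on_def eq by (intro exI[of _ "\<lambda>k. D (Suc k)"]) (use D in auto)
qed

subsection \<open>Square integrable functions on an interval\<close>

text \<open>The bridge between the Lebesgue integral on the open interval, in which the operator is
  defined, and the gauge integral on the closed interval, in which calculus is done.\<close>

lemma continuous_integrable_Ioo:
  fixes f :: "real \<Rightarrow> 'a::euclidean_space"
  assumes "continuous_on {a..b} f"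
  shows "integrable (lebesgue_on {a<..<b}) f"
    and "integral\<^sup>L (lebesgue_on {a<..<b}) f = integral {a..b} f"
proof -
  have "f absolutely_integrable_on {a<..<b}"
    by (rule set_integrable_subset[OF absolutely_integrable_continuous_real[OF assms]]) auto
  then show "integrable (lebesgue_on {a<..<b}) f"
    by (simp add: set_integrable_def integrable_restrict_space)
  then show "integral\<^sup>L (lebesgue_on {a<..<b}) f = integral {a..b} f"
    by (subst lebesgue_integral_eq_integral) (auto simp: integral_open_interval_real)
qed

lemma continuous_L2:
  assumes "continuous_on {a..b} f"
  shows "f \<in> L2 a b"
  unfolding L2_def
proof (intro CollectI conjI)
  show "f \<in> borel_measurable (lebesgue_on {a<..<b})"
    using continuous_integrable_Ioo(1)[OF assms] by (rule borel_measurable_integrable)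
  show "integrable (lebesgue_on {a<..<b}) (\<lambda>x. (norm (f x))\<^sup>2)"
    by (intro continuous_integrable_Ioo continuous_intros assms)
qed

lemma norm_L2_nonneg: "0 \<le> norm_L2 a b f"
  by (auto simp: norm_L2_def intro: Bochner_Integration.integral_nonneg)

lemma norm_L2_sq: "(norm_L2 a b f)\<^sup>2 = (LINT x|lebesgue_on {a<..<b}. (norm (f x))\<^sup>2)"
  by (simp add: norm_L2_def)

lemma L2_measurable [measurable_dest]: "f \<in> L2 a b \<Longrightarrow> f \<in> borel_measurable (lebesgue_on {a<..<b})"
  by (simp add: L2_def)

lemma L2_integrable_sq: "f \<in> L2 a b \<Longrightarrow> integrable (lebesgue_on {a<..<b}) (\<lambda>x. (norm (f x))\<^sup>2)"
  by (simp add: L2_def)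

lemma L2_scale:
  assumes "f \<in> L2 a b"
  shows "(\<lambda>x. c * f x) \<in> L2 a b"
  using assms by (auto simp: L2_def norm_mult power_mult_distrib)

lemma L2_add:
  assumes f: "f \<in> L2 a b" and g: "g \<in> L2 a b"
  shows "(\<lambda>x. f x + g x) \<in> L2 a b"
proof -
  note [measurable] = L2_measurable[OF f] L2_measurable[OF g]
  have "integrable (lebesgue_on {a<..<b}) (\<lambda>x. 2 * (norm (f x))\<^sup>2 + 2 * (norm (g x))\<^sup>2)"
    by (intro Bochner_Integration.integrable_add integrable_mult_right L2_integrable_sq f g)
  then have "integrable (lebesgue_on {a<..<b}) (\<lambda>x. (norm (f x + g x))\<^sup>2)"
  proof (rule Bochner_Integration.integrable_bound)
    show "AE x in lebesgue_on {a<..<b}. norm ((norm (f x + g x))\<^sup>2) \<le> norm (2 * (norm (f x))\<^sup>2 + 2 * (norm (g x))\<^sup>2)"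
    proof (rule AE_I2)
      fix x
      have "(norm (f x + g x))\<^sup>2 \<le> (norm (f x) + norm (g x))\<^sup>2"
        by (intro power_mono norm_triangle_ineq) auto
      also have "\<dots> \<le> 2 * (norm (f x))\<^sup>2 + 2 * (norm (g x))\<^sup>2"
        using sum_squares_bound[of "norm (f x)" "norm (g x)"] by (simp add: power2_sum)
      finally show "norm ((norm (f x + g x))\<^sup>2) \<le> norm (2 * (norm (f x))\<^sup>2 + 2 * (norm (g x))\<^sup>2)"
        by simp
    qed
  qed measurable
  then show ?thesis by (simp add: L2_def)
qed

lemma L2_diff:
  assumes "f \<in> L2 a b" "g \<in> L2 a b"
  shows "(\<lambda>x. f x - g x) \<in> L2 a b"
  using L2_add[OF assms(1) L2_scale[OF assms(2), of "-1"]] by simp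

lemma L2_cnj:
  assumes "f \<in> L2 a b"
  shows "(\<lambda>x. cnj (f x)) \<in> L2 a b"
proof -
  have "cnj \<in> borel_measurable borel"
    by (intro borel_measurable_continuous_onI continuous_intros)
  from measurable_compose[OF L2_measurable[OF assms] this] show ?thesis
    using assms by (simp add: L2_def)
qed

lemma L2_mult_integrable:
  assumes f: "f \<in> L2 a b" and g: "g \<in> L2 a b"
  shows "integrable (lebesgue_on {a<..<b}) (\<lambda>x. f x * g x)"
proof -
  note [measurable] = L2_measurable[OF f] L2_measurable[OF g]
  have "integrable (lebesgue_on {a<..<b}) (\<lambda>x. (norm (f x))\<^sup>2 + (norm (g x))\<^sup>2)"
    by (intro Bochner_Integration.integrable_add L2_integrable_sq f g)
  then show ?thesis
  proof (rule Bochner_Integration.integrable_bound)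
    show "AE x in lebesgue_on {a<..<b}. norm (f x * g x) \<le> norm ((norm (f x))\<^sup>2 + (norm (g x))\<^sup>2)"
    proof (rule AE_I2)
      fix x
      show "norm (f x * g x) \<le> norm ((norm (f x))\<^sup>2 + (norm (g x))\<^sup>2)"
      proof -
        have "norm (f x) * norm (g x) \<le> (norm (f x))\<^sup>2 + (norm (g x))\<^sup>2"
          using sum_squares_bound[of "norm (f x)" "norm (g x)"]
            mult_nonneg_nonneg[OF norm_ge_zero[of "f x"] norm_ge_zero[of "g x"]]
          by linarith
        then show ?thesis by (simp add: norm_mult)
      qed
    qed
  qed measurable
qed

text \<open>Young's inequality with a free weight \<open>t\<close>, which is then optimised up to an
  arbitrary \<open>e\<close>.\<close>

lemma L2_cauchy_schwarz:
  assumes f: "f \<in> L2 a b" and g: "g \<in> L2 a b"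
  shows "norm (LINT x|lebesgue_on {a<..<b}. f x * g x) \<le> norm_L2 a b f * norm_L2 a b g"
proof -
  define c where "c = norm (LINT x|lebesgue_on {a<..<b}. f x * g x)"
  define A where "A = norm_L2 a b f"
  define B where "B = norm_L2 a b g"
  have AB: "0 \<le> A" "0 \<le> B" by (simp_all add: A_def B_def norm_L2_nonneg)
  have young: "2 * c \<le> t * A\<^sup>2 + B\<^sup>2 / t" if t: "t > 0" for t
  proof -
    have "c \<le> (LINT x|lebesgue_on {a<..<b}. t / 2 * (norm (f x))\<^sup>2 + 1 / (2 * t) * (norm (g x))\<^sup>2)"
      unfolding c_def
    proof (rule Bochner_Integration.integral_norm_bound_integral)
      show "norm (f x * g x) \<le> t / 2 * (norm (f x))\<^sup>2 + 1 / (2 * t) * (norm (g x))\<^sup>2" for x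
      proof -
        have "0 \<le> (t * norm (f x) - norm (g x))\<^sup>2 / (2 * t)" using t by simp
        also have "\<dots> = t / 2 * (norm (f x))\<^sup>2 + 1 / (2 * t) * (norm (g x))\<^sup>2 - norm (f x) * norm (g x)"
          using t by (simp add: field_simps power2_eq_square)
        finally show ?thesis by (simp add: norm_mult)
      qed
    qed (intro L2_mult_integrable Bochner_Integration.integrable_add integrable_mult_right L2_integrable_sq f g)+
    also have "\<dots> = t / 2 * A\<^sup>2 + 1 / (2 * t) * B\<^sup>2"
      unfolding A_def B_def norm_L2_sq
      by (simp add: L2_integrable_sq[OF f] L2_integrable_sq[OF g])
    finally show ?thesis using t by (simp add: field_simps)
  qed
  have "c \<le> A * B"
  proof (rule field_le_epsilon)
    fix e :: real assume e: "e > 0"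
    show "c \<le> A * B + e"
    proof (cases "A = 0")
      case True
      \<comment> \<open>If \<open>A = 0\<close>, a large weight removes the remaining term; the
        summand 1 keeps the weight positive when \<open>B = 0\<close>.\<close>
      have X: "0 < B\<^sup>2 + 1" by (simp add: add_nonneg_pos)
      have "B\<^sup>2 / ((B\<^sup>2 + 1) / e) = e * (B\<^sup>2 / (B\<^sup>2 + 1))" by simp
      also have "\<dots> \<le> e * 1" using e X by (intro mult_left_mono) auto
      finally have "2 * c \<le> e"
        using young[of "(B\<^sup>2 + 1) / e"] e X True by simp
      then show ?thesis using e True by simp
    next
      case False
      then have A: "A > 0" using AB by simp
      \<comment> \<open>The optimal weight would be \<open>B / A\<close>; the shift by
        \<open>e / A\<close> keeps it positive when \<open>B = 0\<close> and costs exactly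
        \<open>e\<close>.\<close>
      define y where "y = B + e / A"
      have y: "y > 0" "B \<le> y" using A AB e by (auto simp: y_def add_nonneg_pos)
      have "2 * c \<le> y / A * A\<^sup>2 + B\<^sup>2 / (y / A)" using young[of "y / A"] A y by simp
      also have "B\<^sup>2 / (y / A) \<le> y\<^sup>2 / (y / A)"
        using A AB y by (intro divide_right_mono power_mono) auto
      also have "y / A * A\<^sup>2 + y\<^sup>2 / (y / A) = 2 * (A * y)"
        using A y by (simp add: power2_eq_square)
      also have "A * y = A * B + e" using A by (simp add: y_def distrib_left)
      finally show ?thesis by simp
    qed
  qed
  then show ?thesis by (simp add: c_def A_def B_def)
qed

lemma norm_L2_le:
  assumes f: "f \<in> L2 a b" and "a < b" "\<And>x. x \<in> {a<..<b} \<Longrightarrow> norm (f x) \<le> C" "0 \<le> C"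
  shows "norm_L2 a b f \<le> C * sqrt (b - a)"
proof -
  have "(LINT x|lebesgue_on {a<..<b}. (norm (f x))\<^sup>2) \<le> (LINT x|lebesgue_on {a<..<b}. C\<^sup>2)"
    using assms by (intro integral_mono_AE L2_integrable_sq f continuous_integrable_Ioo continuous_intros)
      (auto intro!: AE_I2 power_mono)
  also have "\<dots> = C\<^sup>2 * (b - a)"
    using continuous_integrable_Ioo(2)[of a b "\<lambda>_. C\<^sup>2"] assms by simp
  finally have "norm_L2 a b f \<le> sqrt (C\<^sup>2 * (b - a))"
    unfolding norm_L2_def by (rule real_sqrt_le_mono)
  also have "\<dots> = C * sqrt (b - a)"
    using assms by (simp add: real_sqrt_mult)
  finally show ?thesis .
qed

lemma norm_L2_triangle:
  assumes f: "f \<in> L2 a b" and g: "g \<in> L2 a b"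
  shows "norm_L2 a b (\<lambda>x. f x + g x) \<le> norm_L2 a b f + norm_L2 a b g"
proof -
  have fg: "integrable (lebesgue_on {a<..<b}) (\<lambda>x. f x * cnj (g x))"
    by (intro L2_mult_integrable L2_cnj f g)
  have "(norm_L2 a b (\<lambda>x. f x + g x))\<^sup>2 =
      (LINT x|lebesgue_on {a<..<b}. (norm (f x))\<^sup>2 + (norm (g x))\<^sup>2 + 2 * Re (f x * cnj (g x)))"
    unfolding norm_L2_sq
    by (intro Bochner_Integration.integral_cong refl) (unfold cmod_power2, simp add: power2_eq_square algebra_simps)
  also have "\<dots> = (norm_L2 a b f)\<^sup>2 + (norm_L2 a b g)\<^sup>2 + 2 * Re (LINT x|lebesgue_on {a<..<b}. f x * cnj (g x))"
    unfolding norm_L2_sq using fg integral_Re[OF fg]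
    by (simp add: L2_integrable_sq f g integrable_Re del: times_complex.simps)
  also have "\<dots> \<le> (norm_L2 a b f)\<^sup>2 + (norm_L2 a b g)\<^sup>2 + 2 * (norm_L2 a b f * norm_L2 a b g)"
  proof -
    have "norm_L2 a b (\<lambda>x. cnj (g x)) = norm_L2 a b g" by (simp add: norm_L2_def)
    then have "norm (LINT x|lebesgue_on {a<..<b}. f x * cnj (g x)) \<le> norm_L2 a b f * norm_L2 a b g"
      using L2_cauchy_schwarz[OF f L2_cnj[OF g]] by simp
    then show ?thesis
      using complex_Re_le_cmod[of "LINT x|lebesgue_on {a<..<b}. f x * cnj (g x)"] by linarith
  qed
  also have "\<dots> = (norm_L2 a b f + norm_L2 a b g)\<^sup>2" by (simp add: power2_sum)
  finally show ?thesis
    using norm_L2_nonneg power2_le_imp_le by (metis add_nonneg_nonneg)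
qed

lemma norm_L2_scale: "norm_L2 a b (\<lambda>x. c * f x) = norm c * norm_L2 a b f"
  by (simp add: norm_L2_def norm_mult power_mult_distrib real_sqrt_mult)

subsection \<open>Approximation by test functions\<close>

text \<open>Support in a closed subinterval rather than in an arbitrary compact set: this form
  passes directly to linear combinations and antiderivatives.\<close>

definition interval_test :: "real \<Rightarrow> real \<Rightarrow> (real \<Rightarrow> complex) \<Rightarrow> bool" where
  "interval_test a b \<phi> \<longleftrightarrow> smooth_on UNIV \<phi> \<and>
     (\<exists>\<alpha> \<beta>. a < \<alpha> \<and> \<alpha> < \<beta> \<and> \<beta> < b \<and> (\<forall>x. x \<notin> {\<alpha>..\<beta>} \<longrightarrow> \<phi> x = 0))"

lemma interval_test_function:
  assumes "interval_test a b \<phi>"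
  shows "\<phi> \<in> test_functions a b"
proof -
  obtain \<alpha> \<beta> where "a < \<alpha>" "\<beta> < b" "\<forall>x. x \<notin> {\<alpha>..\<beta>} \<longrightarrow> \<phi> x = 0" "smooth_on UNIV \<phi>"
    using assms by (auto simp: interval_test_def)
  then show ?thesis
    unfolding test_functions_def by (auto intro!: exI[of _ "{\<alpha>..\<beta>}"])
qed

lemma interval_test_lincomb:
  assumes "interval_test a b f" "interval_test a b g"
  shows "interval_test a b (\<lambda>x. f x - c * g x)"
proof -
  obtain \<alpha> \<beta> \<alpha>' \<beta>' where "a < \<alpha>" "\<alpha> < \<beta>" "\<beta> < b" "\<And>x. x \<notin> {\<alpha>..\<beta>} \<Longrightarrow> f x = 0"
    "a < \<alpha>'" "\<alpha>' < \<beta>'" "\<beta>' < b" "\<And>x. x \<notin> {\<alpha>'..\<beta>'} \<Longrightarrow> g x = 0"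
    using assms unfolding interval_test_def by metis
  note supp = this
  have "f x - c * g x = 0" if "x \<notin> {min \<alpha> \<alpha>'..max \<beta> \<beta>'}" for x
  proof -
    have "x \<notin> {\<alpha>..\<beta>}" "x \<notin> {\<alpha>'..\<beta>'}" using that by auto
    then show ?thesis using supp by simp
  qed
  moreover have "a < min \<alpha> \<alpha>'" "min \<alpha> \<alpha>' < max \<beta> \<beta>'" "max \<beta> \<beta>' < b"
    using supp by auto
  ultimately have "a < min \<alpha> \<alpha>' \<and> min \<alpha> \<alpha>' < max \<beta> \<beta>' \<and> max \<beta> \<beta>' < b \<and>
      (\<forall>x. x \<notin> {min \<alpha> \<alpha>'..max \<beta> \<beta>'} \<longrightarrow> f x - c * g x = 0)"
    by blast
  then show ?thesis
    using assms unfolding interval_test_def by (intro conjI smooth_on_lincomb) blast+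
qed

lemma flat_1_bounds: "0 \<le> flat 1 x" "flat 1 x \<le> 1" "0 < x \<Longrightarrow> 0 < flat 1 x"
  by (auto simp: flat_def)

lemma bump:
  assumes "a < b"
  shows "interval_test a b (\<lambda>x. of_real (flat 1 (x - (2 * a + b) / 3)) * of_real (flat 1 ((a + 2 * b) / 3 - x)))"
    (is "interval_test a b ?\<beta>")
  unfolding interval_test_def
proof (intro conjI exI allI impI)
  show "smooth_on UNIV ?\<beta>"
    by (intro smooth_algebra_smooth smooth_algebra.intros)
  show "?\<beta> x = 0" if "x \<notin> {(2 * a + b) / 3..(a + 2 * b) / 3}" for x
    using that by (auto simp: flat_def)
qed (use assms in \<open>auto simp: field_simps\<close>)

text \<open>Dividing \<open>f\<close> by a bump function, truncated from below, leaves a continuous function, which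
  is approximated by a polynomial.\<close>

lemma continuous_approx_test:
  fixes f :: "real \<Rightarrow> complex"
  assumes "a < b" and f: "continuous_on {a..b} f" and "0 < \<epsilon>"
  obtains \<phi> where "interval_test a b \<phi>" "norm_L2 a b (\<lambda>x. f x - \<phi> x) < \<epsilon>"
proof -
  obtain M where M: "M > 0" "\<And>x. x \<in> {a..b} \<Longrightarrow> norm (f x) \<le> M"
    using compact_imp_bounded[OF compact_continuous_image[OF f compact_Icc]]
    unfolding bounded_pos by blast
  \<comment> \<open>With \<open>e\<close> and \<open>\<eta>\<close> the interior contributes at most
    \<open>\<epsilon>\<^sup>2 / 4\<close> to the squared norm, and the boundary layers of total
    length \<open>4 * \<eta>\<close> at most \<open>\<epsilon>\<^sup>2 / 2\<close>.\<close>
  define e where "e = min 1 (\<epsilon> / (2 * sqrt (b - a)))"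
  have e: "0 < e" "e \<le> 1" using assms by (simp_all add: e_def)
  define \<eta> where "\<eta> = min ((b - a) / 8) (\<epsilon>\<^sup>2 / (8 * (M + 1)\<^sup>2))"
  have "0 < \<eta>" using assms(1,3) M(1) by (simp add: \<eta>_def)
  moreover have "\<eta> \<le> (b - a) / 8" unfolding \<eta>_def by (rule min.cobounded1)
  moreover have "\<eta> \<le> \<epsilon>\<^sup>2 / (8 * (M + 1)\<^sup>2)" unfolding \<eta>_def by (rule min.cobounded2)
  ultimately have \<eta>: "0 < \<eta>" "\<eta> \<le> (b - a) / 8" "\<eta> \<le> \<epsilon>\<^sup>2 / (8 * (M + 1)\<^sup>2)" by blast+
  define \<beta> where "\<beta> = (\<lambda>x. flat 1 (x - (a + \<eta>)) * flat 1 (b - \<eta> - x))"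
  have \<beta>_smooth: "(\<lambda>x. of_real (\<beta> x)) \<in> smooth_algebra"
    unfolding \<beta>_def of_real_mult by (intro smooth_algebra.intros)
  have flat_cont: "continuous_on S (flat 1)" for S
    by (intro continuous_at_imp_continuous_on ballI DERIV_isCont[OF flat_deriv])
  have \<beta>_cont: "continuous_on S \<beta>" for S
    unfolding \<beta>_def
  proof (rule continuous_on_mult)
    show "continuous_on S (\<lambda>x. flat 1 (x - (a + \<eta>)))"
      by (rule continuous_on_compose2[OF flat_cont[of UNIV]]) (auto intro!: continuous_intros)
    show "continuous_on S (\<lambda>x. flat 1 (b - \<eta> - x))"
      by (rule continuous_on_compose2[OF flat_cont[of UNIV]]) (auto intro!: continuous_intros)
  qed
  have \<beta>_bounds: "0 \<le> \<beta> x" "\<beta> x \<le> 1" for x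
    unfolding \<beta>_def using flat_1_bounds by (auto intro: mult_le_one)
  have "{a + 2 * \<eta>..b - 2 * \<eta>} \<noteq> {}" using \<eta> by auto
  then obtain y where y: "y \<in> {a + 2 * \<eta>..b - 2 * \<eta>}" "\<And>x. x \<in> {a + 2 * \<eta>..b - 2 * \<eta>} \<Longrightarrow> \<beta> y \<le> \<beta> x"
    using continuous_attains_inf[OF compact_Icc _ \<beta>_cont] by blast
  \<comment> \<open>The minimum of the cutoff on the inner interval: there
    \<open>\<beta> * g\<close> is exactly \<open>f\<close>, while in the layers boundedness
    suffices.\<close>
  define \<tau> where "\<tau> = \<beta> y"
  have \<tau>: "0 < \<tau>"
    unfolding \<tau>_def \<beta>_def using y(1) \<eta> by (intro mult_pos_pos flat_1_bounds) auto
  define g where "g = (\<lambda>x. f x / of_real (max (\<beta> x) \<tau>))"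
  have g_cont: "continuous_on {a..b} g"
    unfolding g_def using \<tau> by (intro continuous_intros f \<beta>_cont) (auto simp: max_def)
  from Stone_Weierstrass_polynomial_function[OF compact_Icc g_cont e(1)]
  obtain P where P: "polynomial_function P" "\<And>x. x \<in> {a..b} \<Longrightarrow> norm (g x - P x) < e"
    by metis
  define \<phi> where "\<phi> = (\<lambda>x. of_real (\<beta> x) * P x)"
  have \<phi>_test: "interval_test a b \<phi>"
    unfolding interval_test_def
  proof (intro conjI exI allI impI)
    show "smooth_on UNIV \<phi>"
      unfolding \<phi>_def
      by (intro smooth_algebra_smooth smooth_algebra.mult \<beta>_smooth polynomial_smooth_algebra P)
    show "\<phi> x = 0" if "x \<notin> {a + \<eta>..b - \<eta>}" for x
      using that by (auto simp: \<phi>_def \<beta>_def flat_def)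
  qed (use \<eta> in auto)
  have \<phi>_cont: "continuous_on {a..b} \<phi>"
    unfolding \<phi>_def by (intro continuous_intros \<beta>_cont continuous_on_polymonial_function P)
  define d where "d = (\<lambda>x. (norm (f x - \<phi> x))\<^sup>2)"
  have d_int: "d integrable_on {s..t}" if "{s..t} \<subseteq> {a..b}" for s t
    unfolding d_def using that
    by (intro integrable_continuous_real continuous_intros continuous_on_subset[OF f] continuous_on_subset[OF \<phi>_cont])
  have b: "norm (of_real (\<beta> x) * g x - \<phi> x) \<le> e" if "x \<in> {a..b}" for x
  proof -
    have "of_real (\<beta> x) * g x - \<phi> x = of_real (\<beta> x) * (g x - P x)" by (simp add: \<phi>_def algebra_simps)
    also have "norm \<dots> \<le> 1 * e"
      unfolding norm_mult using \<beta>_bounds P(2)[OF that] by (intro mult_mono) auto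
    finally show ?thesis by simp
  qed
  have d_inner: "d x \<le> e\<^sup>2" if x: "x \<in> {a + 2 * \<eta>..b - 2 * \<eta>}" for x
  proof -
    have "max (\<beta> x) \<tau> = \<beta> x" "0 < \<beta> x" using y(2)[OF x] \<tau> by (auto simp: \<tau>_def)
    then have "of_real (\<beta> x) * g x = f x" by (simp add: g_def)
    then show ?thesis using b[of x] x \<eta> unfolding d_def by (intro power_mono) auto
  qed
  have d_outer: "d x \<le> (M + 1)\<^sup>2" if x: "x \<in> {a..b}" for x
  proof -
    have "f x - \<phi> x = (1 - of_real (\<beta> x / max (\<beta> x) \<tau>)) * f x + (of_real (\<beta> x) * g x - \<phi> x)"
      by (simp add: g_def algebra_simps)
    also have "norm \<dots> \<le> norm ((1 - complex_of_real (\<beta> x / max (\<beta> x) \<tau>)) * f x) + norm (of_real (\<beta> x) * g x - \<phi> x)"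
      by (rule norm_triangle_ineq)
    also have "\<dots> \<le> 1 * M + e"
    proof (intro add_mono b x)
      have "\<beta> x / max (\<beta> x) \<tau> \<le> 1" "0 \<le> \<beta> x / max (\<beta> x) \<tau>"
        using \<beta>_bounds[of x] \<tau> by (auto simp: divide_le_eq max_def)
      then have "norm (complex_of_real (1 - \<beta> x / max (\<beta> x) \<tau>)) \<le> 1"
        unfolding norm_of_real by linarith
      then have "norm (1 - complex_of_real (\<beta> x / max (\<beta> x) \<tau>)) \<le> 1"
        by (simp only: of_real_diff of_real_1)
      then show "norm ((1 - complex_of_real (\<beta> x / max (\<beta> x) \<tau>)) * f x) \<le> 1 * M"
        unfolding norm_mult using M(2)[OF x] by (intro mult_mono) auto
    qed
    finally show ?thesis unfolding d_def using e by (intro power_mono) auto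
  qed
  have "(norm_L2 a b (\<lambda>x. f x - \<phi> x))\<^sup>2 = integral {a..b} d"
    unfolding norm_L2_sq d_def by (intro continuous_integrable_Ioo continuous_intros f \<phi>_cont)
  also have "\<dots> = integral {a..a + 2 * \<eta>} d + (integral {a + 2 * \<eta>..b - 2 * \<eta>} d + integral {b - 2 * \<eta>..b} d)"
  proof -
    have "integral {a..a + 2 * \<eta>} d + integral {a + 2 * \<eta>..b} d = integral {a..b} d"
      "integral {a + 2 * \<eta>..b - 2 * \<eta>} d + integral {b - 2 * \<eta>..b} d = integral {a + 2 * \<eta>..b} d"
      using \<eta> by (intro Henstock_Kurzweil_Integration.integral_combine d_int; simp)+
    then show ?thesis by simp
  qed
  also have "\<dots> \<le> integral {a..a + 2 * \<eta>} (\<lambda>_. (M + 1)\<^sup>2) +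
      (integral {a + 2 * \<eta>..b - 2 * \<eta>} (\<lambda>_. e\<^sup>2) + integral {b - 2 * \<eta>..b} (\<lambda>_. (M + 1)\<^sup>2))"
    using \<eta> d_inner d_outer by (intro add_mono integral_le d_int) auto
  also have "\<dots> = 4 * \<eta> * (M + 1)\<^sup>2 + (b - a - 4 * \<eta>) * e\<^sup>2"
    using \<eta> by (simp add: algebra_simps)
  also have "\<dots> < 4 * \<eta> * (M + 1)\<^sup>2 + (b - a) * e\<^sup>2"
    using \<eta> e by (intro add_strict_left_mono mult_strict_right_mono) auto
  also have "4 * \<eta> * (M + 1)\<^sup>2 \<le> \<epsilon>\<^sup>2 / 2"
    using \<eta>(3) M by (simp add: field_simps)
  also have "(b - a) * e\<^sup>2 \<le> (b - a) * (\<epsilon> / (2 * sqrt (b - a)))\<^sup>2"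
    using assms e by (intro mult_left_mono power_mono) (auto simp: e_def)
  also have "\<dots> = \<epsilon>\<^sup>2 / 4"
  proof -
    have h: "l * (\<epsilon> / (2 * sqrt l))\<^sup>2 = \<epsilon>\<^sup>2 / 4" if "0 < l" for l
      using that by (simp add: power_divide power_mult_distrib)
    show ?thesis by (rule h) (use assms in simp)
  qed
  also have "\<epsilon>\<^sup>2 / 2 + \<epsilon>\<^sup>2 / 4 \<le> \<epsilon>\<^sup>2" by simp
  finally have "(norm_L2 a b (\<lambda>x. f x - \<phi> x))\<^sup>2 < \<epsilon>\<^sup>2" by simp
  then have "norm_L2 a b (\<lambda>x. f x - \<phi> x) < \<epsilon>"
    using assms(3) by (intro power2_less_imp_less[of _ \<epsilon>]) auto
  then show ?thesis using that \<phi>_test by blast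
qed

lemma norm_integral_le_L2:
  assumes "a < b" and v: "continuous_on {a..b} v" and x: "x \<in> {a..b}"
  shows "norm (integral {a..x} v) \<le> sqrt (b - a) * norm_L2 a b v"
proof -
  have "norm (integral {a..x} v) \<le> integral {a..x} (\<lambda>t. norm (v t))"
    using x by (intro integral_norm_bound_integral integrable_continuous_real continuous_intros continuous_on_subset[OF v]) auto
  also have "\<dots> \<le> integral {a..b} (\<lambda>t. norm (v t))"
    using x by (intro integral_subset_le integrable_continuous_real continuous_intros continuous_on_subset[OF v]) auto
  finally have 1: "norm (integral {a..x} v) \<le> integral {a..b} (\<lambda>t. norm (v t))" .
  have "complex_of_real (integral {a..b} (\<lambda>t. norm (v t))) = integral {a..b} (\<lambda>t. of_real (norm (v t)) * 1)"
    by (simp, intro integral_unique[symmetric] has_integral_of_real integrable_integral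
      integrable_continuous_real continuous_intros v)
  also have "\<dots> = (LINT t|lebesgue_on {a<..<b}. of_real (norm (v t)) * 1)"
    by (intro continuous_integrable_Ioo(2)[symmetric] continuous_intros v)
  finally have "norm (complex_of_real (integral {a..b} (\<lambda>t. norm (v t))))
      \<le> norm_L2 a b (\<lambda>t. of_real (norm (v t))) * norm_L2 a b (\<lambda>_. 1)"
  proof -
    have m: "(\<lambda>t. complex_of_real (norm (v t))) \<in> L2 a b" "(\<lambda>_. 1) \<in> L2 a b"
      by (intro continuous_L2 continuous_intros v)+
    assume "complex_of_real (integral {a..b} (\<lambda>t. norm (v t))) = (LINT t|lebesgue_on {a<..<b}. of_real (norm (v t)) * 1)"
    then show ?thesis using L2_cauchy_schwarz[OF m] by (simp only:)
  qed
  also have "norm_L2 a b (\<lambda>t. of_real (norm (v t))) = norm_L2 a b v"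
    by (simp add: norm_L2_def)
  also have "norm_L2 a b (\<lambda>_. 1) \<le> 1 * sqrt (b - a)"
    using assms(1) by (intro norm_L2_le continuous_L2) auto
  then have "norm_L2 a b v * norm_L2 a b (\<lambda>_. 1) \<le> norm_L2 a b v * sqrt (b - a)"
    by (intro mult_left_mono norm_L2_nonneg) simp
  finally show ?thesis using 1 by (simp add: mult.commute)
qed

section \<open>Primitives, integration by parts and weak derivatives\<close>

definition C1_on :: "real \<Rightarrow> real \<Rightarrow> (real \<Rightarrow> complex) \<Rightarrow> (real \<Rightarrow> complex) \<Rightarrow> bool" where
  "C1_on a b u v \<longleftrightarrow> (\<forall>x\<in>{a..b}. (u has_vector_derivative v x) (at x within {a..b})) \<and> continuous_on {a..b} v"

lemma C1_on_continuous:
  assumes "C1_on a b u v" shows "continuous_on {a..b} u" "continuous_on {a..b} v"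
  using assms unfolding C1_on_def
  by (auto intro!: has_vector_derivative_continuous simp: continuous_on_eq_continuous_within)

lemma C1_on_subset:
  assumes "C1_on a b u v" "a \<le> c" "d \<le> b"
  shows "C1_on c d u v"
proof -
  have sub: "{c..d} \<subseteq> {a..b}" using assms by auto
  then show ?thesis
    using assms(1) unfolding C1_on_def
    by (meson continuous_on_subset has_vector_derivative_within_subset subsetD)
qed

lemma C1_on_has_integral:
  assumes "C1_on a b u v" "a \<le> s" "s \<le> t" "t \<le> b"
  shows "(v has_integral (u t - u s)) {s..t}"
  using C1_on_subset[OF assms(1,2,4)] assms(3) unfolding C1_on_def
  by (intro fundamental_theorem_of_calculus) auto

lemma C1_on_FTC:
  assumes "C1_on a b u v" "x \<in> {a..b}"
  shows "u x = u a + integral {a..x} v"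
  using C1_on_has_integral[OF assms(1), of a x] assms(2) by (simp add: integral_unique)

lemma C1_on_integral:
  assumes "continuous_on {a..b} v"
  shows "C1_on a b (\<lambda>x. c + integral {a..x} v) v"
  unfolding C1_on_def
  using assms by (auto intro!: derivative_eq_intros integral_has_vector_derivative)

text \<open>The increments of the difference of both sides are bounded by
  \<open>C * (x' - x) * (G x' - G x)\<close> with \<open>G\<close> the integral of \<open>norm g\<close>, so its derivative vanishes
  everywhere although \<open>g\<close> is only integrable.\<close>

lemma integration_by_parts_L1:
  fixes g y :: "real \<Rightarrow> complex"
  assumes "a < b" and g: "g absolutely_integrable_on {a..b}" and y: "C1_on a b y y'" and x: "x \<in> {a..b}"
  shows "y x * integral {a..x} g = integral {a..x} (\<lambda>t. y' t * integral {a..t} g + y t * g t)"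
proof -
  define A where "A = (\<lambda>x. integral {a..x} g)"
  define G where "G = (\<lambda>x. integral {a..x} (\<lambda>t. norm (g t)))"
  note y_cont = C1_on_continuous[OF y]
  have g_int: "g integrable_on {s..t}" if "{s..t} \<subseteq> {a..b}" for s t
    using set_lebesgue_integral_eq_integral(1)[OF g] that integrable_on_subinterval by blast
  have ng_int: "(\<lambda>t. norm (g t)) integrable_on {s..t}" if "{s..t} \<subseteq> {a..b}" for s t
    using absolutely_integrable_on_subinterval[OF g that] absolutely_integrable_on_def by blast
  have A_cont: "continuous_on {a..b} A"
    unfolding A_def by (intro indefinite_integral_continuous_1 g_int) auto
  have G_cont: "continuous_on {a..b} G"
    unfolding G_def by (intro indefinite_integral_continuous_1 ng_int) auto
  have yg: "(\<lambda>t. y t * g t) integrable_on {s..t}" if "{s..t} \<subseteq> {a..b}" for s t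
  proof -
    have "(\<lambda>t. y t * g t) absolutely_integrable_on {a..b}"
    proof (rule absolutely_integrable_bounded_measurable_product[where h = "(*)", OF _ _ _ _ g])
      show "bilinear ((*) :: complex \<Rightarrow> complex \<Rightarrow> complex)" by (simp add: bilinear_times)
      show "y \<in> borel_measurable (lebesgue_on {a..b})"
        by (intro continuous_imp_measurable_on_sets_lebesgue y_cont) auto
      show "bounded (y ` {a..b})"
        by (intro compact_imp_bounded compact_continuous_image y_cont compact_Icc)
    qed auto
    then show ?thesis
      using set_lebesgue_integral_eq_integral(1) that integrable_on_subinterval by blast
  qed
  define f where "f = (\<lambda>t. y' t * A t + y t * g t)"
  have f_int: "f integrable_on {s..t}" if "{s..t} \<subseteq> {a..b}" for s t
    unfolding f_def using that
    by (intro integrable_add yg integrable_continuous_real continuous_intros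
      continuous_on_subset[OF A_cont] continuous_on_subset[OF y_cont(2)])
  define \<Phi> where "\<Phi> = (\<lambda>x. y x * A x - integral {a..x} f)"
  obtain C where C: "C > 0" "\<And>t. t \<in> {a..b} \<Longrightarrow> norm (y' t) \<le> C"
    using compact_imp_bounded[OF compact_continuous_image[OF y_cont(2) compact_Icc]]
    unfolding bounded_pos by blast
  have y_lip: "norm (y s - y t) \<le> C * (s - t)" if "a \<le> t" "t \<le> s" "s \<le> b" for s t
  proof -
    have "(y' has_integral (y s - y t)) {t..s}"
      by (rule C1_on_has_integral[OF y that])
    then have "norm (y s - y t) \<le> C * measure lborel (cbox t s)"
      using C that by (intro has_integral_bound[of C y' _ t s]) auto
    then show ?thesis using that by simp
  qed
  have A_diff: "norm (A s - A t) \<le> G s - G t" "A s - A t = integral {t..s} g" "G s - G t = integral {t..s} (\<lambda>t. norm (g t))"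
    if "a \<le> t" "t \<le> s" "s \<le> b" for s t
  proof -
    show 1: "A s - A t = integral {t..s} g"
      unfolding A_def using that Henstock_Kurzweil_Integration.integral_combine[OF that(1,2) g_int] by (simp add: algebra_simps)
    show 2: "G s - G t = integral {t..s} (\<lambda>t. norm (g t))"
      unfolding G_def using that Henstock_Kurzweil_Integration.integral_combine[OF that(1,2) ng_int] by (simp add: algebra_simps)
    show "norm (A s - A t) \<le> G s - G t"
      unfolding 1 2 using that by (intro integral_norm_bound_integral g_int ng_int) auto
  qed
  have step: "norm (\<Phi> s - \<Phi> t) \<le> 2 * C * (s - t) * (G s - G t)" if ts: "a \<le> t" "t \<le> s" "s \<le> b" for s t
  proof -
    have sub: "{t..s} \<subseteq> {a..b}" using ts by auto
    have int1: "(\<lambda>r. y' r * A r) integrable_on {t..s}"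
      by (intro integrable_continuous_real continuous_intros continuous_on_subset[OF A_cont sub] continuous_on_subset[OF y_cont(2) sub])
    have int2: "(y' has_integral (y s - y t)) {t..s}"
      by (rule C1_on_has_integral[OF y ts])
    have f_diff: "integral {a..s} f - integral {a..t} f = integral {t..s} f"
      using Henstock_Kurzweil_Integration.integral_combine[OF ts(1,2) f_int] ts by (simp add: algebra_simps)
    have "integral {t..s} f = integral {t..s} (\<lambda>r. y' r * A r) + integral {t..s} (\<lambda>r. y r * g r)"
      unfolding f_def by (intro integral_add int1 yg sub)
    then have "\<Phi> s - \<Phi> t = y s * A s - y t * A t - integral {t..s} (\<lambda>r. y' r * A r) - integral {t..s} (\<lambda>r. y r * g r)"
      using f_diff by (simp add: \<Phi>_def algebra_simps)
    \<comment> \<open>Regrouped so that each bracket is bounded by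
      \<open>C * (s - t) * (G s - G t)\<close>.\<close>
    also have "\<dots> = ((y s - y t) * A t - integral {t..s} (\<lambda>r. y' r * A r)) + (y s * (A s - A t) - integral {t..s} (\<lambda>r. y r * g r))"
      by (simp add: algebra_simps)
    also have "(y s - y t) * A t - integral {t..s} (\<lambda>r. y' r * A r) = integral {t..s} (\<lambda>r. y' r * (A t - A r))"
      using integral_diff[OF has_integral_integrable[OF has_integral_mult_left[OF int2, of "A t"]] int1]
        integral_unique[OF int2]
      by (simp add: right_diff_distrib)
    also have "y s * (A s - A t) - integral {t..s} (\<lambda>r. y r * g r) = integral {t..s} (\<lambda>r. (y s - y r) * g r)"
      using integral_diff[OF integrable_on_mult_right[OF g_int[OF sub], of "y s"] yg[OF sub]] A_diff(2)[OF ts]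
      by (simp add: left_diff_distrib)
    finally have eq: "\<Phi> s - \<Phi> t = integral {t..s} (\<lambda>r. y' r * (A t - A r)) + integral {t..s} (\<lambda>r. (y s - y r) * g r)" .
    have "norm (integral {t..s} (\<lambda>r. y' r * (A t - A r))) \<le> integral {t..s} (\<lambda>r. C * (G s - G t))"
    proof (rule integral_norm_bound_integral)
      show "(\<lambda>r. y' r * (A t - A r)) integrable_on {t..s}"
        by (intro integrable_continuous_real continuous_intros continuous_on_subset[OF A_cont sub] continuous_on_subset[OF y_cont(2) sub])
      fix r assume r: "r \<in> {t..s}"
      have "norm (A t - A r) \<le> G r - G t"
        using A_diff(1)[of t r] r ts by (simp add: norm_minus_commute)
      also have "\<dots> \<le> G s - G t"
      proof -
        have "0 \<le> norm (A s - A r)" by simp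
        also have "\<dots> \<le> G s - G r" using A_diff(1)[of r s] r ts by simp
        finally show ?thesis by simp
      qed
      finally show "norm (y' r * (A t - A r)) \<le> C * (G s - G t)"
        unfolding norm_mult using C r sub by (intro mult_mono) auto
    qed auto
    also have "\<dots> = C * (s - t) * (G s - G t)" using ts by simp
    finally have b1: "norm (integral {t..s} (\<lambda>r. y' r * (A t - A r))) \<le> C * (s - t) * (G s - G t)" .
    have "norm (integral {t..s} (\<lambda>r. (y s - y r) * g r)) \<le> integral {t..s} (\<lambda>r. C * (s - t) * norm (g r))"
    proof (rule integral_norm_bound_integral)
      show "(\<lambda>r. (y s - y r) * g r) integrable_on {t..s}"
        unfolding left_diff_distrib by (intro integrable_diff integrable_on_mult_right g_int yg sub)
      show "(\<lambda>r. C * (s - t) * norm (g r)) integrable_on {t..s}"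
        by (intro integrable_on_mult_right ng_int sub)
      fix r assume r: "r \<in> {t..s}"
      have "norm (y s - y r) \<le> C * (s - r)" using y_lip[of r s] r ts by simp
      also have "\<dots> \<le> C * (s - t)" using C r by (intro mult_left_mono) auto
      finally show "norm ((y s - y r) * g r) \<le> C * (s - t) * norm (g r)"
        unfolding norm_mult by (intro mult_right_mono) auto
    qed
    also have "\<dots> = C * (s - t) * (G s - G t)" using A_diff(3)[OF ts] by simp
    finally have b2: "norm (integral {t..s} (\<lambda>r. (y s - y r) * g r)) \<le> C * (s - t) * (G s - G t)" .
    show ?thesis
      unfolding eq using norm_triangle_ineq[of "integral {t..s} (\<lambda>r. y' r * (A t - A r))" "integral {t..s} (\<lambda>r. (y s - y r) * g r)"] b1 b2
      by linarith
  qed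
  \<comment> \<open>By \<open>step\<close> the difference quotient is at most a constant times
    \<open>\<bar>G s - G t\<bar>\<close>, which tends to 0 at every point by continuity of
    \<open>G\<close>.\<close>
  have "(\<Phi> has_vector_derivative 0) (at t within {a..b})" if t: "t \<in> {a..b}" for t
    unfolding has_vector_derivative_def has_derivative_within
  proof (intro conjI)
    show "bounded_linear (\<lambda>x. x *\<^sub>R (0::complex))" by simp
    have "((\<lambda>s. 2 * C * \<bar>G s - G t\<bar>) \<longlongrightarrow> 2 * C * \<bar>G t - G t\<bar>) (at t within {a..b})"
      using G_cont t unfolding continuous_on_def by (intro tendsto_intros) auto
    then have lim: "((\<lambda>s. 2 * C * \<bar>G s - G t\<bar>) \<longlongrightarrow> 0) (at t within {a..b})" by simp
    show "((\<lambda>s. (1 / norm (s - t)) *\<^sub>R (\<Phi> s - (\<Phi> t + (s - t) *\<^sub>R 0))) \<longlongrightarrow> 0) (at t within {a..b})"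
    proof (rule Lim_null_comparison[OF _ lim])
      have "norm ((1 / norm (s - t)) *\<^sub>R (\<Phi> s - (\<Phi> t + (s - t) *\<^sub>R 0))) \<le> 2 * C * \<bar>G s - G t\<bar>"
        if s: "s \<in> {a..b}" "s \<noteq> t" for s
      proof -
        have "norm (\<Phi> s - \<Phi> t) \<le> 2 * C * \<bar>s - t\<bar> * \<bar>G s - G t\<bar>"
        proof (cases "t \<le> s")
          case True
          have "0 \<le> G s - G t" using order_trans[OF norm_ge_zero A_diff(1)[of t s]] True s t by simp
          then show ?thesis using step[of t s] True s t by simp
        next
          case False
          then have "0 \<le> G t - G s" using order_trans[OF norm_ge_zero A_diff(1)[of s t]] s t by simp
          then show ?thesis using step[of s t] False s t by (simp add: norm_minus_commute)
        qed
        then show ?thesis using s by (simp add: divide_le_eq mult_ac)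
      qed
      then show "\<forall>\<^sub>F s in at t within {a..b}. norm ((1 / norm (s - t)) *\<^sub>R (\<Phi> s - (\<Phi> t + (s - t) *\<^sub>R 0))) \<le> 2 * C * \<bar>G s - G t\<bar>"
        by (simp add: eventually_at_filter)
    qed
  qed
  then have "((\<lambda>_. 0) has_integral (\<Phi> x - \<Phi> a)) {a..x}"
    using x by (intro fundamental_theorem_of_calculus)
      (auto intro: has_vector_derivative_within_subset[of _ _ _ "{a..b}"])
  then have "\<Phi> x = \<Phi> a"
    using has_integral_0 has_integral_unique by fastforce
  then show ?thesis by (simp add: \<Phi>_def f_def A_def)
qed

lemma L2_absolutely_integrable:
  assumes "f \<in> L2 a b"
  shows "f absolutely_integrable_on {a..b}"
proof -
  have "integrable (lebesgue_on {a<..<b}) (\<lambda>x. f x * 1)"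
    by (intro L2_mult_integrable assms continuous_L2) auto
  then have "f absolutely_integrable_on {a<..<b}"
    by (simp add: set_integrable_def integrable_restrict_space)
  moreover have "negligible {x \<in> {a..b} - {a<..<b}. f x \<noteq> 0}" "negligible {x \<in> {a<..<b} - {a..b}. f x \<noteq> 0}"
    by (rule negligible_subset[of "{a, b}"], simp, force)+
  ultimately show ?thesis
    by (subst absolutely_integrable_spike_set_eq) auto
qed

lemma LINT_Ioo_eq_integral:
  fixes f :: "real \<Rightarrow> complex"
  assumes "integrable (lebesgue_on {a<..<b}) f"
  shows "integral\<^sup>L (lebesgue_on {a<..<b}) f = integral {a..b} f"
  using assms by (subst lebesgue_integral_eq_integral) (auto simp: integral_open_interval_real)

lemma test_function_C1:
  assumes "\<phi> \<in> test_functions a b"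
  shows "C1_on a b \<phi> (derivative_of \<phi>)" "\<phi> a = 0" "\<phi> b = 0"
proof -
  have s: "smooth_on UNIV \<phi>" using assms by (simp add: test_functions_def)
  show "C1_on a b \<phi> (derivative_of \<phi>)"
    unfolding C1_on_def
    using smooth_on_UNIV_deriv[OF s] by (auto intro: has_vector_derivative_at_within)
  show "\<phi> a = 0" "\<phi> b = 0" using assms by (auto simp: test_functions_def subset_iff)
qed

text \<open>Primitives of square integrable functions are covered, since the second derivative of a
  Green potential contains the right side itself. The constant drops out because test functions
  vanish at both ends.\<close>

lemma weak_deriv_integral:
  assumes "a < b" and g: "g \<in> L2 a b" and u: "\<And>x. x \<in> {a..b} \<Longrightarrow> u x = c + integral {a..x} g"
  shows "weak_deriv a b u g"
proof -
  note ag = L2_absolutely_integrable[OF g]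
  have "continuous_on {a..b} (\<lambda>x. c + integral {a..x} g)"
    by (intro continuous_intros indefinite_integral_continuous_1 set_lebesgue_integral_eq_integral(1)[OF ag])
  then have u_cont: "continuous_on {a..b} u"
    by (rule continuous_on_eq) (simp add: u)
  have "(LINT x|lebesgue_on {a<..<b}. u x * derivative_of \<phi> x) = - (LINT x|lebesgue_on {a<..<b}. g x * \<phi> x)"
    if \<phi>: "\<phi> \<in> test_functions a b" for \<phi>
  proof -
    note \<phi>' = test_function_C1[OF \<phi>]
    note \<phi>_cont = C1_on_continuous[OF \<phi>'(1)]
    have int: "integrable (lebesgue_on {a<..<b}) (\<lambda>x. u x * derivative_of \<phi> x)"
      "integrable (lebesgue_on {a<..<b}) (\<lambda>x. g x * \<phi> x)"
      by (intro L2_mult_integrable g continuous_L2 u_cont \<phi>_cont)+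
    have "(\<lambda>x. g x * \<phi> x) absolutely_integrable_on {a<..<b}"
      using int(2) by (simp add: set_integrable_def integrable_restrict_space)
    then have hk2: "(\<lambda>x. g x * \<phi> x) integrable_on {a..b}"
      using set_lebesgue_integral_eq_integral(1) integrable_on_open_interval_real by blast
    have hk1: "(\<lambda>x. derivative_of \<phi> x * (u x - c)) integrable_on {a..b}"
      by (intro integrable_continuous_real continuous_intros u_cont \<phi>_cont)
    have "\<phi> b * integral {a..b} g = integral {a..b} (\<lambda>t. derivative_of \<phi> t * integral {a..t} g + \<phi> t * g t)"
      using assms(1) by (intro integration_by_parts_L1[OF assms(1) ag \<phi>'(1)]) auto
    also have "\<dots> = integral {a..b} (\<lambda>t. derivative_of \<phi> t * (u t - c) + g t * \<phi> t)"
      by (intro integral_cong) (simp add: u mult.commute)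
    also have "\<dots> = integral {a..b} (\<lambda>t. derivative_of \<phi> t * (u t - c)) + integral {a..b} (\<lambda>t. g t * \<phi> t)"
      by (intro integral_add hk1 hk2)
    also have "integral {a..b} (\<lambda>t. derivative_of \<phi> t * (u t - c)) =
        integral {a..b} (\<lambda>t. u t * derivative_of \<phi> t) - c * integral {a..b} (derivative_of \<phi>)"
    proof -
      have "integral {a..b} (\<lambda>t. derivative_of \<phi> t * (u t - c)) =
          integral {a..b} (\<lambda>t. u t * derivative_of \<phi> t - c * derivative_of \<phi> t)"
        by (intro integral_cong) (simp add: algebra_simps)
      also have "\<dots> = integral {a..b} (\<lambda>t. u t * derivative_of \<phi> t) - integral {a..b} (\<lambda>t. c * derivative_of \<phi> t)"
        by (intro integral_diff integrable_continuous_real continuous_intros u_cont \<phi>_cont)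
      finally show ?thesis by simp
    qed
    also have "integral {a..b} (derivative_of \<phi>) = 0"
      using C1_on_FTC[OF \<phi>'(1), of b] \<phi>' assms(1) by simp
    finally have "integral {a..b} (\<lambda>t. u t * derivative_of \<phi> t) = - integral {a..b} (\<lambda>t. g t * \<phi> t)"
      using \<phi>' by (simp add: eq_neg_iff_add_eq_0)
    then show ?thesis using int by (simp add: LINT_Ioo_eq_integral)
  qed
  then show ?thesis
    unfolding weak_deriv_def using g u_cont by (auto intro: continuous_L2)
qed

lemma weak_deriv_C1:
  assumes "a < b" "C1_on a b u v"
  shows "weak_deriv a b u v"
  using C1_on_FTC[OF assms(2)]
  by (intro weak_deriv_integral[OF assms(1) continuous_L2[OF C1_on_continuous(2)[OF assms(2)]]])

lemma bump_integral_nonzero: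
  assumes "a < b"
  obtains \<beta> where "interval_test a b \<beta>" "integral {a..b} \<beta> \<noteq> 0"
proof -
  define r where "r = (\<lambda>x. flat 1 (x - (2 * a + b) / 3) * flat 1 ((a + 2 * b) / 3 - x))"
  define \<beta> where "\<beta> = (\<lambda>x. complex_of_real (r x))"
  have test: "interval_test a b \<beta>"
    using bump[OF assms] by (simp add: \<beta>_def r_def)
  have r_cont: "continuous_on {a..b} r"
    unfolding r_def
    by (intro continuous_at_imp_continuous_on ballI continuous_mult
        isCont_o2[OF _ DERIV_isCont[OF flat_deriv]]) auto
  have "integral {a..b} \<beta> = of_real (integral {a..b} r)"
    unfolding \<beta>_def by (intro integral_unique has_integral_of_real integrable_integral integrable_continuous_real r_cont)
  moreover have "integral {a..b} r \<noteq> 0"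
  proof
    assume "integral {a..b} r = 0"
    then have "(r has_integral 0) (cbox a b)"
      using integrable_integral[OF integrable_continuous_real[OF r_cont]] by simp
    then have "r ((a + b) / 2) = 0"
      using has_integral_0_cbox_imp_0[of a b r "(a + b) / 2"] assms r_cont flat_1_bounds(1)
      by (auto simp: r_def)
    moreover have "r ((a + b) / 2) > 0"
      unfolding r_def using assms by (intro mult_pos_pos flat_1_bounds) (auto simp: field_simps)
    ultimately show False by simp
  qed
  ultimately show ?thesis using that test by auto
qed

lemma interval_test_cont:
  assumes "interval_test a b \<phi>"
  shows "continuous_on S \<phi>"
  using assms smooth_on_UNIV_deriv(1) unfolding interval_test_def
  by (intro continuous_at_imp_continuous_on ballI) (blast intro: has_vector_derivative_continuous)

text \<open>Mean zero is what makes the primitive vanish to the right of the support; to the left it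
  vanishes anyway.\<close>

lemma interval_test_antiderivative:
  assumes \<psi>: "interval_test a b \<psi>" and int0: "integral {a..b} \<psi> = 0"
  shows "(\<lambda>x. integral {a..x} \<psi>) \<in> test_functions a b" "derivative_of (\<lambda>x. integral {a..x} \<psi>) = \<psi>"
proof -
  define \<phi> where "\<phi> = (\<lambda>x. integral {a..x} \<psi>)"
  obtain \<alpha> \<beta> where supp: "a < \<alpha>" "\<alpha> < \<beta>" "\<beta> < b" "\<And>x. x \<notin> {\<alpha>..\<beta>} \<Longrightarrow> \<psi> x = 0"
    using \<psi> by (auto simp: interval_test_def)
  note cont = interval_test_cont[OF \<psi>]
  have left: "\<phi> x = 0" if "x < \<alpha>" for x
  proof -
    have "integral {a..x} \<psi> = integral {a..x} (\<lambda>_. 0)"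
      by (intro integral_cong supp(4)) (use that in auto)
    then show ?thesis by (simp add: \<phi>_def)
  qed
  have beyond: "integral {a..x} \<psi> = integral {a..\<beta>} \<psi>" if "\<beta> \<le> x" for x
  proof -
    have "integral {\<beta>..x} \<psi> = 0"
    proof -
      have "integral {\<beta>..x} \<psi> = integral {\<beta>..x} (\<lambda>_. 0)"
        by (rule integral_spike[of "{\<beta>}"]) (use supp in auto)
      then show ?thesis by simp
    qed
    then show ?thesis
      using Henstock_Kurzweil_Integration.integral_combine[of a \<beta> x \<psi>] supp that
      by (simp add: integrable_continuous_real[OF cont])
  qed
  have right: "\<phi> x = 0" if "\<beta> < x" for x
    using beyond[of x] beyond[of b] that supp int0 by (simp add: \<phi>_def)
  have deriv: "(\<phi> has_vector_derivative \<psi> x) (at x)" for x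
  proof (cases "x < \<alpha>")
    case True
    have "(\<phi> has_vector_derivative 0) (at x)"
      by (rule has_vector_derivative_transform_within_open[of "\<lambda>_. 0" 0 x "{..<\<alpha>}"]) (use True left in auto)
    then show ?thesis using True supp(4)[of x] by simp
  next
    case False
    then have "(\<phi> has_vector_derivative \<psi> x) (at x within {a..x + 1})"
      unfolding \<phi>_def using supp by (intro integral_has_vector_derivative cont) auto
    moreover have "at x within {a..x + 1} = at x"
      using False supp by (intro at_within_interior) (auto simp: interior_atLeastAtMost_real)
    ultimately show ?thesis by simp
  qed
  have smooth: "smooth_on UNIV \<phi>"
    using \<psi> by (intro smooth_on_antiderivative[OF _ deriv]) (simp add: interval_test_def)
  then have "interval_test a b \<phi>"
    unfolding interval_test_def using supp left right
    by (intro conjI exI[of _ \<alpha>] exI[of _ \<beta>]) auto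
  then show "(\<lambda>x. integral {a..x} \<psi>) \<in> test_functions a b"
    unfolding \<phi>_def by (rule interval_test_function)
  show "derivative_of (\<lambda>x. integral {a..x} \<psi>) = \<psi>"
    using deriv unfolding \<phi>_def derivative_of_def by (auto intro: vector_derivative_at)
qed

text \<open>The derivative is approximated first; a multiple of a bump restores mean zero, so that the
  antiderivative has compact support.\<close>

lemma C1_approx_test:
  assumes "a < b" and u: "C1_on a b u v" "u a = 0" "u b = 0" and "0 < \<epsilon>"
  obtains \<phi> where "\<phi> \<in> test_functions a b" "norm_L2 a b (\<lambda>x. u x - \<phi> x) < \<epsilon>"
    "norm_L2 a b (\<lambda>x. v x - derivative_of \<phi> x) < \<epsilon>"
proof -
  note cont = C1_on_continuous[OF u(1)]
  define l where "l = b - a"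
  have l: "0 < l" using assms by (simp add: l_def)
  obtain \<beta> where \<beta>: "interval_test a b \<beta>" "integral {a..b} \<beta> \<noteq> 0"
    by (rule bump_integral_nonzero[OF assms(1)])
  \<comment> \<open>The factor by which subtracting the multiple of the bump enlarges the error in
    approximating \<open>v\<close>.\<close>
  define k where "k = 1 + sqrt l * norm_L2 a b \<beta> / norm (integral {a..b} \<beta>)"
  have k: "1 \<le> k" using l norm_L2_nonneg[of a b \<beta>] by (simp add: k_def)
  \<comment> \<open>The factor \<open>1 + l\<close> leaves room for the passage from
    \<open>v\<close> to \<open>u\<close>, which multiplies the error by at most
    \<open>l\<close>.\<close>
  define \<epsilon>1 where "\<epsilon>1 = \<epsilon> / (k * (1 + l))"
  have \<epsilon>1: "0 < \<epsilon>1" using k l \<open>0 < \<epsilon>\<close> by (simp add: \<epsilon>1_def)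
  obtain \<xi> where \<xi>: "interval_test a b \<xi>" "norm_L2 a b (\<lambda>x. v x - \<xi> x) < \<epsilon>1"
    by (rule continuous_approx_test[OF assms(1) cont(2) \<epsilon>1])
  define \<theta> where "\<theta> = norm_L2 a b (\<lambda>x. v x - \<xi> x)"
  define c where "c = integral {a..b} \<xi> / integral {a..b} \<beta>"
  define \<psi> where "\<psi> = (\<lambda>x. \<xi> x - c * \<beta> x)"
  have \<psi>: "interval_test a b \<psi>"
    unfolding \<psi>_def by (rule interval_test_lincomb[OF \<xi>(1) \<beta>(1)])
  have tc: "continuous_on {a..b} \<xi>" "continuous_on {a..b} \<beta>" "continuous_on {a..b} \<psi>"
    by (rule interval_test_cont, fact)+
  have "integral {a..b} \<psi> = integral {a..b} \<xi> - integral {a..b} (\<lambda>x. c * \<beta> x)"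
    unfolding \<psi>_def by (intro integral_diff integrable_continuous_real continuous_intros tc)
  then have int0: "integral {a..b} \<psi> = 0"
    using \<beta>(2) by (simp add: c_def)
  define \<phi> where "\<phi> = (\<lambda>x. integral {a..x} \<psi>)"
  note \<phi> = interval_test_antiderivative[OF \<psi> int0, folded \<phi>_def]
  have "integral {a..b} v = 0"
    using C1_on_FTC[OF u(1), of b] u assms(1) by simp
  then have "integral {a..b} (\<lambda>x. v x - \<xi> x) = - integral {a..b} \<xi>"
    by (subst integral_diff) (auto intro!: integrable_continuous_real cont tc)
  then have "norm (integral {a..b} \<xi>) \<le> sqrt l * \<theta>"
    using norm_integral_le_L2[OF assms(1), of "\<lambda>x. v x - \<xi> x" b] assms(1)
    by (simp add: l_def \<theta>_def continuous_intros cont tc)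
  then have "norm c \<le> sqrt l * \<theta> / norm (integral {a..b} \<beta>)"
    unfolding c_def norm_divide by (rule divide_right_mono) simp
  then have c_le: "norm c * norm_L2 a b \<beta> \<le> sqrt l * \<theta> / norm (integral {a..b} \<beta>) * norm_L2 a b \<beta>"
    by (intro mult_right_mono norm_L2_nonneg)
  have v\<psi>: "norm_L2 a b (\<lambda>x. v x - \<psi> x) < \<epsilon> / (1 + l)"
  proof -
    have "norm_L2 a b (\<lambda>x. v x - \<psi> x) = norm_L2 a b (\<lambda>x. (v x - \<xi> x) + c * \<beta> x)"
      by (simp add: \<psi>_def algebra_simps)
    also have "\<dots> \<le> \<theta> + norm_L2 a b (\<lambda>x. c * \<beta> x)"
      unfolding \<theta>_def by (intro norm_L2_triangle continuous_L2 continuous_intros cont tc)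
    also have "\<dots> \<le> \<theta> * k"
      using c_le unfolding norm_L2_scale by (simp add: k_def distrib_left mult_ac)
    also have "\<dots> < \<epsilon>1 * k"
      using \<xi>(2) k by (intro mult_strict_right_mono) (auto simp: \<theta>_def)
    also have "\<dots> = \<epsilon> / (1 + l)" using k by (simp add: \<epsilon>1_def)
    finally show ?thesis .
  qed
  have pt: "norm (u x - \<phi> x) \<le> sqrt l * norm_L2 a b (\<lambda>x. v x - \<psi> x)" if x: "x \<in> {a..b}" for x
  proof -
    have sub: "{a..x} \<subseteq> {a..b}" using x by auto
    have "u x - \<phi> x = integral {a..x} v - integral {a..x} \<psi>"
      using C1_on_FTC[OF u(1) x] u by (simp add: \<phi>_def)
    also have "\<dots> = integral {a..x} (\<lambda>t. v t - \<psi> t)"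
      by (intro integral_diff[symmetric] integrable_continuous_real continuous_on_subset[OF cont(2) sub] continuous_on_subset[OF tc(3) sub])
    finally show ?thesis
      using norm_integral_le_L2[OF assms(1), of "\<lambda>x. v x - \<psi> x" x] x
      by (simp add: l_def continuous_intros cont tc)
  qed
  have \<phi>_cont: "continuous_on {a..b} \<phi>"
    using C1_on_continuous(1)[OF test_function_C1(1)[OF \<phi>(1)]] .
  have "norm_L2 a b (\<lambda>x. u x - \<phi> x) \<le> sqrt l * norm_L2 a b (\<lambda>x. v x - \<psi> x) * sqrt (b - a)"
    using pt assms(1) l norm_L2_nonneg by (intro norm_L2_le continuous_L2 continuous_intros cont \<phi>_cont) auto
  also have "\<dots> = l * norm_L2 a b (\<lambda>x. v x - \<psi> x)"
    using l by (simp add: l_def mult_ac)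
  also have "\<dots> < l * (\<epsilon> / (1 + l))"
    using v\<psi> l by (intro mult_strict_left_mono)
  also have "\<dots> \<le> \<epsilon>" using l \<open>0 < \<epsilon>\<close> by (simp add: field_simps)
  finally have "norm_L2 a b (\<lambda>x. u x - \<phi> x) < \<epsilon>" .
  moreover have "norm_L2 a b (\<lambda>x. v x - derivative_of \<phi> x) < \<epsilon>"
  proof -
    have "\<epsilon> / (1 + l) \<le> \<epsilon>" using l \<open>0 < \<epsilon>\<close> by (simp add: field_simps)
    then show ?thesis using v\<psi> \<phi>(2) by simp
  qed
  ultimately show ?thesis using that \<phi>(1) by blast
qed

lemma C1_H10:
  assumes "a < b" "C1_on a b u v" "u a = 0" "u b = 0"
  shows "u \<in> H10 a b"
  unfolding H10_def
proof (intro CollectI exI conjI allI impI)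
  show "weak_deriv a b u v" by (rule weak_deriv_C1[OF assms(1,2)])
  fix \<epsilon> :: real assume \<epsilon>: "\<epsilon> > 0"
  obtain \<phi> where \<phi>: "\<phi> \<in> test_functions a b" "norm_L2 a b (\<lambda>x. u x - \<phi> x) < \<epsilon> / 2"
    "norm_L2 a b (\<lambda>x. v x - derivative_of \<phi> x) < \<epsilon> / 2"
    by (rule C1_approx_test[OF assms, of "\<epsilon> / 2"]) (use \<epsilon> in auto)
  have "sqrt ((norm_L2 a b (\<lambda>x. u x - \<phi> x))\<^sup>2 + (norm_L2 a b (\<lambda>x. v x - derivative_of \<phi> x))\<^sup>2)
      \<le> norm_L2 a b (\<lambda>x. u x - \<phi> x) + norm_L2 a b (\<lambda>x. v x - derivative_of \<phi> x)"
    by (rule sqrt_sum_squares_le_sum[OF norm_L2_nonneg norm_L2_nonneg])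
  then show "\<exists>\<phi>\<in>test_functions a b. sqrt ((norm_L2 a b (\<lambda>x. u x - \<phi> x))\<^sup>2 +
      (norm_L2 a b (\<lambda>x. v x - derivative_of \<phi> x))\<^sup>2) < \<epsilon>"
    using \<phi> by (intro bexI[of _ \<phi>]) auto
qed

subsection \<open>The spectrum consists of the Dirichlet eigenvalues\<close>

text \<open>Bilinear, without a conjugate: for this pairing the operator with potential
  \<open>\<i> * V\<close> is symmetric, so the transposed problem is the same equation.\<close>

definition pairing :: "real \<Rightarrow> real \<Rightarrow> (real \<Rightarrow> complex) \<Rightarrow> (real \<Rightarrow> complex) \<Rightarrow> complex" where
  "pairing a b f g = (LINT x|lebesgue_on {a<..<b}. f x * g x)"

lemma pairing_bound: "f \<in> L2 a b \<Longrightarrow> g \<in> L2 a b \<Longrightarrow> norm (pairing a b f g) \<le> norm_L2 a b f * norm_L2 a b g"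
  unfolding pairing_def by (rule L2_cauchy_schwarz)

lemma pairing_diff_left:
  assumes "f \<in> L2 a b" "f' \<in> L2 a b" "g \<in> L2 a b"
  shows "pairing a b (\<lambda>x. f x - f' x) g = pairing a b f g - pairing a b f' g"
  unfolding pairing_def left_diff_distrib
  by (intro Bochner_Integration.integral_diff L2_mult_integrable assms)

lemma pairing_diff_right:
  assumes "f \<in> L2 a b" "g \<in> L2 a b" "g' \<in> L2 a b"
  shows "pairing a b f (\<lambda>x. g x - g' x) = pairing a b f g - pairing a b f g'"
  unfolding pairing_def right_diff_distrib
  by (intro Bochner_Integration.integral_diff L2_mult_integrable assms)

lemma pairing_add_left:
  assumes "f \<in> L2 a b" "f' \<in> L2 a b" "g \<in> L2 a b"
  shows "pairing a b (\<lambda>x. f x + f' x) g = pairing a b f g + pairing a b f' g"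
  unfolding pairing_def distrib_right
  by (intro Bochner_Integration.integral_add L2_mult_integrable assms)

lemma pairing_add_right:
  assumes "f \<in> L2 a b" "g \<in> L2 a b" "g' \<in> L2 a b"
  shows "pairing a b f (\<lambda>x. g x + g' x) = pairing a b f g + pairing a b f g'"
  unfolding pairing_def distrib_left
  by (intro Bochner_Integration.integral_add L2_mult_integrable assms)

lemma pairing_commute: "pairing a b f g = pairing a b g f"
  by (simp add: pairing_def mult.commute)

lemma pairing_scale: "pairing a b (\<lambda>x. c * f x) g = c * pairing a b f g"
  "pairing a b f (\<lambda>x. c * g x) = c * pairing a b f g"
  by (simp_all add: pairing_def mult.assoc mult.left_commute)

lemma weak_derivD:
  assumes "weak_deriv a b u v"
  shows "u \<in> L2 a b" "v \<in> L2 a b"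
    "\<phi> \<in> test_functions a b \<Longrightarrow> pairing a b u (derivative_of \<phi>) = - pairing a b v \<phi>"
  using assms by (auto simp: weak_deriv_def pairing_def)

lemma test_functions_L2:
  assumes "\<phi> \<in> test_functions a b"
  shows "\<phi> \<in> L2 a b" "derivative_of \<phi> \<in> L2 a b"
  using C1_on_continuous[OF test_function_C1(1)[OF assms]] by (auto intro: continuous_L2)

lemma zero_of_small:
  fixes x :: complex
  assumes "\<And>\<epsilon>. 0 < \<epsilon> \<Longrightarrow> norm x \<le> K * \<epsilon>" and "0 \<le> K"
  shows "x = 0"
proof -
  have "norm x \<le> 0 + e" if "0 < e" for e
  proof -
    have "norm x \<le> K * (e / (K + 1))" using that assms(2) by (intro assms(1)) simp
    also have "\<dots> \<le> e" using that assms(2) by (simp add: field_simps)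
    finally show ?thesis by simp
  qed
  then have "norm x \<le> 0" by (rule field_le_epsilon)
  then show ?thesis by simp
qed

text \<open>Both derivatives are moved by density. The Dirichlet condition of \<open>\<psi>\<close>
  enters through \<open>C1_approx_test\<close>, that of \<open>u\<close> through the approximating
  test functions in \<open>H10\<close>.\<close>

lemma second_derivative_symmetric:
  assumes "a < b" and u: "u \<in> H10 a b" and v: "weak_deriv a b u v" and w: "weak_deriv a b v w"
    and \<psi>: "C1_on a b \<psi> \<psi>'" "\<psi> a = 0" "\<psi> b = 0" and \<psi>'': "weak_deriv a b \<psi>' \<psi>''"
  shows "pairing a b w \<psi> = pairing a b u \<psi>''"
proof -
  note \<psi>_cont = C1_on_continuous[OF \<psi>(1)]
  have L2: "u \<in> L2 a b" "v \<in> L2 a b" "w \<in> L2 a b" "\<psi> \<in> L2 a b" "\<psi>' \<in> L2 a b" "\<psi>'' \<in> L2 a b"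
    using weak_derivD(1,2) v w \<psi>'' \<psi>_cont by (blast intro: continuous_L2)+
  obtain v0 where v0: "weak_deriv a b u v0" and approx: "\<And>\<epsilon>. \<epsilon> > 0 \<Longrightarrow> \<exists>\<phi>\<in>test_functions a b.
      sqrt ((norm_L2 a b (\<lambda>x. u x - \<phi> x))\<^sup>2 + (norm_L2 a b (\<lambda>x. v0 x - derivative_of \<phi> x))\<^sup>2) < \<epsilon>"
    using u unfolding H10_def by blast
  note v0_L2 = weak_derivD(2)[OF v0]
  have "pairing a b w \<psi> + pairing a b v \<psi>' = 0"
  proof (rule zero_of_small)
    fix \<epsilon> :: real assume "0 < \<epsilon>"
    then obtain \<phi> where \<phi>: "\<phi> \<in> test_functions a b" "norm_L2 a b (\<lambda>x. \<psi> x - \<phi> x) < \<epsilon>"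
      "norm_L2 a b (\<lambda>x. \<psi>' x - derivative_of \<phi> x) < \<epsilon>"
      using C1_approx_test[OF assms(1) \<psi>] by blast
    note \<phi>_L2 = test_functions_L2[OF \<phi>(1)]
    have "pairing a b w \<psi> + pairing a b v \<psi>' =
        pairing a b w (\<lambda>x. \<psi> x - \<phi> x) + pairing a b v (\<lambda>x. \<psi>' x - derivative_of \<phi> x)"
      using weak_derivD(3)[OF w \<phi>(1)] by (simp add: pairing_diff_right L2 \<phi>_L2)
    also have "norm \<dots> \<le> norm_L2 a b w * norm_L2 a b (\<lambda>x. \<psi> x - \<phi> x) + norm_L2 a b v * norm_L2 a b (\<lambda>x. \<psi>' x - derivative_of \<phi> x)"
      by (intro norm_triangle_mono pairing_bound L2 \<phi>_L2 L2_diff)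
    also have "\<dots> \<le> norm_L2 a b w * \<epsilon> + norm_L2 a b v * \<epsilon>"
      using \<phi> by (intro add_mono mult_left_mono norm_L2_nonneg) auto
    finally show "norm (pairing a b w \<psi> + pairing a b v \<psi>') \<le> (norm_L2 a b w + norm_L2 a b v) * \<epsilon>"
      by (simp add: distrib_right)
  qed (simp add: norm_L2_nonneg)
  \<comment> \<open>\<open>H10\<close> supplies its own weak derivative \<open>v0\<close>; it is
    compared with \<open>v\<close> through the pairing with \<open>\<psi>'\<close>, by density of
    test functions.\<close>
  moreover have "pairing a b v \<psi>' - pairing a b v0 \<psi>' = 0"
  proof (rule zero_of_small)
    fix \<epsilon> :: real assume "0 < \<epsilon>"
    then obtain \<phi> where \<phi>: "interval_test a b \<phi>" "norm_L2 a b (\<lambda>x. \<psi>' x - \<phi> x) < \<epsilon>"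
      using continuous_approx_test[OF assms(1) \<psi>_cont(2)] by blast
    note \<phi>t = interval_test_function[OF \<phi>(1)]
    note \<phi>_L2 = test_functions_L2[OF \<phi>t]
    have "pairing a b v \<phi> = pairing a b v0 \<phi>"
      using weak_derivD(3)[OF v \<phi>t] weak_derivD(3)[OF v0 \<phi>t] by simp
    then have "pairing a b v \<psi>' - pairing a b v0 \<psi>' = pairing a b (\<lambda>x. v x - v0 x) (\<lambda>x. \<psi>' x - \<phi> x)"
      by (simp add: pairing_diff_left pairing_diff_right L2 \<phi>_L2 v0_L2 L2_diff)
    also have "norm \<dots> \<le> norm_L2 a b (\<lambda>x. v x - v0 x) * norm_L2 a b (\<lambda>x. \<psi>' x - \<phi> x)"
      by (intro pairing_bound L2 \<phi>_L2 L2_diff v0_L2)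
    also have "\<dots> \<le> norm_L2 a b (\<lambda>x. v x - v0 x) * \<epsilon>"
      using \<phi> by (intro mult_left_mono norm_L2_nonneg) auto
    finally show "norm (pairing a b v \<psi>' - pairing a b v0 \<psi>') \<le> norm_L2 a b (\<lambda>x. v x - v0 x) * \<epsilon>" .
  qed (simp add: norm_L2_nonneg)
  moreover have "pairing a b v0 \<psi>' + pairing a b u \<psi>'' = 0"
  proof (rule zero_of_small)
    fix \<epsilon> :: real assume "0 < \<epsilon>"
    then obtain \<phi> where \<phi>: "\<phi> \<in> test_functions a b"
      "sqrt ((norm_L2 a b (\<lambda>x. u x - \<phi> x))\<^sup>2 + (norm_L2 a b (\<lambda>x. v0 x - derivative_of \<phi> x))\<^sup>2) < \<epsilon>"
      using approx by blast
    note \<phi>_L2 = test_functions_L2[OF \<phi>(1)]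
    have small: "norm_L2 a b (\<lambda>x. u x - \<phi> x) \<le> \<epsilon>" "norm_L2 a b (\<lambda>x. v0 x - derivative_of \<phi> x) \<le> \<epsilon>"
      using \<phi>(2) real_sqrt_sum_squares_ge1[of "norm_L2 a b (\<lambda>x. u x - \<phi> x)" "norm_L2 a b (\<lambda>x. v0 x - derivative_of \<phi> x)"]
        real_sqrt_sum_squares_ge2[of "norm_L2 a b (\<lambda>x. v0 x - derivative_of \<phi> x)" "norm_L2 a b (\<lambda>x. u x - \<phi> x)"]
      by linarith+
    have "pairing a b (derivative_of \<phi>) \<psi>' = - pairing a b \<phi> \<psi>''"
      using weak_derivD(3)[OF \<psi>'' \<phi>(1)] by (simp add: pairing_commute)
    then have "pairing a b v0 \<psi>' + pairing a b u \<psi>'' =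
        pairing a b (\<lambda>x. v0 x - derivative_of \<phi> x) \<psi>' + pairing a b (\<lambda>x. u x - \<phi> x) \<psi>''"
      by (simp add: pairing_diff_left L2 \<phi>_L2 v0_L2)
    also have "norm \<dots> \<le> norm_L2 a b (\<lambda>x. v0 x - derivative_of \<phi> x) * norm_L2 a b \<psi>' + norm_L2 a b (\<lambda>x. u x - \<phi> x) * norm_L2 a b \<psi>''"
      by (intro norm_triangle_mono pairing_bound L2 \<phi>_L2 L2_diff v0_L2)
    also have "\<dots> \<le> \<epsilon> * norm_L2 a b \<psi>' + \<epsilon> * norm_L2 a b \<psi>''"
      using small by (intro add_mono mult_right_mono norm_L2_nonneg) auto
    finally show "norm (pairing a b v0 \<psi>' + pairing a b u \<psi>'') \<le> (norm_L2 a b \<psi>' + norm_L2 a b \<psi>'') * \<epsilon>"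
      by (simp add: algebra_simps)
  qed (simp add: norm_L2_nonneg)
  ultimately show ?thesis
    by (simp add: eq_neg_iff_add_eq_0 algebra_simps) (metis add.commute add_left_cancel)
qed

lemma L2_mult_continuous:
  assumes f: "f \<in> L2 a b" and y: "continuous_on {a..b} y"
  shows "(\<lambda>x. y x * f x) \<in> L2 a b"
proof -
  obtain K where K: "K > 0" "\<And>x. x \<in> {a..b} \<Longrightarrow> norm (y x) \<le> K"
    using compact_imp_bounded[OF compact_continuous_image[OF y compact_Icc]]
    unfolding bounded_pos by blast
  note [measurable] = L2_measurable[OF f] L2_measurable[OF continuous_L2[OF y]]
  have "integrable (lebesgue_on {a<..<b}) (\<lambda>x. K\<^sup>2 * (norm (f x))\<^sup>2)"
    by (intro integrable_mult_right L2_integrable_sq f)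
  then have "integrable (lebesgue_on {a<..<b}) (\<lambda>x. (norm (y x * f x))\<^sup>2)"
  proof (rule Bochner_Integration.integrable_bound)
    show "AE x in lebesgue_on {a<..<b}. norm ((norm (y x * f x))\<^sup>2) \<le> norm (K\<^sup>2 * (norm (f x))\<^sup>2)"
      using K by (intro AE_I2) (auto simp: norm_mult power_mult_distrib intro!: mult_right_mono power_mono)
  qed measurable
  then show ?thesis by (simp add: L2_def)
qed

lemma norm_integral_mult_le:
  assumes "f \<in> L2 a b" "g \<in> L2 a b" "x \<in> {a..b}"
  shows "norm (integral {a..x} (\<lambda>t. f t * g t)) \<le> norm_L2 a b f * norm_L2 a b g"
proof -
  have nL2: "(\<lambda>t. complex_of_real (norm (h t))) \<in> L2 a b" "norm_L2 a b (\<lambda>t. complex_of_real (norm (h t))) = norm_L2 a b h"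
    if h: "h \<in> L2 a b" for h
  proof -
    note [measurable] = L2_measurable[OF h]
    show "(\<lambda>t. complex_of_real (norm (h t))) \<in> L2 a b"
      using L2_integrable_sq[OF h] by (simp add: L2_def)
  qed (simp add: norm_L2_def)
  have "integrable (lebesgue_on {a<..<b}) (\<lambda>t. f t * g t)"
    by (intro L2_mult_integrable assms)
  then have "(\<lambda>t. f t * g t) absolutely_integrable_on {a<..<b}"
    by (simp add: set_integrable_def integrable_restrict_space)
  then have abs: "(\<lambda>t. f t * g t) integrable_on {a..b}" "(\<lambda>t. norm (f t * g t)) integrable_on {a..b}"
    by (simp_all add: absolutely_integrable_on_def integrable_on_open_interval_real)
  have sub: "{a..x} \<subseteq> {a..b}" using assms by auto
  have "norm (integral {a..x} (\<lambda>t. f t * g t)) \<le> integral {a..x} (\<lambda>t. norm (f t * g t))"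
    by (intro integral_norm_bound_integral integrable_on_subinterval[OF abs(1) sub] integrable_on_subinterval[OF abs(2) sub]) auto
  also have "\<dots> \<le> integral {a..b} (\<lambda>t. norm (f t * g t))"
    by (intro integral_subset_le sub abs integrable_on_subinterval[OF abs(2) sub]) auto
  also have "\<dots> = (LINT t|lebesgue_on {a<..<b}. norm (f t * g t))"
    using integrable_norm[OF \<open>integrable (lebesgue_on {a<..<b}) (\<lambda>t. f t * g t)\<close>]
    by (subst lebesgue_integral_eq_integral) (auto simp: integral_open_interval_real)
  also have "\<dots> = norm (complex_of_real (LINT t|lebesgue_on {a<..<b}. norm (f t * g t)))"
    by (simp add: Bochner_Integration.integral_nonneg)
  also have "complex_of_real (LINT t|lebesgue_on {a<..<b}. norm (f t * g t)) =
      (LINT t|lebesgue_on {a<..<b}. of_real (norm (f t)) * of_real (norm (g t)))"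
    by (simp add: norm_mult flip: integral_complex_of_real)
  also have "norm \<dots> \<le> norm_L2 a b f * norm_L2 a b g"
    using L2_cauchy_schwarz[OF nL2(1)[OF assms(1)] nL2(1)[OF assms(2)]] nL2(2)[OF assms(1)] nL2(2)[OF assms(2)] by simp
  finally show ?thesis .
qed

lemma C1_on_ode_sol:
  assumes "ode_sol a b q y y'" "continuous_on {a..b} q"
  shows "C1_on a b y y'" "C1_on a b y' (\<lambda>x. q x * y x)"
  using assms ode_sol_continuous[OF assms(1)] unfolding C1_on_def ode_sol_def
  by (auto intro: continuous_intros)

lemma C1_on_eq_integral:
  assumes v: "continuous_on {a..b} v" and u: "\<And>x. x \<in> {a..b} \<Longrightarrow> u x = c + integral {a..x} v"
  shows "C1_on a b u v"
proof -
  have "(u has_vector_derivative v x) (at x within {a..b})" if x: "x \<in> {a..b}" for x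
    by (rule has_vector_derivative_transform[OF x u]) (use C1_on_integral[OF v, of c] x in \<open>auto simp: C1_on_def\<close>)
  then show ?thesis using v by (simp add: C1_on_def)
qed

text \<open>Green's function \<open>\<kappa> y\<^sub>1(min x t) y\<^sub>2(max x t)\<close>; the terms in which the integration
  bounds are differentiated cancel in \<open>U'\<close>, so \<open>U\<close> is continuously differentiable.\<close>

lemma green_operator:
  fixes V :: "real \<Rightarrow> real"
  assumes "a < b" and V: "continuous_on {a..b} V" and "0 < h"
    and no_ev: "\<not> dirichlet_eigenvalue a b V (h\<^sup>2) z"
  obtains C where "0 \<le> C"
    "\<And>\<rho>. \<rho> \<in> L2 a b \<Longrightarrow> \<exists>U U' w. C1_on a b U U' \<and> U a = 0 \<and> U b = 0 \<and> weak_deriv a b U' w \<and>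
       (\<forall>x. - (of_real h)\<^sup>2 * w x + (\<i> * V x - z) * U x = \<rho> x) \<and> norm_L2 a b U \<le> C * norm_L2 a b \<rho>"
proof -
  define q where "q = (\<lambda>x. (\<i> * V x - z) / of_real (h\<^sup>2))"
  have q_cont: "continuous_on {a..b} q"
    unfolding q_def divide_inverse by (intro continuous_intros V)
  obtain y1 y1' where y1: "ode_sol a b q y1 y1'" "y1 a = 0" "y1' a = 1"
    using ode_sol_exists[OF less_imp_le[OF assms(1)] q_cont, of 0 1] by blast
  have "continuous_on {a..b} (\<lambda>x. q (a + b - x))"
    by (rule continuous_on_compose2[OF q_cont]) (auto intro!: continuous_intros)
  from ode_sol_exists[OF less_imp_le[OF assms(1)] this, of 0 1]
  obtain r r' where r: "ode_sol a b (\<lambda>x. q (a + b - x)) r r'" "r a = 0" "r' a = 1" by blast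
  \<comment> \<open>Shooting from \<open>b\<close>, obtained by shooting from \<open>a\<close> for
    the reversed potential.\<close>
  define y2 where "y2 = (\<lambda>x. r (a + b - x))"
  define y2' where "y2' = (\<lambda>x. - r' (a + b - x))"
  have y2: "ode_sol a b q y2 y2'" "y2 b = 0" "y2' b = - 1"
    using ode_sol_reverse[OF r(1)] r by (simp_all add: y2_def y2'_def)
  have y1b: "y1 b \<noteq> 0"
    using no_ev y1 unfolding dirichlet_eigenvalue_def q_def by (metis zero_neq_one)
  \<comment> \<open>The constant Wronskian, evaluated at \<open>b\<close> from
    \<open>y2 b = 0\<close> and \<open>y2' b = - 1\<close>; it is nonzero since \<open>z\<close> is
    not an eigenvalue.\<close>
  define \<omega> where "\<omega> = - y1 b"
  have \<omega>: "y1 x * y2' x - y1' x * y2 x = \<omega>" if x: "x \<in> {a..b}" for x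
  proof -
    have const: "y1 x * y2' x - y1' x * y2 x = y1 a * y2' a - y1' a * y2 a" if "x \<in> {a..b}" for x
    proof -
      have "((\<lambda>_. 0) has_integral (y1 x * y2' x - y1' x * y2 x) - (y1 a * y2' a - y1' a * y2 a)) {a..x}"
        using ode_sol_wronskian[OF y1(1) y2(1), of x] that by simp
      then show ?thesis using has_integral_0 has_integral_unique by fastforce
    qed
    show ?thesis using const[OF x] const[of b] assms(1) y2 by (simp add: \<omega>_def)
  qed
  \<comment> \<open>Normalised so that \<open>- h\<^sup>2 * \<kappa> * \<omega> = 1\<close>, the
    coefficient of \<open>\<rho>\<close> in the equation.\<close>
  define \<kappa> where "\<kappa> = - 1 / (of_real (h\<^sup>2) * \<omega>)"
  note C1 = C1_on_ode_sol[OF y1(1) q_cont] C1_on_ode_sol[OF y2(1) q_cont]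
  note cont = C1_on_continuous[OF C1(1)] C1_on_continuous[OF C1(2)] C1_on_continuous[OF C1(3)] C1_on_continuous[OF C1(4)]
  obtain K where K: "K > 0" "\<And>x. x \<in> {a..b} \<Longrightarrow> norm (y1 x) \<le> K"
    using compact_imp_bounded[OF compact_continuous_image[OF cont(1) compact_Icc]]
    unfolding bounded_pos by blast
  obtain K2 where K2: "K2 > 0" "\<And>x. x \<in> {a..b} \<Longrightarrow> norm (y2 x) \<le> K2"
    using compact_imp_bounded[OF compact_continuous_image[OF cont(5) compact_Icc]]
    unfolding bounded_pos by blast
  define N1 where "N1 = norm_L2 a b y1"
  define N2 where "N2 = norm_L2 a b y2"
  have N: "0 \<le> N1" "0 \<le> N2" by (simp_all add: N1_def N2_def norm_L2_nonneg)
  define C where "C = norm \<kappa> * (K2 * N1 + K * (2 * N2)) * sqrt (b - a)"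
  have C: "0 \<le> C" using N K K2 assms(1) by (simp add: C_def)
  have "\<exists>U U' w. C1_on a b U U' \<and> U a = 0 \<and> U b = 0 \<and> weak_deriv a b U' w \<and>
       (\<forall>x. - (of_real h)\<^sup>2 * w x + (\<i> * V x - z) * U x = \<rho> x) \<and> norm_L2 a b U \<le> C * norm_L2 a b \<rho>"
    if \<rho>: "\<rho> \<in> L2 a b" for \<rho>
  proof -
    have L2s: "(\<lambda>t. y1 t * \<rho> t) \<in> L2 a b" "(\<lambda>t. y2 t * \<rho> t) \<in> L2 a b"
      by (intro L2_mult_continuous \<rho> cont)+
    note ai = L2_absolutely_integrable[OF L2s(1)] L2_absolutely_integrable[OF L2s(2)]
    define A1 where "A1 = (\<lambda>x. integral {a..x} (\<lambda>t. y1 t * \<rho> t))"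
    define A2 where "A2 = (\<lambda>x. integral {a..x} (\<lambda>t. y2 t * \<rho> t))"
    have A_cont: "continuous_on {a..b} A1" "continuous_on {a..b} A2"
      unfolding A1_def A2_def
      by (intro indefinite_integral_continuous_1 set_lebesgue_integral_eq_integral(1) ai)+
    define U where "U = (\<lambda>x. \<kappa> * (y2 x * A1 x + y1 x * (A2 b - A2 x)))"
    define U' where "U' = (\<lambda>x. \<kappa> * (y2' x * A1 x + y1' x * (A2 b - A2 x)))"
    \<comment> \<open>The weak second derivative of \<open>U\<close>; the factor
      \<open>\<kappa> * \<omega>\<close> is the jump in the slope of Green's function.\<close>
    define w where "w = (\<lambda>x. q x * U x + \<kappa> * \<omega> * \<rho> x)"
    have U_cont: "continuous_on {a..b} U" "continuous_on {a..b} U'"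
      unfolding U_def U'_def by (intro continuous_intros A_cont cont)+
    have w_L2: "w \<in> L2 a b"
      unfolding w_def by (intro L2_add L2_scale \<rho> continuous_L2 continuous_intros q_cont U_cont)
    text \<open>Integration by parts for a general pair, so that it applies to \<open>y\<^sub>i\<close> and to \<open>y\<^sub>i'\<close>.\<close>
    have parts: "\<eta>2 x * A1 x + \<eta>1 x * (A2 b - A2 x) = \<eta>1 a * A2 b +
        integral {a..x} (\<lambda>t. \<theta>2 t * A1 t + \<theta>1 t * (A2 b - A2 t) + (\<eta>2 t * y1 t - \<eta>1 t * y2 t) * \<rho> t)"
      if \<eta>: "C1_on a b \<eta>1 \<theta>1" "C1_on a b \<eta>2 \<theta>2" and x: "x \<in> {a..b}" for \<eta>1 \<eta>2 \<theta>1 \<theta>2 x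
    proof -
      have sub: "{a..x} \<subseteq> {a..b}" using x by auto
      note \<eta>c = C1_on_continuous[OF \<eta>(1)] C1_on_continuous[OF \<eta>(2)]
      have i\<rho>: "(\<lambda>t. y t * \<rho> t) integrable_on {a..x}" if "continuous_on {a..b} y" for y
        using set_lebesgue_integral_eq_integral(1)[OF L2_absolutely_integrable[OF L2_mult_continuous[OF \<rho> that]]]
          integrable_on_subinterval sub by blast
      have ic: "f integrable_on {a..x}" if "continuous_on {a..b} f" for f :: "real \<Rightarrow> complex"
        by (rule integrable_continuous_real[OF continuous_on_subset[OF that sub]])
      have p1: "\<eta>2 x * A1 x = integral {a..x} (\<lambda>t. \<theta>2 t * A1 t + \<eta>2 t * (y1 t * \<rho> t))"
        unfolding A1_def by (rule integration_by_parts_L1[OF assms(1) ai(1) \<eta>(2) x])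
      have p2: "\<eta>1 x * A2 x = integral {a..x} (\<lambda>t. \<theta>1 t * A2 t + \<eta>1 t * (y2 t * \<rho> t))"
        unfolding A2_def by (rule integration_by_parts_L1[OF assms(1) ai(2) \<eta>(1) x])
      have p3: "\<eta>1 x * A2 b = \<eta>1 a * A2 b + integral {a..x} (\<lambda>t. \<theta>1 t * A2 b)"
        using C1_on_FTC[OF \<eta>(1) x] by (simp add: distrib_right)
      have j1: "(\<lambda>t. \<theta>2 t * A1 t + \<eta>2 t * (y1 t * \<rho> t)) integrable_on {a..x}"
        unfolding mult.assoc[symmetric] by (intro integrable_add ic i\<rho> continuous_intros \<eta>c A_cont cont)
      have j2: "(\<lambda>t. \<theta>1 t * A2 t + \<eta>1 t * (y2 t * \<rho> t)) integrable_on {a..x}"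
        unfolding mult.assoc[symmetric] by (intro integrable_add ic i\<rho> continuous_intros \<eta>c A_cont cont)
      have j3: "(\<lambda>t. \<theta>1 t * A2 b) integrable_on {a..x}"
        by (intro ic continuous_intros \<eta>c)
      have "\<eta>2 x * A1 x + \<eta>1 x * (A2 b - A2 x) = \<eta>1 a * A2 b +
          (integral {a..x} (\<lambda>t. \<theta>2 t * A1 t + \<eta>2 t * (y1 t * \<rho> t)) + integral {a..x} (\<lambda>t. \<theta>1 t * A2 b)
           - integral {a..x} (\<lambda>t. \<theta>1 t * A2 t + \<eta>1 t * (y2 t * \<rho> t)))"
        unfolding p1[symmetric] p2[symmetric] using p3 by (simp add: algebra_simps)
      also have "integral {a..x} (\<lambda>t. \<theta>2 t * A1 t + \<eta>2 t * (y1 t * \<rho> t)) + integral {a..x} (\<lambda>t. \<theta>1 t * A2 b)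
           - integral {a..x} (\<lambda>t. \<theta>1 t * A2 t + \<eta>1 t * (y2 t * \<rho> t)) =
          integral {a..x} (\<lambda>t. \<theta>2 t * A1 t + \<eta>2 t * (y1 t * \<rho> t) + \<theta>1 t * A2 b - (\<theta>1 t * A2 t + \<eta>1 t * (y2 t * \<rho> t)))"
        by (simp add: integral_diff[OF integrable_add[OF j1 j3] j2] integral_add[OF j1 j3])
      also have "(\<lambda>t. \<theta>2 t * A1 t + \<eta>2 t * (y1 t * \<rho> t) + \<theta>1 t * A2 b - (\<theta>1 t * A2 t + \<eta>1 t * (y2 t * \<rho> t)))
          = (\<lambda>t. \<theta>2 t * A1 t + \<theta>1 t * (A2 b - A2 t) + (\<eta>2 t * y1 t - \<eta>1 t * y2 t) * \<rho> t)"
        by (auto simp: algebra_simps)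
      finally show ?thesis .
    qed
    have "U x = 0 + integral {a..x} U'" if x: "x \<in> {a..b}" for x
    proof -
      have "U x = \<kappa> * integral {a..x} (\<lambda>t. y2' t * A1 t + y1' t * (A2 b - A2 t))"
        using parts[OF C1(1) C1(3) x] y1 by (simp add: U_def mult.commute)
      then show ?thesis by (simp add: U'_def)
    qed
    then have "C1_on a b U U'" by (rule C1_on_eq_integral[OF U_cont(2)])
    moreover have "U' x = \<kappa> * (y1' a * A2 b) + integral {a..x} w" if x: "x \<in> {a..b}" for x
    proof -
      have "U' x = \<kappa> * (y1' a * A2 b + integral {a..x} (\<lambda>t. q t * y2 t * A1 t + q t * y1 t * (A2 b - A2 t)
          + (y2' t * y1 t - y1' t * y2 t) * \<rho> t))"
        using parts[OF C1(2) C1(4) x] by (simp add: U'_def)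
      also have "integral {a..x} (\<lambda>t. q t * y2 t * A1 t + q t * y1 t * (A2 b - A2 t) + (y2' t * y1 t - y1' t * y2 t) * \<rho> t)
          = integral {a..x} (\<lambda>t. q t * (y2 t * A1 t + y1 t * (A2 b - A2 t)) + \<omega> * \<rho> t)"
        by (intro integral_cong) (use \<omega> x in \<open>auto simp: algebra_simps\<close>)
      also have "\<kappa> * (y1' a * A2 b + \<dots>) = \<kappa> * (y1' a * A2 b) + integral {a..x} w"
        by (simp add: w_def U_def distrib_left flip: integral_mult_right) (simp add: mult_ac)
      finally show ?thesis .
    qed
    then have "weak_deriv a b U' w" by (rule weak_deriv_integral[OF assms(1) w_L2])
    moreover have "U a = 0" "U b = 0"
      using y1 y2 by (simp_all add: U_def A1_def)
    moreover have "- (of_real h)\<^sup>2 * w x + (\<i> * V x - z) * U x = \<rho> x" for x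
      using \<open>0 < h\<close> y1b by (simp add: w_def q_def \<kappa>_def \<omega>_def field_simps)
    moreover have "norm_L2 a b U \<le> C * norm_L2 a b \<rho>"
    proof -
      have "norm (U x) \<le> norm \<kappa> * (K2 * N1 + K * (2 * N2)) * norm_L2 a b \<rho>" if x: "x \<in> {a..b}" for x
      proof -
        have a1: "norm (A1 x) \<le> N1 * norm_L2 a b \<rho>" and a2: "norm (A2 x) \<le> N2 * norm_L2 a b \<rho>"
          unfolding A1_def A2_def N1_def N2_def by (intro norm_integral_mult_le continuous_L2 cont \<rho> x)+
        have "norm (A2 b) \<le> N2 * norm_L2 a b \<rho>"
          unfolding A2_def N2_def using assms(1) by (intro norm_integral_mult_le continuous_L2 cont \<rho>) auto
        then have a3: "norm (A2 b - A2 x) \<le> 2 * N2 * norm_L2 a b \<rho>"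
          using norm_triangle_ineq4[of "A2 b" "A2 x"] a2 by simp
        have "norm (y2 x * A1 x + y1 x * (A2 b - A2 x)) \<le> K2 * (N1 * norm_L2 a b \<rho>) + K * (2 * N2 * norm_L2 a b \<rho>)"
          using K K2 x a1 a3
          by (intro norm_triangle_mono) (auto simp: norm_mult intro!: mult_mono)
        then have "norm \<kappa> * norm (y2 x * A1 x + y1 x * (A2 b - A2 x)) \<le> norm \<kappa> * (K2 * (N1 * norm_L2 a b \<rho>) + K * (2 * N2 * norm_L2 a b \<rho>))"
          by (intro mult_left_mono) auto
        then show ?thesis unfolding U_def norm_mult[of \<kappa>] by (simp add: algebra_simps)
      qed
      then have "norm_L2 a b U \<le> norm \<kappa> * (K2 * N1 + K * (2 * N2)) * norm_L2 a b \<rho> * sqrt (b - a)"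
        using assms(1) N K K2 norm_L2_nonneg by (intro norm_L2_le continuous_L2 U_cont) auto
      then show ?thesis by (simp add: C_def mult_ac)
    qed
    ultimately show ?thesis by blast
  qed
  then show ?thesis using that C by blast
qed

text \<open>The eigenfunction lies in the domain and breaks injectivity.\<close>

lemma eigenvalue_in_spectrum:
  fixes V :: "real \<Rightarrow> real"
  assumes "a < b" and V: "continuous_on {a..b} V" and "0 < h"
    and ev: "dirichlet_eigenvalue a b V (h\<^sup>2) z"
  shows "z \<in> spectrum_of a b (schrodinger_op a b V h)"
proof -
  define q where "q = (\<lambda>x. (\<i> * V x - z) / of_real (h\<^sup>2))"
  have q_cont: "continuous_on {a..b} q"
    unfolding q_def divide_inverse by (intro continuous_intros V)
  obtain u u' where u: "ode_sol a b q u u'" "u a = 0" "u b = 0" "u' a \<noteq> 0"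
    using ev by (auto simp: dirichlet_eigenvalue_def q_def)
  note C1 = C1_on_ode_sol[OF u(1) q_cont]
  note cont = C1_on_continuous[OF C1(1)]
  have wd: "weak_deriv a b u u'" "weak_deriv a b u' (\<lambda>x. q x * u x)"
    by (rule weak_deriv_C1[OF assms(1)], rule C1)+
  have "(u, \<lambda>x. z * u x) \<in> schrodinger_op a b V h"
    unfolding schrodinger_op_def
  proof (intro CollectI case_prodI conjI exI AE_I2)
    show "u \<in> H10 a b \<inter> H2 a b"
      using C1_H10[OF assms(1) C1(1) u(2,3)] wd by (auto simp: H2_def H1_def)
    show "(\<lambda>x. z * u x) \<in> L2 a b"
      by (intro L2_scale continuous_L2 cont)
    show "z * u x = - (complex_of_real h)\<^sup>2 * (q x * u x) + \<i> * complex_of_real (V x) * u x" for x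
      using \<open>0 < h\<close> by (simp add: q_def field_simps)
  qed (rule wd)+
  \<comment> \<open>A continuous function that is zero almost everywhere is zero identically, which
    contradicts \<open>u' a \<noteq> 0\<close>.\<close>
  moreover have "\<not> (AE x in lebesgue_on {a<..<b}. u x = 0)"
  proof
    assume "AE x in lebesgue_on {a<..<b}. u x = 0"
    then have "(LINT x|lebesgue_on {a<..<b}. (norm (u x))\<^sup>2) = 0"
      by (intro integral_eq_zero_AE) auto
    moreover have "(LINT x|lebesgue_on {a<..<b}. (norm (u x))\<^sup>2) = integral {a..b} (\<lambda>x. (norm (u x))\<^sup>2)"
      by (intro continuous_integrable_Ioo continuous_intros cont)
    moreover have "(\<lambda>x. (norm (u x))\<^sup>2) integrable_on {a..b}"
      by (intro integrable_continuous_real continuous_intros cont)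
    ultimately have "((\<lambda>x. (norm (u x))\<^sup>2) has_integral 0) (cbox a b)"
      by (simp add: has_integral_iff)
    moreover have "continuous_on (cbox a b) (\<lambda>x. (norm (u x))\<^sup>2)"
      unfolding cbox_interval by (intro continuous_intros cont)
    ultimately have zero: "u x = 0" if "x \<in> {a..b}" for x
      using has_integral_0_cbox_imp_0[of a b "\<lambda>x. (norm (u x))\<^sup>2" x] that assms(1) by auto
    have "u' a = 0"
    proof (rule vector_derivative_unique_within)
      show "at a within {a..b} \<noteq> bot"
        using assms(1) by (simp add: trivial_limit_within islimpt_Icc)
      show "(u has_vector_derivative u' a) (at a within {a..b})"
        using C1(1) assms(1) by (simp add: C1_on_def)
      show "(u has_vector_derivative 0) (at a within {a..b})"
        by (rule has_vector_derivative_transform[of a _ _ "\<lambda>_. 0"]) (use assms(1) zero in auto)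
    qed
    then show False using u by simp
  qed
  ultimately have "z \<notin> resolvent_set a b (schrodinger_op a b V h)"
    unfolding resolvent_set_def by fastforce
  then show ?thesis by (simp add: spectrum_of_def)
qed

text \<open>Surjectivity is the Green operator. The bound, and with it injectivity, is obtained by
  transposition: an element \<open>u\<close> of the domain is known only weakly, so it is paired
  with the regular solution \<open>U\<close> of the same equation with right side
  \<open>cnj u\<close>.\<close>

lemma non_eigenvalue_in_resolvent_set:
  fixes V :: "real \<Rightarrow> real"
  assumes "a < b" and V: "continuous_on {a..b} V" and "0 < h"
    and no_ev: "\<not> dirichlet_eigenvalue a b V (h\<^sup>2) z"
  shows "z \<in> resolvent_set a b (schrodinger_op a b V h)"
proof -
  obtain C where C: "0 \<le> C"
    "\<And>\<rho>. \<rho> \<in> L2 a b \<Longrightarrow> \<exists>U U' w. C1_on a b U U' \<and> U a = 0 \<and> U b = 0 \<and> weak_deriv a b U' w \<and>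
       (\<forall>x. - (of_real h)\<^sup>2 * w x + (\<i> * V x - z) * U x = \<rho> x) \<and> norm_L2 a b U \<le> C * norm_L2 a b \<rho>"
    by (rule green_operator[OF assms]) blast
  have bound: "norm_L2 a b u \<le> C * norm_L2 a b (\<lambda>x. g x - z * u x)"
    if ug: "(u, g) \<in> schrodinger_op a b V h" for u g
  proof -
    obtain v w where u: "u \<in> H10 a b" "g \<in> L2 a b" "weak_deriv a b u v" "weak_deriv a b v w"
      and eq: "AE x in lebesgue_on {a<..<b}. g x = - (complex_of_real h)\<^sup>2 * w x + \<i> * complex_of_real (V x) * u x"
      using ug by (auto simp: schrodinger_op_def)
    have L2: "u \<in> L2 a b" "w \<in> L2 a b"
      using weak_derivD u by blast+
    have G_L2: "(\<lambda>x. g x - z * u x) \<in> L2 a b"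
      by (intro L2_diff L2_scale u L2)
    \<comment> \<open>Paired bilinearly with \<open>u\<close>, this right side gives the squared
      norm of \<open>u\<close>; the bound for \<open>U\<close> then becomes the resolvent estimate
      with the same \<open>C\<close>.\<close>
    obtain U U' W where U: "C1_on a b U U'" "U a = 0" "U b = 0" "weak_deriv a b U' W"
      "\<And>x. - (of_real h)\<^sup>2 * W x + (\<i> * V x - z) * U x = cnj (u x)"
      "norm_L2 a b U \<le> C * norm_L2 a b (\<lambda>x. cnj (u x))"
      using C(2)[OF L2_cnj[OF L2(1)]] by blast
    note U_cont = C1_on_continuous[OF U(1)]
    have U_L2: "U \<in> L2 a b" "W \<in> L2 a b" "(\<lambda>x. (\<i> * V x - z) * U x) \<in> L2 a b"
      using weak_derivD(2)[OF U(4)] U_cont by (auto intro!: continuous_L2 continuous_intros V)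
    have u_L2': "(\<lambda>x. (\<i> * V x - z) * u x) \<in> L2 a b"
      by (intro L2_mult_continuous L2 continuous_intros V)
    have "pairing a b (\<lambda>x. g x - z * u x) U =
        pairing a b (\<lambda>x. - (of_real h)\<^sup>2 * w x + (\<i> * V x - z) * u x) U"
      unfolding pairing_def
    proof (rule integral_cong_AE)
      show "AE x in lebesgue_on {a<..<b}. (g x - z * u x) * U x = (- (of_real h)\<^sup>2 * w x + (\<i> * V x - z) * u x) * U x"
        using eq
      proof eventually_elim
        case (elim x)
        then have "g x - z * u x = - (of_real h)\<^sup>2 * w x + (\<i> * V x - z) * u x"
          by (simp only: algebra_simps)
        then show ?case by simp
      qed
    qed (intro borel_measurable_integrable L2_mult_integrable G_L2 U_L2 L2_add L2_scale u_L2' L2)+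
    also have "\<dots> = - (of_real h)\<^sup>2 * pairing a b w U + pairing a b (\<lambda>x. (\<i> * V x - z) * u x) U"
      by (subst pairing_add_left) (intro L2_scale L2 u_L2' U_L2 | simp only: pairing_scale)+
    also have "pairing a b w U = pairing a b u W"
      by (rule second_derivative_symmetric[OF assms(1) u(1,3,4) U(1-4)])
    also have "pairing a b (\<lambda>x. (\<i> * V x - z) * u x) U = pairing a b u (\<lambda>x. (\<i> * V x - z) * U x)"
      by (simp add: pairing_def mult_ac)
    also have "- (of_real h)\<^sup>2 * pairing a b u W + pairing a b u (\<lambda>x. (\<i> * V x - z) * U x) =
        pairing a b u (\<lambda>x. - (of_real h)\<^sup>2 * W x + (\<i> * V x - z) * U x)"
      by (subst pairing_add_right) (intro L2_scale L2 U_L2 | simp only: pairing_scale)+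
    also have "\<dots> = pairing a b u (\<lambda>x. cnj (u x))"
      by (simp only: U(5))
    also have "\<dots> = of_real ((norm_L2 a b u)\<^sup>2)"
      unfolding pairing_def norm_L2_sq by (simp add: complex_norm_square[symmetric] flip: of_real_power)
    finally have "(norm_L2 a b u)\<^sup>2 = norm (pairing a b (\<lambda>x. g x - z * u x) U)"
      by (simp only: norm_of_real abs_power2)
    also have "\<dots> \<le> norm_L2 a b (\<lambda>x. g x - z * u x) * norm_L2 a b U"
      by (rule pairing_bound[OF G_L2 U_L2(1)])
    also have "\<dots> \<le> norm_L2 a b (\<lambda>x. g x - z * u x) * (C * norm_L2 a b u)"
      using U(6) by (intro mult_left_mono norm_L2_nonneg) (simp add: norm_L2_def)
    finally have *: "norm_L2 a b u * norm_L2 a b u \<le> (C * norm_L2 a b (\<lambda>x. g x - z * u x)) * norm_L2 a b u"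
      by (simp add: power2_eq_square mult_ac)
    show ?thesis
    proof (cases "norm_L2 a b u = 0")
      case True
      then show ?thesis using C(1) norm_L2_nonneg by simp
    next
      case False
      then have "0 < norm_L2 a b u" using norm_L2_nonneg[of a b u] by simp
      then show ?thesis using * by (rule mult_right_le_imp_le[rotated])
    qed
  qed
  have inj: "AE x in lebesgue_on {a<..<b}. u x = 0"
    if ug: "(u, g) \<in> schrodinger_op a b V h" and 0: "AE x in lebesgue_on {a<..<b}. g x - z * u x = 0" for u g
  proof -
    have "(LINT x|lebesgue_on {a<..<b}. (norm (g x - z * u x))\<^sup>2) = 0"
      using 0 by (intro integral_eq_zero_AE) auto
    then have "norm_L2 a b u \<le> 0"
      using bound[OF ug] by (simp add: norm_L2_def)
    then have "(LINT x|lebesgue_on {a<..<b}. (norm (u x))\<^sup>2) = 0"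
      using norm_L2_nonneg[of a b u] norm_L2_sq[of a b u] by simp
    moreover have "integrable (lebesgue_on {a<..<b}) (\<lambda>x. (norm (u x))\<^sup>2)"
      using ug weak_derivD(1) by (auto simp: schrodinger_op_def intro!: L2_integrable_sq)
    ultimately show ?thesis
      by (subst (asm) integral_nonneg_eq_0_iff_AE) auto
  qed
  show ?thesis
    unfolding resolvent_set_def
  proof (intro CollectI conjI)
    show "\<forall>f\<in>L2 a b. \<exists>(u, g)\<in>schrodinger_op a b V h. AE x in lebesgue_on {a<..<b}. g x - z * u x = f x"
    proof
      fix f assume f: "f \<in> L2 a b"
      obtain U U' W where U: "C1_on a b U U'" "U a = 0" "U b = 0" "weak_deriv a b U' W"
        "\<And>x. - (of_real h)\<^sup>2 * W x + (\<i> * V x - z) * U x = f x"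
        using C(2)[OF f] by blast
      have wd: "weak_deriv a b U U'" by (rule weak_deriv_C1[OF assms(1) U(1)])
      have "(U, \<lambda>x. f x + z * U x) \<in> schrodinger_op a b V h"
        unfolding schrodinger_op_def
      proof (intro CollectI case_prodI conjI exI AE_I2)
        show "U \<in> H10 a b \<inter> H2 a b"
          using C1_H10[OF assms(1) U(1-3)] wd U(4) by (auto simp: H2_def H1_def)
        show "(\<lambda>x. f x + z * U x) \<in> L2 a b"
          by (intro L2_add L2_scale f weak_derivD(1)[OF wd])
        show "f x + z * U x = - (complex_of_real h)\<^sup>2 * W x + \<i> * complex_of_real (V x) * U x" for x
          unfolding U(5)[of x, symmetric] by (simp add: algebra_simps)
        show "weak_deriv a b U U'" "weak_deriv a b U' W" by (fact wd, fact U(4))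
      qed
      then show "\<exists>(u, g)\<in>schrodinger_op a b V h. AE x in lebesgue_on {a<..<b}. g x - z * u x = f x"
        by (intro bexI[of _ "(U, \<lambda>x. f x + z * U x)"]) auto
    qed
    show "\<forall>(u, g)\<in>schrodinger_op a b V h. (AE x in lebesgue_on {a<..<b}. g x - z * u x = 0) \<longrightarrow>
        (AE x in lebesgue_on {a<..<b}. u x = 0)"
    proof (intro ballI)
      fix p assume p: "p \<in> schrodinger_op a b V h"
      obtain u g where ug: "p = (u, g)" by (cases p)
      show "case p of (u, g) \<Rightarrow> (AE x in lebesgue_on {a<..<b}. g x - z * u x = 0) \<longrightarrow>
          (AE x in lebesgue_on {a<..<b}. u x = 0)"
        unfolding ug prod.case using inj[OF p[unfolded ug]] by (rule impI)
    qed
    show "\<exists>C. \<forall>(u, g)\<in>schrodinger_op a b V h. norm_L2 a b u \<le> C * norm_L2 a b (\<lambda>x. g x - z * u x)"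
      using bound by blast
  qed
qed

lemma spectrum_eq:
  fixes V :: "real \<Rightarrow> real"
  assumes "a < b" "continuous_on {a..b} V" "0 < h"
  shows "spectrum_of a b (schrodinger_op a b V h) = {z. dirichlet_eigenvalue a b V (h\<^sup>2) z}"
  using eigenvalue_in_spectrum[OF assms] non_eigenvalue_in_resolvent_set[OF assms]
  by (auto simp: spectrum_of_def)

subsection \<open>The bottom of the spectrum\<close>

text \<open>The upper bound is taken at the endpoint with the smaller slope. If this is
  \<open>b\<close>, the reflected potential is used and the eigenvalue conjugated, which keeps its
  real part.\<close>

lemma (in increasing_potential) eigenvalue_asymptotics:
  assumes Airy0: "Airy 0 \<noteq> 0" and \<mu>: "\<And>x. airy_Ai x = 0 \<Longrightarrow> x \<le> \<mu>" "airy_Ai \<mu> = 0" "\<mu> < 0" and "0 < \<epsilon>"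
  obtains \<delta>0 where "0 < \<delta>0"
    "\<And>\<delta> z. 0 < \<delta> \<Longrightarrow> \<delta> < \<delta>0 \<Longrightarrow> dirichlet_eigenvalue a b V (\<delta> ^ 3) z \<Longrightarrow>
       Re z \<ge> (- \<mu> / 2 * (min (V' a) (V' b)) powr (2/3) - \<epsilon>) * \<delta>"
    "\<And>\<delta>. 0 < \<delta> \<Longrightarrow> \<delta> < \<delta>0 \<Longrightarrow> \<exists>z. dirichlet_eigenvalue a b V (\<delta> ^ 3) z \<and>
       Re z \<le> (- \<mu> / 2 * (min (V' a) (V' b)) powr (2/3) + \<epsilon>) * \<delta>"
proof -
  obtain \<delta>1 where \<delta>1: "0 < \<delta>1"
    "\<And>\<delta> z. 0 < \<delta> \<Longrightarrow> \<delta> < \<delta>1 \<Longrightarrow> dirichlet_eigenvalue a b V (\<delta> ^ 3) z \<Longrightarrow>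
       Re z \<ge> (- \<mu> / 2 * (min (V' a) (V' b)) powr (2/3) - \<epsilon>) * \<delta>"
    by (rule eigenvalue_lower_bound[OF Airy0 \<mu>(1,3) \<open>0 < \<epsilon>\<close>]) blast+
  have "\<exists>\<delta>2>0. \<forall>\<delta>. 0 < \<delta> \<longrightarrow> \<delta> < \<delta>2 \<longrightarrow> (\<exists>z. dirichlet_eigenvalue a b V (\<delta> ^ 3) z \<and>
       Re z \<le> (- \<mu> / 2 * (min (V' a) (V' b)) powr (2/3) + \<epsilon>) * \<delta>)"
  proof (cases "V' a \<le> V' b")
    case True
    obtain \<delta>2 where "0 < \<delta>2" "\<And>\<delta>. 0 < \<delta> \<Longrightarrow> \<delta> < \<delta>2 \<Longrightarrow> \<exists>z. dirichlet_eigenvalue a b V (\<delta> ^ 3) z \<and>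
       Re z \<le> (- \<mu> / 2 * V' a powr (2/3) + \<epsilon>) * \<delta>"
      by (rule eigenvalue_exists[OF Airy0 \<mu>(2,3) \<open>0 < \<epsilon>\<close>]) blast+
    then show ?thesis using True by (auto simp: min_absorb1)
  next
    case False
    interpret r: increasing_potential a b "\<lambda>x. - V (a + b - x)" "\<lambda>x. V' (a + b - x)" m J1 K
      by (rule reflected)
    obtain \<delta>2 where \<delta>2: "0 < \<delta>2"
      "\<And>\<delta>. 0 < \<delta> \<Longrightarrow> \<delta> < \<delta>2 \<Longrightarrow> \<exists>z. dirichlet_eigenvalue a b (\<lambda>x. - V (a + b - x)) (\<delta> ^ 3) z \<and>
       Re z \<le> (- \<mu> / 2 * V' (a + b - a) powr (2/3) + \<epsilon>) * \<delta>"
      by (rule r.eigenvalue_exists[OF Airy0 \<mu>(2,3) \<open>0 < \<epsilon>\<close>]) blast+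
    have "\<exists>z. dirichlet_eigenvalue a b V (\<delta> ^ 3) z \<and>
       Re z \<le> (- \<mu> / 2 * (min (V' a) (V' b)) powr (2/3) + \<epsilon>) * \<delta>" if \<delta>: "0 < \<delta>" "\<delta> < \<delta>2" for \<delta>
    proof -
      obtain z where z: "dirichlet_eigenvalue a b (\<lambda>x. - V (a + b - x)) (\<delta> ^ 3) z"
        "Re z \<le> (- \<mu> / 2 * V' (a + b - a) powr (2/3) + \<epsilon>) * \<delta>"
        using \<delta>2(2)[OF \<delta>] by blast
      have "dirichlet_eigenvalue a b V (\<delta> ^ 3) (cnj z)"
        using dirichlet_eigenvalue_reflect[OF z(1) ab r.continuous_V] by simp
      then show ?thesis
        using z(2) False by (intro exI[of _ "cnj z"]) (simp add: min_absorb2)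
    qed
    then show ?thesis using \<delta>2(1) by blast
  qed
  then obtain \<delta>2 where "\<delta>2 > 0" "\<And>\<delta>. 0 < \<delta> \<Longrightarrow> \<delta> < \<delta>2 \<Longrightarrow> \<exists>z. dirichlet_eigenvalue a b V (\<delta> ^ 3) z \<and>
       Re z \<le> (- \<mu> / 2 * (min (V' a) (V' b)) powr (2/3) + \<epsilon>) * \<delta>" by blast
  then show ?thesis using that[of "min \<delta>1 \<delta>2"] \<delta>1 by auto
qed

section \<open>Reduction to increasing potentials and the limit\<close>

lemma mean_value_within:
  fixes f :: "real \<Rightarrow> real"
  assumes "\<And>x. x \<in> {a..b} \<Longrightarrow> (f has_real_derivative f' x) (at x within {a..b})"
    and "x \<in> {a..b}" "y \<in> {a..b}"
  obtains \<xi> where "\<xi> \<in> {a..b}" "f y - f x = f' \<xi> * (y - x)" "\<bar>\<xi> - x\<bar> \<le> \<bar>y - x\<bar>"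
proof -
  have *: "\<exists>\<xi>\<in>{s..t}. f t - f s = f' \<xi> * (t - s)" if st: "s \<le> t" "s \<in> {a..b}" "t \<in> {a..b}" for s t
  proof -
    have "(f has_derivative (*) (f' \<xi>)) (at \<xi> within {s..t})" if "s \<le> \<xi>" "\<xi> \<le> t" for \<xi>
    proof -
      have "(f has_real_derivative f' \<xi>) (at \<xi> within {s..t})"
        by (rule DERIV_subset[OF assms(1)]) (use st that in auto)
      then show ?thesis by (simp add: has_field_derivative_def)
    qed
    from mvt_very_simple[OF st(1) this] show ?thesis .
  qed
  show ?thesis
  proof (cases "x \<le> y")
    case True
    then obtain \<xi> where "\<xi> \<in> {x..y}" "f y - f x = f' \<xi> * (y - x)" using * assms by blast
    then show ?thesis using that[of \<xi>] assms by auto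
  next
    case False
    then obtain \<xi> where "\<xi> \<in> {y..x}" "f x - f y = f' \<xi> * (x - y)" using * assms by (meson linear)
    then show ?thesis using that[of \<xi>] assms by (auto simp: algebra_simps)
  qed
qed

lemma increasing_potentialI:
  fixes V V1 V2 :: "real \<Rightarrow> real"
  assumes "a < b"
    and V: "\<And>x. x \<in> {a..b} \<Longrightarrow> (V has_real_derivative V1 x) (at x within {a..b})"
    and V1: "\<And>x. x \<in> {a..b} \<Longrightarrow> (V1 has_real_derivative V2 x) (at x within {a..b})"
    and V2: "continuous_on {a..b} V2"
    and pos: "\<And>x. x \<in> {a..b} \<Longrightarrow> V1 x > 0"
  obtains m J1 K where "increasing_potential a b V V1 m J1 K"
proof -
  have V1_cont: "continuous_on {a..b} V1"
    using V1 by (rule DERIV_continuous_on)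
  have ne: "{a..b} \<noteq> {}" using assms(1) by auto
  obtain s where s: "s \<in> {a..b}" "\<And>x. x \<in> {a..b} \<Longrightarrow> V1 s \<le> V1 x"
    using continuous_attains_inf[OF compact_Icc ne V1_cont] by blast
  obtain t where t: "t \<in> {a..b}" "\<And>x. x \<in> {a..b} \<Longrightarrow> V1 x \<le> V1 t"
    using continuous_attains_sup[OF compact_Icc ne V1_cont] by blast
  obtain K where K: "K > 0" "\<And>x. x \<in> {a..b} \<Longrightarrow> norm (V2 x) \<le> K"
    using compact_imp_bounded[OF compact_continuous_image[OF V2 compact_Icc]]
    unfolding bounded_pos by blast
  have "increasing_potential a b V V1 (V1 s) (V1 t) K"
  proof
    fix x y assume xy: "a \<le> x" "x \<le> y" "y \<le> b"
    then have "x \<in> {a..b}" "y \<in> {a..b}" by auto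
    then obtain \<xi> where \<xi>: "\<xi> \<in> {a..b}" "V y - V x = V1 \<xi> * (y - x)"
      using mean_value_within[OF V, of x y] by blast
    show "V1 s * (y - x) \<le> V y - V x" "V y - V x \<le> V1 t * (y - x)"
      unfolding \<xi>(2) using s(2)[OF \<xi>(1)] t(2)[OF \<xi>(1)] xy by (auto intro: mult_right_mono)
  next
    fix x y assume xy: "x \<in> {a..b}" "y \<in> {a..b}"
    obtain \<xi> where \<xi>: "\<xi> \<in> {a..b}" "V y - V x = V1 \<xi> * (y - x)" "\<bar>\<xi> - x\<bar> \<le> \<bar>y - x\<bar>"
      using mean_value_within[OF V xy] by blast
    \<comment> \<open>The location of \<open>\<xi>\<close> turns this second use of the mean value
      theorem into a quadratic remainder.\<close>
    obtain \<eta> where \<eta>: "\<eta> \<in> {a..b}" "V1 \<xi> - V1 x = V2 \<eta> * (\<xi> - x)"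
      using mean_value_within[OF V1 xy(1) \<xi>(1)] by blast
    have "V y - V x - V1 x * (y - x) = (V1 \<xi> - V1 x) * (y - x)"
      unfolding \<xi>(2) by (simp add: algebra_simps)
    also have "\<bar>\<dots>\<bar> = \<bar>V2 \<eta>\<bar> * \<bar>\<xi> - x\<bar> * \<bar>y - x\<bar>"
      unfolding \<eta>(2) abs_mult ..
    also have "\<dots> \<le> K * \<bar>y - x\<bar> * \<bar>y - x\<bar>"
      using K(2)[OF \<eta>(1)] K(1) \<xi>(3) by (intro mult_right_mono mult_mono) auto
    also have "\<dots> = K * (y - x)\<^sup>2"
      by (simp add: power2_eq_square mult.assoc)
    finally show "\<bar>V y - V x - V1 x * (y - x)\<bar> \<le> K * (y - x)\<^sup>2" .
  qed (use assms(1) pos s t K in auto)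
  then show ?thesis by (rule that)
qed

text \<open>Serves decreasing potentials. In contrast to \<open>dirichlet_eigenvalue_reflect\<close>
  the operator is merely transported by a change of variable, so the spectral parameter is not
  conjugated.\<close>

lemma dirichlet_eigenvalue_reverse:
  assumes "dirichlet_eigenvalue a b V e z" "a < b" "continuous_on {a..b} V"
  shows "dirichlet_eigenvalue a b (\<lambda>x. V (a + b - x)) e z"
proof -
  obtain u u' where u: "ode_sol a b (\<lambda>x. (\<i> * V x - z) / of_real e) u u'" "u a = 0" "u b = 0" "u' a \<noteq> 0"
    using assms(1) by (auto simp: dirichlet_eigenvalue_def)
  note rev = ode_sol_reverse[OF u(1)]
  have "continuous_on {a..b} (\<lambda>x. (\<i> * of_real (V (a + b - x)) - z) / of_real e)"
    unfolding divide_inverse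
    by (intro continuous_intros continuous_on_compose2[OF assms(3), of "{a..b}" "\<lambda>x. a + b - x"]) auto
  from ode_sol_zero(2)[OF rev this, of b] have "- u' (a + b - a) \<noteq> 0"
    using u assms(2) by auto
  then show ?thesis
    unfolding dirichlet_eigenvalue_def using rev u
    by (intro exI[of _ "\<lambda>x. u (a + b - x)"] exI[of _ "\<lambda>x. - u' (a + b - x)"]) auto
qed

lemma dirichlet_eigenvalue_reverse_iff:
  assumes "a < b" "continuous_on {a..b} V"
  shows "dirichlet_eigenvalue a b (\<lambda>x. V (a + b - x)) e z \<longleftrightarrow> dirichlet_eigenvalue a b V e z"
proof
  have "continuous_on {a..b} (\<lambda>x. V (a + b - x))"
    by (rule continuous_on_compose2[OF assms(2)]) (auto intro!: continuous_intros)
  then show "dirichlet_eigenvalue a b (\<lambda>x. V (a + b - x)) e z \<Longrightarrow> dirichlet_eigenvalue a b V e z"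
    using dirichlet_eigenvalue_reverse[of a b "\<lambda>x. V (a + b - x)"] assms(1) by simp
qed (rule dirichlet_eigenvalue_reverse[OF _ assms])

lemma smooth_on_Icc_derivatives:
  fixes V V' :: "real \<Rightarrow> real"
  assumes "a < b" "smooth_on {a..b} V"
    and "\<And>x. x \<in> {a..b} \<Longrightarrow> (V has_real_derivative V' x) (at x within {a..b})"
  obtains V2 where "\<And>x. x \<in> {a..b} \<Longrightarrow> (V' has_real_derivative V2 x) (at x within {a..b})"
    "continuous_on {a..b} V2"
proof -
  obtain D where D: "\<And>x. x \<in> {a..b} \<Longrightarrow> D 0 x = V x"
    "\<And>k x. x \<in> {a..b} \<Longrightarrow> (D k has_vector_derivative D (Suc k) x) (at x within {a..b})"
    using assms(2) unfolding smooth_on_def by blast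
  \<comment> \<open>One-sided derivatives on a nondegenerate interval are unique, so the given
    \<open>V'\<close> agrees with the sequence from \<open>smooth_on\<close>.\<close>
  have eq: "D 1 x = V' x" if x: "x \<in> {a..b}" for x
  proof -
    have "(V has_vector_derivative D 1 x) (at x within {a..b})"
      by (rule has_vector_derivative_transform[OF x D(1)[symmetric]]) (use D(2)[OF x, of 0] in auto)
    then show ?thesis
      using assms(1,3) x vector_derivative_unique_within_closed_interval[of a b x V "D 1 x" "V' x"]
      by (auto simp: has_real_derivative_iff_has_vector_derivative)
  qed
  have "(V' has_real_derivative D 2 x) (at x within {a..b})" if x: "x \<in> {a..b}" for x
    unfolding has_real_derivative_iff_has_vector_derivative
    by (rule has_vector_derivative_transform[OF x eq[symmetric]])
      (use D(2)[OF x, of 1] in \<open>auto simp: numeral_2_eq_2\<close>)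
  moreover have "continuous_on {a..b} (D 2)"
    unfolding continuous_on_eq_continuous_within
    using has_vector_derivative_continuous[OF D(2)] by blast
  ultimately show ?thesis using that by blast
qed

lemma monotone_eigenvalue_asymptotics:
  fixes V V' :: "real \<Rightarrow> real"
  assumes "a < b" "smooth_on {a..b} V"
    and V': "\<And>x. x \<in> {a..b} \<Longrightarrow> (V has_real_derivative V' x) (at x within {a..b})"
    and nz: "\<And>x. x \<in> {a..b} \<Longrightarrow> V' x \<noteq> 0"
    and \<mu>: "\<And>x. airy_Ai x = 0 \<Longrightarrow> x \<le> \<mu>" "airy_Ai \<mu> = 0" "\<mu> < 0" and "0 < \<epsilon>"
  obtains \<delta>0 where "0 < \<delta>0"
    "\<And>\<delta> z. 0 < \<delta> \<Longrightarrow> \<delta> < \<delta>0 \<Longrightarrow> dirichlet_eigenvalue a b V (\<delta> ^ 3) z \<Longrightarrow>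
       Re z \<ge> (- \<mu> / 2 * (min \<bar>V' a\<bar> \<bar>V' b\<bar>) powr (2/3) - \<epsilon>) * \<delta>"
    "\<And>\<delta>. 0 < \<delta> \<Longrightarrow> \<delta> < \<delta>0 \<Longrightarrow> \<exists>z. dirichlet_eigenvalue a b V (\<delta> ^ 3) z \<and>
       Re z \<le> (- \<mu> / 2 * (min \<bar>V' a\<bar> \<bar>V' b\<bar>) powr (2/3) + \<epsilon>) * \<delta>"
proof -
  obtain V2 where V2: "\<And>x. x \<in> {a..b} \<Longrightarrow> (V' has_real_derivative V2 x) (at x within {a..b})"
    "continuous_on {a..b} V2"
    by (rule smooth_on_Icc_derivatives[OF assms(1-3)]) auto
  \<comment> \<open>A zero at 0 would lie to the right of \<open>\<mu> < 0\<close>.\<close>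
  have Airy0: "Airy 0 \<noteq> 0"
    using Airy_of_real[of 0] \<mu>(1)[of 0] \<mu>(3) by auto
  have V'_cont: "continuous_on {a..b} V'" by (rule DERIV_continuous_on[OF V2(1)])
  have V_cont: "continuous_on {a..b} V" by (rule DERIV_continuous_on[OF V'])
  have ab_mem: "a \<in> {a..b}" "b \<in> {a..b}" using assms(1) by auto
  show ?thesis
  proof (cases "V' a > 0")
    case True
    \<comment> \<open>A continuous derivative without zeros keeps its sign.\<close>
    have pos: "V' x > 0" if x: "x \<in> {a..b}" for x
    proof (rule ccontr)
      assume "\<not> V' x > 0"
      then obtain y where "a \<le> y" "y \<le> x" "V' y = 0"
        using IVT2'[of V' x 0 a] continuous_on_subset[OF V'_cont, of "{a..x}"] True x by auto
      then show False using nz[of y] x by auto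
    qed
    obtain m J1 K where "increasing_potential a b V V' m J1 K"
      by (rule increasing_potentialI[OF assms(1) V' V2 pos]) auto
    from increasing_potential.eigenvalue_asymptotics[OF this Airy0 \<mu> \<open>0 < \<epsilon>\<close>] that
    show ?thesis using pos[OF ab_mem(1)] pos[OF ab_mem(2)] by (metis abs_of_pos)
  next
    case False
    have neg: "V' x < 0" if x: "x \<in> {a..b}" for x
    proof (rule ccontr)
      assume "\<not> V' x < 0"
      then obtain y where "a \<le> y" "y \<le> x" "V' y = 0"
        using IVT'[of V' a 0 x] continuous_on_subset[OF V'_cont, of "{a..x}"] False x by auto
      then show False using nz[of y] x by auto
    qed
    define W where "W = (\<lambda>x. V (a + b - x))"
    define W1 where "W1 = (\<lambda>x. - V' (a + b - x))"
    define W2 where "W2 = (\<lambda>x. V2 (a + b - x))"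
    have refl: "((\<lambda>x. f (a + b - x)) has_real_derivative - f' (a + b - x)) (at x within {a..b})"
      if f: "\<And>x. x \<in> {a..b} \<Longrightarrow> (f has_real_derivative f' x) (at x within {a..b})" and x: "x \<in> {a..b}"
      for f f' :: "real \<Rightarrow> real" and x
    proof -
      have "((\<lambda>x. a + b - x) has_real_derivative - 1) (at x within {a..b})"
        by (auto intro!: derivative_eq_intros)
      moreover have "(\<lambda>x. a + b - x) ` {a..b} = {a..b}"
        by (auto simp: image_iff intro!: bexI[of _ "a + b - _"])
      moreover have "a + b - x \<in> {a..b}" using x by auto
      ultimately have "((f \<circ> (\<lambda>x. a + b - x)) has_real_derivative f' (a + b - x) * - 1) (at x within {a..b})"
        using f[of "a + b - x"] by (intro DERIV_image_chain) auto
      then show ?thesis by (simp add: o_def)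
    qed
    have W: "(W has_real_derivative W1 x) (at x within {a..b})" if "x \<in> {a..b}" for x
      unfolding W_def W1_def using refl[OF V' that] .
    have W1: "(W1 has_real_derivative W2 x) (at x within {a..b})" if "x \<in> {a..b}" for x
      unfolding W1_def W2_def using DERIV_minus[OF refl[OF V2(1) that]] by simp
    have W2: "continuous_on {a..b} W2"
      unfolding W2_def by (rule continuous_on_compose2[OF V2(2)]) (auto intro!: continuous_intros)
    have W1_pos: "W1 x > 0" if "x \<in> {a..b}" for x
      using neg[of "a + b - x"] that by (auto simp: W1_def)
    obtain m J1 K where inc: "increasing_potential a b W W1 m J1 K"
      by (rule increasing_potentialI[OF assms(1) W W1 W2 W1_pos]) auto
    have min_eq: "min (W1 a) (W1 b) = min \<bar>V' a\<bar> \<bar>V' b\<bar>"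
      using neg[OF ab_mem(1)] neg[OF ab_mem(2)] by (simp add: W1_def min.commute)
    have ev: "dirichlet_eigenvalue a b W e z \<longleftrightarrow> dirichlet_eigenvalue a b V e z" for e z
      unfolding W_def by (rule dirichlet_eigenvalue_reverse_iff[OF assms(1) V_cont])
    show ?thesis
      by (rule increasing_potential.eigenvalue_asymptotics[OF inc Airy0 \<mu> \<open>0 < \<epsilon>\<close>])
        (unfold min_eq ev, auto intro: that)
  qed
qed

theorem theorem1p2:
  fixes h0 a b \<mu>1 :: real and V V' :: "real \<Rightarrow> real"
  assumes "h0 > 0" and "a < b"
    and "smooth_on {a..b} V"
    and "\<And>x. x \<in> {a..b} \<Longrightarrow> (V has_real_derivative V' x) (at x within {a..b})"
    and "\<And>x. x \<in> {a..b} \<Longrightarrow> V' x \<noteq> 0"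
    and "\<mu>1 < 0" and "airy_Ai \<mu>1 = 0" and "\<And>x. airy_Ai x = 0 \<Longrightarrow> x \<le> \<mu>1"
  shows "((\<lambda>h. (INF z\<in>spectrum_of a b (schrodinger_op a b V h). ereal (Re z)) /
                 ereal (h powr (2/3)))
           \<longlongrightarrow> ereal (\<bar>\<mu>1\<bar> / 2 * (min \<bar>V' a\<bar> \<bar>V' b\<bar>) powr (2/3)))
         (at 0 within {0<..<h0})"
proof -
  define c where "c = \<bar>\<mu>1\<bar> / 2 * (min \<bar>V' a\<bar> \<bar>V' b\<bar>) powr (2/3)"
  define X where "X = (\<lambda>h. (INF z\<in>spectrum_of a b (schrodinger_op a b V h). ereal (Re z)) / ereal (h powr (2/3)))"
  have V_cont: "continuous_on {a..b} V" by (rule DERIV_continuous_on[OF assms(4)])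
  \<comment> \<open>In the extended reals an empty spectrum would give an infinite infimum; the
    upper bound rules this out for small \<open>h\<close>.\<close>
  have squeeze: "\<forall>\<^sub>F h in at 0 within {0<..<h0}. ereal (c - \<epsilon>) \<le> X h \<and> X h \<le> ereal (c + \<epsilon>)"
    if \<epsilon>: "0 < \<epsilon>" for \<epsilon>
  proof -
    obtain \<delta>0 where \<delta>0: "0 < \<delta>0"
      "\<And>\<delta> z. 0 < \<delta> \<Longrightarrow> \<delta> < \<delta>0 \<Longrightarrow> dirichlet_eigenvalue a b V (\<delta> ^ 3) z \<Longrightarrow>
         Re z \<ge> (- \<mu>1 / 2 * (min \<bar>V' a\<bar> \<bar>V' b\<bar>) powr (2/3) - \<epsilon>) * \<delta>"
      "\<And>\<delta>. 0 < \<delta> \<Longrightarrow> \<delta> < \<delta>0 \<Longrightarrow> \<exists>z. dirichlet_eigenvalue a b V (\<delta> ^ 3) z \<and>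
         Re z \<le> (- \<mu>1 / 2 * (min \<bar>V' a\<bar> \<bar>V' b\<bar>) powr (2/3) + \<epsilon>) * \<delta>"
      by (rule monotone_eigenvalue_asymptotics[OF assms(2-5,8,7,6) \<epsilon>]) blast+
    have "ereal (c - \<epsilon>) \<le> X h \<and> X h \<le> ereal (c + \<epsilon>)" if h: "0 < h" "h < \<delta>0 powr (3/2)" for h
    proof -
      \<comment> \<open>This substitution turns \<open>h\<^sup>2\<close> into
        \<open>\<delta> ^ 3\<close> and the normalisation into division by
        \<open>\<delta>\<close>.\<close>
      define \<delta> where "\<delta> = h powr (2/3)"
      have \<delta>: "0 < \<delta>" using h by (simp add: \<delta>_def)
      have "\<delta> < (\<delta>0 powr (3/2)) powr (2/3)"
        unfolding \<delta>_def using h by (intro powr_less_mono2) auto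
      then have \<delta>_less: "\<delta> < \<delta>0" using \<delta>0(1) by (simp add: powr_powr)
      have "\<delta> ^ 3 = \<delta> powr 3" using \<delta> by simp
      also have "\<dots> = h powr 2" unfolding \<delta>_def powr_powr by simp
      finally have \<delta>3: "\<delta> ^ 3 = h\<^sup>2" using h by simp
      define S where "S = spectrum_of a b (schrodinger_op a b V h)"
      have S: "S = {z. dirichlet_eigenvalue a b V (\<delta> ^ 3) z}"
        unfolding S_def \<delta>3 by (rule spectrum_eq[OF assms(2) V_cont h(1)])
      have lower: "ereal ((c - \<epsilon>) * \<delta>) \<le> (INF z\<in>S. ereal (Re z))"
        using \<delta>0(2)[OF \<delta> \<delta>_less] assms(6) by (intro INF_greatest) (simp add: S c_def)
      obtain z where z: "z \<in> S" "Re z \<le> (c + \<epsilon>) * \<delta>"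
        using \<delta>0(3)[OF \<delta> \<delta>_less] assms(6) by (auto simp: S c_def)
      have upper: "(INF z\<in>S. ereal (Re z)) \<le> ereal ((c + \<epsilon>) * \<delta>)"
        using z by (intro INF_lower2[of z]) auto
      have "ereal ((c - \<epsilon>) * \<delta>) / ereal \<delta> \<le> X h" "X h \<le> ereal ((c + \<epsilon>) * \<delta>) / ereal \<delta>"
        unfolding X_def S_def[symmetric] \<delta>_def[symmetric] 
        by (intro ereal_divide_right_mono lower upper; use \<delta> in simp)+
      then show ?thesis using \<delta> by simp
    qed
    moreover have "0 < \<delta>0 powr (3/2)" using \<delta>0(1) by simp
    ultimately show ?thesis
      unfolding eventually_at by (intro exI[of _ "\<delta>0 powr (3/2)"]) (auto simp: dist_real_def)
  qed
  have "(X \<longlongrightarrow> ereal c) (at 0 within {0<..<h0})"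
  proof (rule order_tendstoI)
    fix l assume "l < ereal c"
    \<comment> \<open>For an infinite \<open>l\<close> any \<open>\<epsilon>\<close> works;
      otherwise half the gap is taken.\<close>
    then obtain \<epsilon> where \<epsilon>: "0 < \<epsilon>" "l < ereal (c - \<epsilon>)"
    proof (cases l)
      case (real r)
      then show ?thesis using \<open>l < ereal c\<close> by (intro that[of "(c - r) / 2"]) (auto simp: field_simps)
    qed (auto intro: that[of 1])
    show "\<forall>\<^sub>F h in at 0 within {0<..<h0}. l < X h"
      using squeeze[OF \<epsilon>(1)] by eventually_elim (use \<epsilon>(2) in auto)
  next
    fix l assume "ereal c < l"
    then obtain \<epsilon> where \<epsilon>: "0 < \<epsilon>" "ereal (c + \<epsilon>) < l"
    proof (cases l)
      case (real r)
      then show ?thesis using \<open>ereal c < l\<close> by (intro that[of "(r - c) / 2"]) (auto simp: field_simps)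
    qed (auto intro: that[of 1])
    show "\<forall>\<^sub>F h in at 0 within {0<..<h0}. X h < l"
      using squeeze[OF \<epsilon>(1)] by eventually_elim (use \<epsilon>(2) in auto)
  qed
  then show ?thesis by (simp add: X_def c_def)
qed

end
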